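(* Let $V_{\text{off}}$ be the offline velocity space and $Q_{\text{off}}$ the coarse pressure space of the offline GMsFEM for the Stokes problem in the perforated domain $\Omega^{\epsilon}$, as defined in the context. Assume that the continuous inf-sup condition holds: there is a constant $C_{\text{cont}}>0$ such that for every $p\in L^2(\Omega^{\epsilon})$ with zero mean, $$\sup_{v\in (H^1_0(\Omega^{\epsilon}))^2,\ v\neq 0} \frac{\int_{\Omega^{\epsilon}} \operatorname{div}(v)\,p}{\|v\|_{H^1(\Omega^{\epsilon})}} \ \geq\ C_{\text{cont}} \,\|p\|_{L^2(\Omega^{\epsilon})}.$$ Then there is a constant $C_{\text{infsup}}>0$ such that for all $p\in Q_{\text{off}}$, $$\sup_{u\in V_{\text{off}},\ u\neq 0} \frac{\int_{\Omega^{\epsilon}} \operatorname{div}(u)\,p}{\|u\|_{H^1(\Omega^{\epsilon})}} \ \geq\ C_{\text{infsup}}\, \|p\|_{L^2(\Omega^{\epsilon})}.$$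
   Context: **Domain and meshes.** $\Omega\subset\mathbb{R}^2$ is a bounded domain, $\mathcal{B}^{\epsilon}$ is the set of perforations, and $\Omega^{\epsilon}=\Omega\setminus\mathcal{B}^{\epsilon}$ is assumed polygonally bounded. $\mathcal{T}^H$ is a coarse triangular partition of $\Omega^{\epsilon}$ of mesh size $H$, whose blocks may have non-straight boundaries because of the perforations; every coarse block is path-connected. $\mathcal{T}^h$ is a conforming refinement of $\mathcal{T}^H$ of mesh size $h$, $0<h\ll H<1$, resolving the perforations. $N_v$, $N_e$ are the numbers of coarse nodes and coarse edges. The coarse neighborhood of a coarse node (resp. coarse edge) is the union of all coarse blocks whose closure contains that node (resp. edge); for the Stokes problem both kinds are used, and they are numbered $\omega_i^{\epsilon}$, $1\le i\le N_e+N_v$. **Spaces.** The Stokes problem has velocity space $(H^1_0(\Omega^{\epsilon}))^2$ and pressure space $L^2_0(\Omega^{\epsilon})$ ($L^2$ functions with zero average on $\Omega^\epsilon$). The fine-grid velocity space $V_h$ consists of piecewise $P^2$ vector fields on $\mathcal{T}^h$, the fine-grid pressure space $Q_h$ of piecewise constants on $\mathcal{T}^h$; $V_h^i,Q_h^i$ are their restrictions to $\omega_i^{\epsilon}$ and $V_{h,0}^i\subset V_h^i$ is the subspace of functions vanishing on $\partial\omega_i^{\epsilon}$. **Snapshot space.** Let $e_1,\dots,e_{S_i}$ be the fine-grid edges on $\partial\omega_i^{\epsilon}\setminus\partial\mathcal{B}^{\epsilon}$ and $\delta_l^i$ the piecewise constant function equal to $1$ on $e_l$ and $0$ on the other fine-grid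 edges. The snapshots $\psi_l^{i,\text{snap}}=u_l^i$ are the velocities of the fine-grid solutions $(u_l^i,p_l^i)$ (with $u_l^i\in V_h^i$, $p_l^i\in Q_h^i$) of $$\int_{\omega_i^{\epsilon}}\nabla u_l^i:\nabla v-\int_{\omega_i^{\epsilon}}p_l^i\operatorname{div}v=0\ \ \forall v\in V_{h,0}^i,\qquad \int_{\omega_i^{\epsilon}}q\operatorname{div}u_l^i=\int_{\omega_i^{\epsilon}}c\,q\ \ \forall q\in Q_h^i,$$ with $u_l^i=0$ on $\partial\mathcal{B}^{\epsilon}$, $u_l^i=(\delta_l^i,0)$ or $(0,\delta_l^i)$ on $\partial\omega_i^{\epsilon}\setminus\partial\mathcal{B}^{\epsilon}$, and the constant $c=\frac1{|\omega_i^{\epsilon}|}\int_{\partial\omega_i^{\epsilon}\setminus\partial\mathcal{B}^{\epsilon}}u_l^i\cdot n_i\,ds$. $V_{\text{snap}}$ is the span of all $\psi_l^{i,\text{snap}}$, $1\le l\le 2S_i$, $1\le i\le N_e+N_v$. **Offline space.** Let $\{\chi_i\}$ be partition of unity functions associated with the coarse nodes and the midpoints of coarse edges. In the span of the snapshots of $\omega_i^{\epsilon}$ solve the eigenvalue problem $a_i(\widetilde\Phi,\psi)=\lambda\, s_i(\widetilde\Phi,\psi)$ for all $\psi$ in that span, where $a_i(u,v)=\int_{\omega_i^{\epsilon}}\nabla u:\nabla v$ and $s_i(u,v)=\int_{\omega_i^{\epsilon}}|\nabla\chi_i|^2u\cdot v$, with eigenvalues in increasing order and eigenfunctions $\widetilde\Phi_k^{i,\text{off}}=(\widetilde\Phi_{x_1,k}^{i,\text{off}},\widetilde\Phi_{x_2,k}^{i,\text{off}})$;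 the first $M_i$ eigenfunctions are selected. For a field $w$ supported in $\omega_i^{\epsilon}$, its Stokes extension $\mathcal{H}(w)$ is defined on each coarse block $K\subset\omega_i^{\epsilon}$ as the minimizer of $\|\nabla\Phi\|_{L^2(K)}$ subject to $\Phi=w$ on $\partial K$ and $\operatorname{div}\Phi=\frac1{|K|}\int_{\partial K}w\cdot n\,ds$ in $K$. Set $\Phi_{x_1,k}^{i,\text{off}}=\mathcal{H}((\chi_i\widetilde\Phi_{x_1,k}^{i,\text{off}},0))$ and $\Phi_{x_2,k}^{i,\text{off}}=\mathcal{H}((0,\chi_i\widetilde\Phi_{x_2,k}^{i,\text{off}}))$. Then $V_{\text{off}}$ is the span of all $\Phi_{x_1,k}^{i,\text{off}},\Phi_{x_2,k}^{i,\text{off}}$, $1\le i\le N_e+N_v$, $1\le k\le M_i$; each basis function is supported in its coarse neighborhood. **Coarse pressure space.** $Q_{\text{off}}$ is the space of functions that are piecewise constant on the coarse mesh $\mathcal{T}^H$; as elements of the pressure space $L^2_0(\Omega^{\epsilon})$ they have zero mean. **Standing property of the basis.** For each interior coarse edge $E_i$ there is an offline basis function $\Phi_i^{\text{off}}$, associated with (and supported in) the coarse neighborhood $\omega_i^{\epsilon}$ of that edge, such that $\int_{E_i}\Phi_i^{\text{off}}\cdot n_i\neq0$.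
   Formalization: The partition of unity functions are additionally assumed to vanish on every coarse edge (outer boundary edges included) not containing their node or edge, as Lagrange functions do; without this, interior-edge basis functions can carry flux through the outer boundary and the claim can fail. *)

theory Defs
  imports "HOL-Analysis.Analysis"
begin

type_synonym pt = "real^2"
type_synonym field = "real^2 \<Rightarrow> real^2"

primrec Ck :: "nat \<Rightarrow> (pt \<Rightarrow> real) \<Rightarrow> bool" where
  "Ck 0 f \<longleftrightarrow> continuous_on UNIV f"
| "Ck (Suc k) f \<longleftrightarrow> (\<forall>x. f differentiable (at x)) \<and>
     (\<forall>v. Ck k (\<lambda>x. frechet_derivative f (at x) v))"

definition test_functions :: "pt set \<Rightarrow> (pt \<Rightarrow> real) set" where
  "test_functions U = {\<phi>. (\<forall>k. Ck k \<phi>) \<and> (\<exists>C. compact C \<and> C \<subseteq> U \<and> (\<forall>x. x \<notin> C \<longrightarrow> \<phi> x = 0))}"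

definition square_integrable :: "pt set \<Rightarrow> (pt \<Rightarrow> 'b::euclidean_space) \<Rightarrow> bool" where
  "square_integrable U f \<longleftrightarrow> f \<in> borel_measurable (lebesgue_on U) \<and>
     integrable (lebesgue_on U) (\<lambda>x. (norm (f x))\<^sup>2)"

definition l2_norm :: "pt set \<Rightarrow> (pt \<Rightarrow> 'b::euclidean_space) \<Rightarrow> real" where
  "l2_norm U f = sqrt (\<integral>x. (norm (f x))\<^sup>2 \<partial>lebesgue_on U)"

definition has_weak_partial :: "pt set \<Rightarrow> 2 \<Rightarrow> (pt \<Rightarrow> real) \<Rightarrow> (pt \<Rightarrow> real) \<Rightarrow> bool" where
  "has_weak_partial U j f g \<longleftrightarrow> square_integrable U f \<and> square_integrable U g \<and>
     (\<forall>\<phi>\<in>test_functions U.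
        (\<integral>x. f x * frechet_derivative \<phi> (at x) (axis j 1) \<partial>lebesgue_on U)
        = - (\<integral>x. g x * \<phi> x \<partial>lebesgue_on U))"

text \<open>Determined almost everywhere in \<open>U\<close>; meaningful only if a weak derivative exists.\<close>

definition weak_partial :: "pt set \<Rightarrow> 2 \<Rightarrow> (pt \<Rightarrow> real) \<Rightarrow> pt \<Rightarrow> real" where
  "weak_partial U j f = (SOME g. has_weak_partial U j f g)"

definition grad :: "pt set \<Rightarrow> field \<Rightarrow> pt \<Rightarrow> real^2^2" where
  "grad U u x = (\<chi> i j. weak_partial U j (\<lambda>y. u y $ i) x)"

definition divergence :: "pt set \<Rightarrow> field \<Rightarrow> pt \<Rightarrow> real" where
  "divergence U u x = trace (grad U u x)"

definition H1 :: "pt set \<Rightarrow> field set" where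
  "H1 U = {u. \<forall>i j. \<exists>g. has_weak_partial U j (\<lambda>x. u x $ i) g}"

definition h1_norm :: "pt set \<Rightarrow> field \<Rightarrow> real" where
  "h1_norm U u = sqrt ((l2_norm U u)\<^sup>2 + (l2_norm U (grad U u))\<^sup>2)"

definition H1_0 :: "pt set \<Rightarrow> field set" where
  "H1_0 U = {u \<in> H1 U. \<forall>\<epsilon>>0. \<exists>\<phi>. (\<forall>i. (\<lambda>x. \<phi> x $ i) \<in> test_functions U) \<and>
     h1_norm U (\<lambda>x. u x - \<phi> x) < \<epsilon>}"

text \<open>The inner product on \<open>real^2^2\<close> is the Frobenius product.\<close>

definition grad_form :: "pt set \<Rightarrow> field \<Rightarrow> field \<Rightarrow> real" where
  "grad_form U u v = (\<integral>x. grad U u x \<bullet> grad U v x \<partial>lebesgue_on U)"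

text \<open>The supremum over \<open>v \<noteq> 0\<close> of the inf-sup quotient, taken in \<open>[0,\<infinity>]\<close>. On a linear
  space \<open>V\<close> other than \<open>{0}\<close>, replacing negative quotients by \<open>0\<close> does not change it
  (replace \<open>v\<close> by \<open>-v\<close>), and the supremum over the empty family is \<open>0\<close>.\<close>

definition sup_quotient :: "pt set \<Rightarrow> field set \<Rightarrow> (pt \<Rightarrow> real) \<Rightarrow> ennreal" where
  "sup_quotient U V p = (SUP v\<in>{v\<in>V. h1_norm U v \<noteq> 0}.
     ennreal ((\<integral>x. divergence U v x * p x \<partial>lebesgue_on U) / h1_norm U v))"

definition L2_0 :: "pt set \<Rightarrow> (pt \<Rightarrow> real) set" where
  "L2_0 U = {p. square_integrable U p \<and> (\<integral>x. p x \<partial>lebesgue_on U) = 0}"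

definition field_span :: "field set \<Rightarrow> field set" where
  "field_span F = {(\<lambda>x. \<Sum>f\<in>S. c f *\<^sub>R f x) | S c. finite S \<and> S \<subseteq> F}"


definition triangular_mesh :: "pt set set \<Rightarrow> bool" where
  "triangular_mesh \<T> \<longleftrightarrow> triangulation \<T> \<and> (\<forall>t\<in>\<T>. 2 simplex t)"

definition mesh_edges :: "pt set set \<Rightarrow> pt set set" where
  "mesh_edges \<T> = {e. 1 simplex e \<and> (\<exists>t\<in>\<T>. e face_of t)}"

definition mesh_vertices :: "pt set set \<Rightarrow> pt set" where
  "mesh_vertices \<T> = {x. \<exists>t\<in>\<T>. x extreme_point_of t}"

definition lagrange_nodes :: "pt set set \<Rightarrow> pt set" where
  "lagrange_nodes \<T> = mesh_vertices \<T> \<union> {midpoint a b | a b. closed_segment a b \<in> mesh_edges \<T>}"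

definition mesh_size :: "pt set set \<Rightarrow> real" where
  "mesh_size \<S> = Max (diameter ` \<S>)"

definition edge_integral :: "pt set \<Rightarrow> (pt \<Rightarrow> real) \<Rightarrow> real" where
  "edge_integral e f = (THE s. \<exists>a b. e = closed_segment a b \<and>
     s = dist a b * integral {0..1} (\<lambda>\<tau>. f (linepath a b \<tau>)))"

text \<open>Unit normal to the edge \<open>e\<close> of the triangle \<open>t\<close>, pointing out of \<open>t\<close>.\<close>

definition outer_normal :: "pt set \<Rightarrow> pt set \<Rightarrow> pt" where
  "outer_normal t e = (THE n. norm n = 1 \<and> (\<forall>x\<in>t. \<forall>y\<in>e. n \<bullet> (x - y) \<le> 0))"

text \<open>Coarse blocks and coarse neighborhoods are handled as sets \<open>R\<close> of fine triangles.
  The corresponding open region is \<open>interior (\<Union>R)\<close>. Its boundary consists of the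
  edges belonging to exactly one triangle of \<open>R\<close>; each is paired with that triangle, which
  determines the outward normal.\<close>

definition boundary_edges :: "pt set set \<Rightarrow> (pt set \<times> pt set) set" where
  "boundary_edges R = {(t, e). t \<in> R \<and> e \<in> mesh_edges {t} \<and> (\<forall>t'\<in>R. e \<subseteq> t' \<longrightarrow> t' = t)}"

definition flux :: "(pt set \<times> pt set) set \<Rightarrow> field \<Rightarrow> real" where
  "flux S w = (\<Sum>(t, e)\<in>S. edge_integral e (\<lambda>x. w x \<bullet> outer_normal t e))"

abbreviation area :: "pt set set \<Rightarrow> real" where
  "area R \<equiv> measure lebesgue (\<Union>R)"

text \<open>\<open>\<Phi> = g\<close> on the boundary of the region of \<open>R\<close>, in the sense of traces.\<close>

definition has_trace :: "pt set set \<Rightarrow> field \<Rightarrow> field \<Rightarrow> bool" where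
  "has_trace R \<Phi> g \<longleftrightarrow> continuous_on (\<Union>R) g \<and> g \<in> H1 (interior (\<Union>R)) \<and>
     (\<lambda>x. \<Phi> x - g x) \<in> H1_0 (interior (\<Union>R))"

definition stokes_admissible :: "pt set set \<Rightarrow> field \<Rightarrow> field \<Rightarrow> bool" where
  "stokes_admissible K w \<Phi> \<longleftrightarrow> \<Phi> \<in> H1 (interior (\<Union>K)) \<and> has_trace K \<Phi> w \<and>
     (AE x in lebesgue_on (interior (\<Union>K)).
        divergence (interior (\<Union>K)) \<Phi> x = flux (boundary_edges K) w / area K)"

definition stokes_minimizer :: "pt set set \<Rightarrow> field \<Rightarrow> field \<Rightarrow> bool" where
  "stokes_minimizer K w \<Phi> \<longleftrightarrow> stokes_admissible K w \<Phi> \<and>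
     (\<forall>\<Psi>. stokes_admissible K w \<Psi> \<longrightarrow>
        l2_norm (interior (\<Union>K)) (grad (interior (\<Union>K)) \<Phi>)
        \<le> l2_norm (interior (\<Union>K)) (grad (interior (\<Union>K)) \<Psi>))"

definition quadratic_on :: "pt set \<Rightarrow> (pt \<Rightarrow> real) \<Rightarrow> bool" where
  "quadratic_on t f \<longleftrightarrow> (\<exists>a b (A::real^2^2). \<forall>x\<in>t. f x = a + b \<bullet> x + x \<bullet> (A *v x))"

text \<open>A complete list \<open>\<Phi> 0, \<dots>, \<Phi> (n-1)\<close> of eigenfunctions of \<open>a(u,\<psi>) = \<mu> s(u,\<psi>)\<close> in \<open>V\<close>,
  with multiplicities, ordered by increasing eigenvalue.\<close>

definition eigensystem ::
  "field set \<Rightarrow> (field \<Rightarrow> field \<Rightarrow> real) \<Rightarrow> (field \<Rightarrow> field \<Rightarrow> real) \<Rightarrow> nat \<Rightarrow> (nat \<Rightarrow> real) \<Rightarrow> (nat \<Rightarrow> field) \<Rightarrow> bool"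
where
  "eigensystem V a s n ev \<Phi> \<longleftrightarrow>
     (\<forall>k<n. \<Phi> k \<in> V \<and> (\<forall>\<psi>\<in>V. a (\<Phi> k) \<psi> = ev k * s (\<Phi> k) \<psi>)) \<and>
     (\<forall>c::nat \<Rightarrow> real. (\<forall>x. (\<Sum>k<n. c k *\<^sub>R \<Phi> k x) = 0) \<longrightarrow> (\<forall>k<n. c k = 0)) \<and>
     (\<forall>k l. k \<le> l \<and> l < n \<longrightarrow> ev k \<le> ev l) \<and>
     (\<forall>\<mu>. \<forall>u\<in>V. (\<forall>\<psi>\<in>V. a u \<psi> = \<mu> * s u \<psi>) \<longrightarrow> u \<in> field_span {\<Phi> k | k. k < n \<and> ev k = \<mu>})"


text \<open>\<open>\<Omega>\<close> is the unperforated domain and \<open>B\<close> the union of the perforations. The coarse grid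
  is given by curvilinear triangles \<open>G ` T\<close>, \<open>T \<in> \<T>H\<close>, where \<open>\<T>H\<close> is a straight triangular
  mesh and \<open>G\<close> a homeomorphism of the plane (the identity for straight coarse triangles);
  the coarse blocks are the sets \<open>G ` T - B\<close>.\<close>

locale grid_data =
  fixes \<Omega> B :: "pt set" and G :: "pt \<Rightarrow> pt" and \<T>H \<T>h :: "pt set set"
begin

definition perf_dom :: "pt set" where
  "perf_dom = \<Omega> - B"

definition blocks :: "pt set set set" where
  "blocks = {{t \<in> \<T>h. t \<subseteq> G ` T} | T. T \<in> \<T>H} - {{}}"

definition coarse_nodes :: "pt set" where
  "coarse_nodes = G ` mesh_vertices \<T>H \<inter> closure perf_dom"

definition coarse_edges :: "pt set set" where
  "coarse_edges = {closure (G ` e - B) | e. e \<in> mesh_edges \<T>H \<and> \<not> G ` e \<subseteq> B}"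

text \<open>The index set of the coarse neighborhoods: a coarse node \<open>x\<close> is represented by \<open>{x}\<close>,
  a coarse edge by itself.\<close>

definition anchors :: "pt set set" where
  "anchors = (\<lambda>x. {x}) ` coarse_nodes \<union> coarse_edges"

definition nbhd :: "pt set \<Rightarrow> pt set set" where
  "nbhd X = \<Union>{K \<in> blocks. X \<subseteq> \<Union>K}"

definition region :: "pt set \<Rightarrow> pt set" where
  "region X = interior (\<Union>(nbhd X))"

definition V_h :: "field set" where
  "V_h = {u. continuous_on (\<Union>\<T>h) u \<and> (\<forall>t\<in>\<T>h. \<forall>i. quadratic_on t (\<lambda>x. u x $ i))}"

text \<open>Functions on a coarse neighborhood are extended by zero.\<close>

definition V_h_loc :: "pt set \<Rightarrow> field set" where
  "V_h_loc X = (\<lambda>u x. if x \<in> \<Union>(nbhd X) then u x else 0) ` V_h"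

definition V_h0_loc :: "pt set \<Rightarrow> field set" where
  "V_h0_loc X = {v \<in> V_h_loc X. \<forall>x\<in>frontier (region X). v x = 0}"

definition Q_h_loc :: "pt set \<Rightarrow> (pt \<Rightarrow> real) set" where
  "Q_h_loc X = {q. \<forall>t\<in>nbhd X. \<exists>c. \<forall>x\<in>interior t. q x = c}"

definition snap_edges :: "pt set \<Rightarrow> pt set set" where
  "snap_edges X = {e \<in> mesh_edges (nbhd X). e \<subseteq> frontier (region X) \<and> \<not> e \<subseteq> frontier B}"

text \<open>The values of the piecewise constant boundary datum of the edge \<open>e\<close> at the two
  endpoints of \<open>e\<close> are left open.\<close>

definition edge_indicators :: "(pt set \<Rightarrow> pt set \<Rightarrow> pt \<Rightarrow> real) \<Rightarrow> bool" where
  "edge_indicators \<delta> \<longleftrightarrow> (\<forall>X\<in>anchors. \<forall>e\<in>snap_edges X.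
     (\<forall>z\<in>rel_interior e. \<delta> X e z = 1) \<and> (\<forall>z\<in>\<Union>(snap_edges X) - e. \<delta> X e z = 0))"

text \<open>A discontinuous datum is not the trace of a continuous field; as usual for finite
  elements it is imposed at the Lagrange nodes of the boundary. The index \<open>d\<close> selects
  the datum \<open>(\<delta>, 0)\<close> or \<open>(0, \<delta>)\<close>.\<close>

definition is_snapshot :: "(pt set \<Rightarrow> pt set \<Rightarrow> pt \<Rightarrow> real) \<Rightarrow> pt set \<Rightarrow> pt set \<Rightarrow> 2 \<Rightarrow> field \<Rightarrow> bool" where
  "is_snapshot \<delta> X e d u \<longleftrightarrow>
     (let U = region X;
          c = flux {(t, f) \<in> boundary_edges (nbhd X). \<not> f \<subseteq> frontier B} u / area (nbhd X)
      in u \<in> V_h_loc X \<and>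
         (\<exists>p\<in>Q_h_loc X. \<forall>v\<in>V_h0_loc X.
            grad_form U u v - (\<integral>x. p x * divergence U v x \<partial>lebesgue_on U) = 0) \<and>
         (\<forall>q\<in>Q_h_loc X. (\<integral>x. q x * divergence U u x \<partial>lebesgue_on U)
            = (\<integral>x. c * q x \<partial>lebesgue_on U)) \<and>
         (\<forall>x\<in>\<Union>(nbhd X) \<inter> frontier B. u x = 0) \<and>
         (\<forall>z\<in>lagrange_nodes (nbhd X) \<inter> frontier (region X) - frontier B.
            u z = axis d (\<delta> X e z)))"

definition snap_space :: "(pt set \<Rightarrow> pt set \<Rightarrow> pt \<Rightarrow> real) \<Rightarrow> pt set \<Rightarrow> field set" where
  "snap_space \<delta> X = field_span {u. \<exists>e\<in>snap_edges X. \<exists>d. is_snapshot \<delta> X e d u}"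

definition weight_form :: "(pt set \<Rightarrow> pt \<Rightarrow> real) \<Rightarrow> pt set \<Rightarrow> field \<Rightarrow> field \<Rightarrow> real" where
  "weight_form pou X u v = (\<integral>x. (\<Sum>j\<in>UNIV. (weak_partial (region X) j (pou X) x)\<^sup>2) * (u x \<bullet> v x)
     \<partial>lebesgue_on (region X))"

text \<open>The last condition says how \<open>pou X\<close> is tied to its node or edge: it vanishes on the
  coarse edges not containing it, also on those that lie on the boundary of \<open>\<Omega>\<close>
  (elsewhere this follows from the support condition). The quadratic Lagrange basis at the
  nodes and edge midpoints is the standard example.\<close>

definition partition_of_unity :: "(pt set \<Rightarrow> pt \<Rightarrow> real) \<Rightarrow> bool" where
  "partition_of_unity pou \<longleftrightarrow>
     (\<forall>X\<in>anchors. continuous_on (\<Union>\<T>h) (pou X) \<and>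
        (\<forall>t\<in>\<T>h. \<exists>g. Ck 1 g \<and> (\<forall>x\<in>t. pou X x = g x)) \<and>
        (\<forall>x\<in>\<Union>\<T>h - \<Union>(nbhd X). pou X x = 0) \<and>
        (\<forall>e\<in>mesh_edges \<T>H. \<not> X \<subseteq> G ` e \<longrightarrow> (\<forall>x\<in>G ` e - B. pou X x = 0))) \<and>
     (\<forall>x\<in>\<Union>\<T>h. (\<Sum>X\<in>anchors. pou X x) = 1)"

definition stokes_extension :: "pt set \<Rightarrow> field \<Rightarrow> field \<Rightarrow> bool" where
  "stokes_extension X w \<Phi> \<longleftrightarrow>
     (\<forall>K\<in>blocks. K \<subseteq> nbhd X \<longrightarrow> stokes_minimizer K w \<Phi>) \<and> (\<forall>x. x \<notin> \<Union>(nbhd X) \<longrightarrow> \<Phi> x = 0)"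

definition Q_off :: "(pt \<Rightarrow> real) set" where
  "Q_off = {p \<in> L2_0 perf_dom. \<forall>K\<in>blocks. \<exists>c. \<forall>x\<in>interior (\<Union>K). p x = c}"

definition V_off :: "(pt set \<Rightarrow> nat) \<Rightarrow> (pt set \<Rightarrow> 2 \<Rightarrow> nat \<Rightarrow> field) \<Rightarrow> field set" where
  "V_off M \<Phi> = field_span {\<Phi> X d k | X d k. X \<in> anchors \<and> k < M X}"

end

locale perforated_grid = grid_data +
  assumes domain: "open \<Omega>" "connected \<Omega>" "bounded \<Omega>"
    and perforations: "closed B" "perf_dom \<noteq> {}"
    and meshes: "triangular_mesh \<T>H" "triangular_mesh \<T>h"
    and homeo: "\<exists>G'. homeomorphism UNIV UNIV G G'"
    and coarse_cover: "perf_dom \<subseteq> (\<Union>T\<in>\<T>H. G ` T)" "(\<Union>T\<in>\<T>H. G ` T) - B \<subseteq> closure \<Omega>"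
    and fine_cover: "perf_dom = interior (\<Union>\<T>h)"
    and refinement: "\<forall>t\<in>\<T>h. \<exists>T\<in>\<T>H. t \<subseteq> G ` T"
    and resolved: "\<forall>e\<in>mesh_edges \<T>h. e \<subseteq> frontier B \<or> e \<inter> frontier B \<subseteq> mesh_vertices \<T>h"
    and blocks_connected: "\<forall>K\<in>blocks. path_connected (interior (\<Union>K))"
    and sizes: "mesh_size \<T>h < mesh_size (Union ` blocks)" "mesh_size (Union ` blocks) < 1"

text \<open>\<open>\<delta> X e\<close> are the snapshot boundary data, \<open>ev X k\<close> and \<open>\<Phi>t X k\<close> (\<open>k < n X\<close>) the eigenvalues
  and eigenfunctions of the local spectral problem, \<open>M X\<close> the number of selected ones, and
  \<open>\<Phi> X d k\<close> the offline basis functions built from component \<open>d\<close> of \<open>\<Phi>t X k\<close>. The last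
  assumption is the standing one on fluxes through interior coarse edges; the sign of the
  normal is immaterial, so the one exterior to either adjacent block may be used.\<close>

locale stokes_gmsfem = perforated_grid +
  fixes \<delta> :: "pt set \<Rightarrow> pt set \<Rightarrow> pt \<Rightarrow> real"
    and pou :: "pt set \<Rightarrow> pt \<Rightarrow> real"
    and n :: "pt set \<Rightarrow> nat"
    and ev :: "pt set \<Rightarrow> nat \<Rightarrow> real"
    and \<Phi>t :: "pt set \<Rightarrow> nat \<Rightarrow> field"
    and M :: "pt set \<Rightarrow> nat"
    and \<Phi> :: "pt set \<Rightarrow> 2 \<Rightarrow> nat \<Rightarrow> field"
  assumes boundary_data: "edge_indicators \<delta>"
    and partition: "partition_of_unity pou"
    and eigenproblem: "\<forall>X\<in>anchors. eigensystem (snap_space \<delta> X) (grad_form (region X))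
          (weight_form pou X) (n X) (ev X) (\<Phi>t X)"
    and selected: "\<forall>X\<in>anchors. M X \<le> n X"
    and offline_basis: "\<forall>X\<in>anchors. \<forall>d. \<forall>k<M X.
          stokes_extension X (\<lambda>x. axis d (pou X x * \<Phi>t X k x $ d)) (\<Phi> X d k)"
    and edge_flux: "\<forall>E\<in>coarse_edges. \<not> E \<subseteq> frontier perf_dom \<longrightarrow>
          (\<exists>d. \<exists>k<M E. \<exists>K\<in>blocks. E \<subseteq> \<Union>K \<and>
             (\<exists>g. has_trace K (\<Phi> E d k) g \<and>
                flux {(t, f) \<in> boundary_edges K. f \<subseteq> E} g \<noteq> 0))"

end

theory Submission
  imports Defs
begin

text \<open>
  The constant \<open>C_infsup\<close> may depend on the grid, and modulo null sets the coarse pressure space is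
  finite-dimensional. A seminorm on such a space that vanishes on the common kernel of finitely many
  linear functionals is bounded by a multiple of the sum of their absolute values (\<open>seminorm_bounded_by_functionals\<close>).
  With the functionals \<open>p \<mapsto> \<integral> div u p\<close>, \<open>u\<close> an offline basis function, and the \<open>L2\<close> norm as
  seminorm, it remains to see that a coarse pressure \<open>p\<close> orthogonal to all divergences of basis
  functions vanishes almost everywhere.

  Let \<open>E\<close> be an interior coarse edge and \<open>\<Phi>\<close> its basis function with nonzero flux through \<open>E\<close>. Its boundary
  data \<open>\<omega>\<close>, a component of an eigenfunction times the partition function of \<open>E\<close>, vanish on the perforations
  and on all other coarse edges. Hence \<open>\<omega>\<close> extends by zero to a Lipschitz function on the plane, and \<open>\<Phi>\<close>
  differs from this extension by fields in \<open>H1_0\<close> of the two blocks at \<open>E\<close>. So \<open>\<Phi>\<close> is in \<open>H1\<close> and its divergence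
  integrates to zero over the domain. By definition of the Stokes extension this divergence is constant on
  each of the two blocks, with value flux over area; the flux is nonzero, because the trace of a
  continuous function is determined by the \<open>H1\<close> class (\<open>continuous_vanishes_at_boundary_point\<close>) and the only
  boundary edges of the block on which \<open>\<omega>\<close> does not vanish lie on \<open>E\<close>. Therefore \<open>\<integral> div \<Phi> p\<close> is a nonzero
  multiple of the jump of \<open>p\<close> across \<open>E\<close> (\<open>divergence_measures_jump\<close>).

  A pressure without jumps is locally constant in the domain: around points of coarse edges directly, and
  around the finitely many coarse vertices because punctured discs are connected. It is then orthogonal to
  the divergence of every \<open>H1_0\<close> field, and the continuous inf-sup condition forces it to be zero.

  Since weak derivatives are only determined almost everywhere, the calculus with them rests on the
  fundamental lemma of the calculus of variations, and integration by parts for Lipschitz functions rests on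
  the translation invariance of the Lebesgue integral.
\<close>

section \<open>Smooth functions with compact support\<close>

lemma Ck_SucI:
  assumes "\<And>x. (f has_derivative f' x) (at x)" and "\<And>v. Ck k (\<lambda>x. f' x v)"
  shows "Ck (Suc k) f"
proof -
  have "frechet_derivative f (at x) = f' x" for x
    using frechet_derivative_at[OF assms(1)[of x]] by simp
  then show ?thesis using assms by (auto simp: differentiable_def)
qed

lemma Ck_SucD:
  assumes "Ck (Suc k) f"
  shows "(f has_derivative frechet_derivative f (at x)) (at x)"
    and "Ck k (\<lambda>x. frechet_derivative f (at x) v)"
  using assms frechet_derivative_works by auto

lemma Ck_Suc_imp_Ck: "Ck (Suc k) f \<Longrightarrow> Ck k f"
proof (induction k arbitrary: f)
  case 0
  then have "\<forall>x. f differentiable (at x)" by auto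
  then show ?case
    by (simp add: continuous_on_eq_continuous_at differentiable_imp_continuous_within)
next
  case (Suc k)
  show ?case
  proof (rule Ck_SucI)
    show "(f has_derivative frechet_derivative f (at x)) (at x)" for x
      using Suc.prems by (rule Ck_SucD)
    show "Ck k (\<lambda>x. frechet_derivative f (at x) v)" for v
      using Suc.IH Ck_SucD(2)[OF Suc.prems] by blast
  qed
qed

lemma Ck_const: "Ck k (\<lambda>x. c)"
proof (induction k arbitrary: c)
  case (Suc k)
  show ?case by (rule Ck_SucI[where f' = "\<lambda>x v. 0"]) (use Suc in \<open>auto intro!: derivative_eq_intros\<close>)
qed simp

lemma Ck_add: "Ck k f \<Longrightarrow> Ck k g \<Longrightarrow> Ck k (\<lambda>x. f x + g x)"
proof (induction k arbitrary: f g)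
  case (Suc k)
  show ?case
  proof (rule Ck_SucI)
    show "((\<lambda>x. f x + g x) has_derivative
        (\<lambda>v. frechet_derivative f (at x) v + frechet_derivative g (at x) v)) (at x)" for x
      by (intro has_derivative_add Ck_SucD(1)[OF Suc.prems(1)] Ck_SucD(1)[OF Suc.prems(2)])
    show "Ck k (\<lambda>x. frechet_derivative f (at x) v + frechet_derivative g (at x) v)" for v
      by (intro Suc.IH Ck_SucD(2)[OF Suc.prems(1)] Ck_SucD(2)[OF Suc.prems(2)])
  qed
qed (auto intro: continuous_on_add)

lemma Ck_mult: "Ck k f \<Longrightarrow> Ck k g \<Longrightarrow> Ck k (\<lambda>x. f x * g x)"
proof (induction k arbitrary: f g)
  case (Suc k)
  show ?case
  proof (rule Ck_SucI)
    show "((\<lambda>x. f x * g x) has_derivative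
        (\<lambda>v. f x * frechet_derivative g (at x) v + frechet_derivative f (at x) v * g x)) (at x)" for x
      by (intro has_derivative_mult Ck_SucD(1)[OF Suc.prems(1)] Ck_SucD(1)[OF Suc.prems(2)])
    show "Ck k (\<lambda>x. f x * frechet_derivative g (at x) v + frechet_derivative f (at x) v * g x)" for v
      by (intro Ck_add Suc.IH Ck_SucD(2)[OF Suc.prems(1)] Ck_SucD(2)[OF Suc.prems(2)]
          Ck_Suc_imp_Ck[OF Suc.prems(1)] Ck_Suc_imp_Ck[OF Suc.prems(2)])
  qed
qed (auto intro: continuous_on_mult)

lemma Ck_exp: "Ck k f \<Longrightarrow> Ck k (\<lambda>x. exp (f x))"
proof (induction k arbitrary: f)
  case (Suc k)
  show ?case
  proof (rule Ck_SucI)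
    show "((\<lambda>x. exp (f x)) has_derivative
        (\<lambda>v. exp (f x) * frechet_derivative f (at x) v)) (at x)" for x
      using has_derivative_exp[OF Ck_SucD(1)[OF Suc.prems], of x] by (simp add: mult.commute)
    show "Ck k (\<lambda>x. exp (f x) * frechet_derivative f (at x) v)" for v
      by (intro Ck_mult Suc.IH Ck_SucD(2)[OF Suc.prems] Ck_Suc_imp_Ck[OF Suc.prems])
  qed
qed (auto intro: continuous_on_exp)

text \<open>Up to linear combinations, the functions \<open>exp (- 1 / t) / t ^ m\<close>, continued by zero, are closed under
  differentiation; smoothness of all of them is therefore a single induction.\<close>

definition flat :: "nat \<Rightarrow> real \<Rightarrow> real" where
  "flat m t = (if t > 0 then inverse t ^ m * exp (- inverse t) else 0)"

lemma flat_tendsto_0: "(flat m \<longlongrightarrow> 0) (at_right 0)"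
proof -
  have "((\<lambda>t::real. inverse t ^ m / exp (inverse t)) \<longlongrightarrow> 0) (at_right 0)"
    by (rule filterlim_compose[OF tendsto_power_div_exp_0 filterlim_inverse_at_top_right])
  moreover have "eventually (\<lambda>t. inverse t ^ m / exp (inverse t) = flat m t) (at_right 0)"
    using eventually_at_right_less[of "0::real"]
    by eventually_elim (simp add: flat_def exp_minus divide_inverse)
  ultimately show ?thesis by (rule Lim_transform_eventually)
qed

lemma flat_has_derivative:
  "(flat m has_real_derivative (flat (m + 2) t - real m * flat (m + 1) t)) (at t)"
proof -
  consider "t > 0" | "t < 0" | "t = 0" by linarith
  then show ?thesis
  proof cases
    case 1
    have "((\<lambda>t. inverse t ^ m * exp (- inverse t)) has_real_derivative
       (flat (m + 2) t - real m * flat (m + 1) t)) (at t)"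
    proof -
      have "((\<lambda>t. inverse t ^ m * exp (- inverse t)) has_real_derivative
        (real m * (inverse t ^ (m - 1) * - (inverse t ^ 2))) * exp (- inverse t)
          + (exp (- inverse t) * inverse t ^ 2) * inverse t ^ m) (at t)"
        using 1 by (auto intro!: derivative_eq_intros simp: power2_eq_square)
      moreover have "real m * (inverse t ^ (m - 1) * - (inverse t ^ 2)) = - (real m * inverse t ^ (m + 1))"
        by (cases m) (auto simp: power2_eq_square algebra_simps)
      ultimately show ?thesis
        using 1 by (simp only:) (simp add: flat_def algebra_simps power2_eq_square)
    qed
    then show ?thesis
      by (rule has_field_derivative_transform_within_open[where S = "{0<..}"]) (use 1 in \<open>auto simp: flat_def\<close>)
  next
    case 2
    have "((\<lambda>t. 0) has_real_derivative (flat (m + 2) t - real m * flat (m + 1) t)) (at t)"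
      using 2 by (auto simp: flat_def)
    then show ?thesis
      by (rule has_field_derivative_transform_within_open[where S = "{..<0}"]) (use 2 in \<open>auto simp: flat_def\<close>)
  next
    case 3
    have "((\<lambda>y. (flat m y - flat m 0) / (y - 0)) \<longlongrightarrow> 0) (at 0)"
    proof (rule filterlim_split_at)
      show "((\<lambda>y. (flat m y - flat m 0) / (y - 0)) \<longlongrightarrow> 0) (at_left 0)"
      proof (rule tendsto_eventually)
        have "eventually (\<lambda>y. y < 0) (at_left (0::real))"
          by (simp add: eventually_at_filter)
        then show "eventually (\<lambda>y. (flat m y - flat m 0) / (y - 0) = 0) (at_left 0)"
          by eventually_elim (simp add: flat_def)
      qed
    next
      have "eventually (\<lambda>y. flat (m + 1) y = (flat m y - flat m 0) / (y - 0)) (at_right 0)"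
        using eventually_at_right_less[of "0::real"]
        by eventually_elim (simp add: flat_def divide_inverse)
      then show "((\<lambda>y. (flat m y - flat m 0) / (y - 0)) \<longlongrightarrow> 0) (at_right 0)"
        by (rule Lim_transform_eventually[OF flat_tendsto_0])
    qed
    then show ?thesis using 3 by (simp add: has_field_derivative_iff flat_def)
  qed
qed

lemma Ck_flat_coordinate: "Ck k (\<lambda>x. flat m (c * (x $ i) + d))"
proof (induction k arbitrary: m)
  case 0
  have "continuous_on UNIV (flat m)"
    by (intro continuous_at_imp_continuous_on ballI DERIV_isCont[OF flat_has_derivative])
  then show ?case
    using continuous_on_compose2[of UNIV "flat m" UNIV "\<lambda>x. c * (x $ i) + d"]
    by (simp add: continuous_on_add continuous_on_mult continuous_on_component)
next
  case (Suc k)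
  show ?case
  proof (rule Ck_SucI)
    show "((\<lambda>x. flat m (c * (x $ i) + d)) has_derivative
        (\<lambda>v. (flat (m + 2) (c * (x $ i) + d) + (- real m) * flat (m + 1) (c * (x $ i) + d)) * (c * v $ i))) (at x)" for x :: pt
    proof -
      have "((\<lambda>x. c * (x $ i) + d) has_derivative (\<lambda>v. c * v $ i)) (at x)"
        by (auto intro!: derivative_eq_intros bounded_linear.has_derivative[OF bounded_linear_vec_nth])
      from DERIV_compose_FDERIV[OF flat_has_derivative this]
      show ?thesis by (simp add: mult.commute)
    qed
    show "Ck k (\<lambda>x. (flat (m + 2) (c * (x $ i) + d) + (- real m) * flat (m + 1) (c * (x $ i) + d)) * (c * v $ i))" for v :: pt
      by (intro Ck_mult Ck_add Ck_const Suc.IH)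
  qed
qed

definition box_bump :: "pt \<Rightarrow> pt \<Rightarrow> pt \<Rightarrow> real" where
  "box_bump a b x = flat 0 (x $ 1 - a $ 1) * flat 0 (b $ 1 - x $ 1) *
     (flat 0 (x $ 2 - a $ 2) * flat 0 (b $ 2 - x $ 2))"

lemma Ck_box_bump: "Ck k (box_bump a b)"
proof -
  have "Ck k (\<lambda>x. flat 0 (1 * x $ 1 + (- a $ 1)) * flat 0 ((-1) * x $ 1 + b $ 1) *
     (flat 0 (1 * x $ 2 + (- a $ 2)) * flat 0 ((-1) * x $ 2 + b $ 2)))"
    by (intro Ck_mult Ck_flat_coordinate)
  then show ?thesis unfolding box_bump_def[abs_def] by simp
qed

lemma box_bump_pos: "x \<in> box a b \<Longrightarrow> box_bump a b x > 0"
  and box_bump_zero: "x \<notin> box a b \<Longrightarrow> box_bump a b x = 0"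
  by (auto simp: box_bump_def flat_def mem_box_cart forall_2)

text \<open>The functions \<open>1 - exp (- n \<beta>)\<close>, with \<open>\<beta>\<close> a bump that is positive exactly on the box,
  are admissible test functions increasing to the indicator function of the box.\<close>

lemma box_indicator_test_function:
  assumes "cbox a b \<subseteq> U"
  shows "(\<lambda>x. 1 - exp (- (real n * box_bump a b x))) \<in> test_functions U"
proof -
  have "Ck k (\<lambda>x. 1 + (-1) * exp ((- real n) * box_bump a b x))" for k
    by (intro Ck_mult Ck_add Ck_const Ck_exp Ck_box_bump)
  moreover have "1 - exp (- (real n * box_bump a b x)) = 0" if "x \<notin> cbox a b" for x
    using box_bump_zero[of x a b] that box_subset_cbox[of a b] by auto
  ultimately show ?thesis using assms
    by (auto simp: test_functions_def intro!: exI[of _ "cbox a b"])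
qed

section \<open>Square integrable functions\<close>

lemma square_integrable_real:
  "square_integrable U (f :: pt \<Rightarrow> real) \<longleftrightarrow>
     f \<in> borel_measurable (lebesgue_on U) \<and> integrable (lebesgue_on U) (\<lambda>x. (f x)\<^sup>2)"
  by (simp add: square_integrable_def)

lemma l2_norm_real: "l2_norm U (f :: pt \<Rightarrow> real) = sqrt (\<integral>x. (f x)\<^sup>2 \<partial>lebesgue_on U)"
  by (simp add: l2_norm_def)

lemma l2_norm_nonneg: "l2_norm U f \<ge> 0"
  by (simp add: l2_norm_def)

lemma square_integrable_mult_integrable:
  fixes f g :: "pt \<Rightarrow> real"
  assumes "square_integrable U f" "square_integrable U g"
  shows "integrable (lebesgue_on U) (\<lambda>x. f x * g x)"
proof (rule Bochner_Integration.integrable_bound)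
  show "integrable (lebesgue_on U) (\<lambda>x. (f x)\<^sup>2 + (g x)\<^sup>2)"
    using assms by (auto simp: square_integrable_real)
  show "(\<lambda>x. f x * g x) \<in> borel_measurable (lebesgue_on U)"
    using assms by (auto simp: square_integrable_real)
  have "\<bar>a * b\<bar> \<le> a\<^sup>2 + b\<^sup>2" for a b :: real
  proof -
    have "2 * (\<bar>a\<bar> * \<bar>b\<bar>) \<le> a\<^sup>2 + b\<^sup>2" "0 \<le> \<bar>a\<bar> * \<bar>b\<bar>"
      using sum_squares_bound[of "\<bar>a\<bar>" "\<bar>b\<bar>"] by simp_all
    then show ?thesis unfolding abs_mult by linarith
  qed
  then show "AE x in lebesgue_on U. norm (f x * g x) \<le> norm ((f x)\<^sup>2 + (g x)\<^sup>2)"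
    by (intro AE_I2) (simp add: sum_power2_ge_zero)
qed

lemma square_integrable_add:
  fixes f g :: "pt \<Rightarrow> real"
  assumes "square_integrable U f" "square_integrable U g"
  shows "square_integrable U (\<lambda>x. f x + g x)"
proof -
  have "integrable (lebesgue_on U) (\<lambda>x. (f x)\<^sup>2 + 2 * (f x * g x) + (g x)\<^sup>2)"
    using assms square_integrable_mult_integrable[OF assms]
    by (auto simp: square_integrable_real)
  then show ?thesis
    using assms by (auto simp: square_integrable_real power2_sum algebra_simps)
qed

lemma square_integrable_cmult:
  fixes f :: "pt \<Rightarrow> real"
  assumes "square_integrable U f"
  shows "square_integrable U (\<lambda>x. c * f x)"
  using assms by (auto simp: square_integrable_real power_mult_distrib)

lemma square_integrable_zero: "square_integrable U (\<lambda>x. 0 :: real)"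
  by (simp add: square_integrable_real)

lemma square_integrable_sum:
  fixes f :: "'i \<Rightarrow> pt \<Rightarrow> real"
  shows "(\<And>i. i \<in> I \<Longrightarrow> square_integrable U (f i)) \<Longrightarrow> square_integrable U (\<lambda>x. \<Sum>i\<in>I. f i x)"
  by (induction I rule: infinite_finite_induct)
    (auto simp: square_integrable_zero intro: square_integrable_add)

lemma open_in_sets_lebesgue: "open (U :: pt set) \<Longrightarrow> U \<in> sets lebesgue"
  by (simp add: borel_open)

lemma square_integrable_bounded_function:
  fixes f :: "pt \<Rightarrow> real"
  assumes "open U" "bounded U" "f \<in> borel_measurable (lebesgue_on U)"
    and "AE x in lebesgue_on U. \<bar>f x\<bar> \<le> B"
  shows "square_integrable U f"
proof -
  have "U \<in> lmeasurable" using assms(1,2) by (simp add: lmeasurable_open)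
  then have c: "integrable (lebesgue_on U) (\<lambda>x. B\<^sup>2 :: real)"
    by (intro finite_measure.integrable_const finite_measure_lebesgue_on)
  have "integrable (lebesgue_on U) (\<lambda>x. (f x)\<^sup>2)"
  proof (rule Bochner_Integration.integrable_bound[OF c])
    show "AE x in lebesgue_on U. norm ((f x)\<^sup>2) \<le> norm (B\<^sup>2)"
      using assms(4)
    proof eventually_elim
      case (elim x)
      then show ?case using power_mono[of "\<bar>f x\<bar>" B 2] by simp
    qed
  qed (use assms(3) in simp)
  then show ?thesis using assms(3) by (simp add: square_integrable_real)
qed

lemma square_integrable_indicator:
  assumes "U \<in> sets lebesgue" "S \<in> lmeasurable"
  shows "square_integrable U (indicator S :: pt \<Rightarrow> real)"
proof -
  have "integrable lebesgue (indicator S :: pt \<Rightarrow> real)"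
    using assms(2) by (simp only: lmeasurable_iff_integrable)
  then have "integrable lebesgue (\<lambda>x. indicator U x *\<^sub>R (indicator S x :: real))"
    using assms(1) by (intro integrable_mult_indicator)
  then have "integrable (lebesgue_on U) (indicator S :: pt \<Rightarrow> real)"
    using assms(1) by (simp add: integrable_restrict_space)
  moreover have "(\<lambda>x. (indicator S x :: real)\<^sup>2) = indicator S"
    by (auto simp: indicator_def)
  moreover have "(indicator S :: pt \<Rightarrow> real) \<in> borel_measurable (lebesgue_on U)"
    using assms(2) by (intro measurable_restrict_space1 borel_measurable_indicator fmeasurableD)
  ultimately show ?thesis by (simp add: square_integrable_real)
qed

lemma abs_integral_mult_le_l2_norm:
  fixes f g :: "pt \<Rightarrow> real"
  assumes f: "square_integrable U f" and g: "square_integrable U g"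
  shows "\<bar>\<integral>x. f x * g x \<partial>lebesgue_on U\<bar> \<le> l2_norm U f * l2_norm U g"
proof -
  define F H G where "F = (\<integral>x. (f x)\<^sup>2 \<partial>lebesgue_on U)" and "H = (\<integral>x. f x * g x \<partial>lebesgue_on U)"
    and "G = (\<integral>x. (g x)\<^sup>2 \<partial>lebesgue_on U)"
  have int: "integrable (lebesgue_on U) (\<lambda>x. (f x)\<^sup>2)" "integrable (lebesgue_on U) (\<lambda>x. (g x)\<^sup>2)"
    "integrable (lebesgue_on U) (\<lambda>x. f x * g x)"
    using f g square_integrable_mult_integrable[OF f g] by (auto simp: square_integrable_real)
  have q: "0 \<le> F - 2 * t * H + t\<^sup>2 * G" for t
  proof -
    have "0 \<le> (\<integral>x. (f x - t * g x)\<^sup>2 \<partial>lebesgue_on U)" by simp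
    also have "\<dots> = (\<integral>x. ((f x)\<^sup>2 - (2 * t) * (f x * g x)) + t\<^sup>2 * (g x)\<^sup>2 \<partial>lebesgue_on U)"
      by (simp add: power2_diff power_mult_distrib algebra_simps)
    also have "\<dots> = F - 2 * t * H + t\<^sup>2 * G"
      unfolding F_def H_def G_def using int by simp
    finally show ?thesis .
  qed
  have FG: "F \<ge> 0" "G \<ge> 0" by (auto simp: F_def G_def)
  have "H\<^sup>2 \<le> F * G"
  proof (cases "G = 0")
    case True
    have "H = 0"
    proof (rule ccontr)
      assume "H \<noteq> 0"
      then show False using q[of "(F + 1) / (2 * H)"] True FG by (simp add: field_simps)
    qed
    then show ?thesis using True by simp
  next
    case False
    then have "G > 0" using FG by simp
    then show ?thesis using q[of "H / G"] by (simp add: field_simps power2_eq_square)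
  qed
  then have "\<bar>H\<bar> \<le> sqrt (F * G)" by (metis real_sqrt_abs real_sqrt_le_iff)
  then show ?thesis by (simp add: l2_norm_real F_def G_def H_def real_sqrt_mult)
qed

lemma l2_norm_add_le:
  fixes f g :: "pt \<Rightarrow> real"
  assumes f: "square_integrable U f" and g: "square_integrable U g"
  shows "l2_norm U (\<lambda>x. f x + g x) \<le> l2_norm U f + l2_norm U g"
proof -
  have int: "integrable (lebesgue_on U) (\<lambda>x. (f x)\<^sup>2)" "integrable (lebesgue_on U) (\<lambda>x. (g x)\<^sup>2)"
    "integrable (lebesgue_on U) (\<lambda>x. f x * g x)"
    using f g square_integrable_mult_integrable[OF f g] by (auto simp: square_integrable_real)
  have "(\<integral>x. (f x + g x)\<^sup>2 \<partial>lebesgue_on U) = (\<integral>x. ((f x)\<^sup>2 + 2 * (f x * g x)) + (g x)\<^sup>2 \<partial>lebesgue_on U)"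
    by (simp add: power2_sum algebra_simps)
  also have "\<dots> = (l2_norm U f)\<^sup>2 + 2 * (\<integral>x. f x * g x \<partial>lebesgue_on U) + (l2_norm U g)\<^sup>2"
    using int by (simp add: l2_norm_real)
  also have "\<dots> \<le> (l2_norm U f + l2_norm U g)\<^sup>2"
    using abs_integral_mult_le_l2_norm[OF f g] by (simp add: power2_sum)
  finally show ?thesis
    by (subst l2_norm_real, intro real_le_lsqrt) (auto simp: l2_norm_nonneg)
qed

lemma l2_norm_cmult: "l2_norm U (\<lambda>x. c * f x :: real) = \<bar>c\<bar> * l2_norm U f"
  by (simp add: l2_norm_real power_mult_distrib real_sqrt_mult)

lemma AE_zero_if_l2_norm_zero:
  assumes "square_integrable U f" "l2_norm U f = 0"
  shows "AE x in lebesgue_on U. f x = 0"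
  using assms
  by (simp add: l2_norm_def square_integrable_def integral_nonneg_eq_0_iff_AE)

section \<open>The fundamental lemma of the calculus of variations\<close>

lemma test_functionD:
  assumes "\<phi> \<in> test_functions U"
  shows "Ck k \<phi>" and "(\<phi> has_derivative frechet_derivative \<phi> (at x)) (at x)"
    and "continuous_on UNIV (\<lambda>x. frechet_derivative \<phi> (at x) v)" and "continuous_on UNIV \<phi>"
proof -
  show *: "Ck k \<phi>" for k using assms by (simp add: test_functions_def)
  show "(\<phi> has_derivative frechet_derivative \<phi> (at x)) (at x)"
    using Ck_SucD(1)[OF *] .
  show "continuous_on UNIV (\<lambda>x. frechet_derivative \<phi> (at x) v)"
    using Ck_SucD(2)[OF *[of "Suc 0"]] by simp
  show "continuous_on UNIV \<phi>" using *[of 0] by simp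
qed

lemma test_function_support:
  assumes "\<phi> \<in> test_functions U"
  obtains C where "compact C" "C \<subseteq> U" "\<And>x. x \<notin> C \<Longrightarrow> \<phi> x = 0"
    "\<And>x v. x \<notin> C \<Longrightarrow> frechet_derivative \<phi> (at x) v = 0"
proof -
  obtain C where C: "compact C" "C \<subseteq> U" "\<And>x. x \<notin> C \<Longrightarrow> \<phi> x = 0"
    using assms by (auto simp: test_functions_def)
  have "frechet_derivative \<phi> (at x) v = 0" if "x \<notin> C" for x v
  proof -
    have "(\<phi> has_derivative (\<lambda>_. 0)) (at x)"
    proof (rule has_derivative_transform_within_open[of "\<lambda>_. 0" "\<lambda>_. 0" x UNIV "- C"])
      show "open (- C)" using C(1) by (simp add: compact_imp_closed open_Compl)
    qed (use that C(3) in auto)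
    then show ?thesis using frechet_derivative_at by metis
  qed
  then show ?thesis using that C by blast
qed

lemma integral_restrict_support:
  fixes f :: "pt \<Rightarrow> real"
  assumes "V \<subseteq> U" "V \<in> sets lebesgue" "U \<in> sets lebesgue" "\<And>x. x \<in> U - V \<Longrightarrow> f x = 0"
  shows "(\<integral>x. f x \<partial>lebesgue_on U) = (\<integral>x. f x \<partial>lebesgue_on V)"
proof -
  have "indicator U x *\<^sub>R f x = indicator V x *\<^sub>R f x" for x
    using assms(1,4) by (auto simp: indicator_def)
  then have "(\<lambda>x. indicator U x *\<^sub>R f x) = (\<lambda>x. indicator V x *\<^sub>R f x)" by blast
  then show ?thesis
    using assms(2,3) integral_restrict_space[of U lebesgue f] integral_restrict_space[of V lebesgue f]
    by simp
qed

text \<open>Boxes generate the Borel sets and are stable under intersection, so by Dynkin's argument a Borel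
  representative of \<open>f\<close> has integral zero over every Borel set.\<close>

lemma integral_zero_on_boxes_imp_AE_zero:
  fixes f :: "pt \<Rightarrow> real"
  assumes f: "integrable lebesgue f"
    and tot: "(\<integral>x. f x \<partial>lebesgue) = 0"
    and box: "\<And>c d. (\<integral>x. indicator (box c d) x * f x \<partial>lebesgue) = 0"
  shows "AE x in lebesgue. f x = 0"
proof -
  obtain g where g: "g \<in> borel_measurable lborel" "AE x in lborel. f x = g x"
    using completion_ex_borel_measurable_real[of f lborel] f by auto
  have fg: "AE x in lebesgue. f x = g x" using g(2) by (rule AE_completion)
  have gl: "g \<in> borel_measurable lebesgue" using g(1) by (rule measurable_completion)
  have gi: "integrable lborel g"
    using f integrable_cong_AE[OF _ gl fg] integrable_completion[OF g(1)[simplified]] g(1)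
    by (auto simp: integrable_completion)
  have eq: "(\<integral>x. indicator A x * g x \<partial>lborel) = (\<integral>x. indicator A x * f x \<partial>lebesgue)"
    if "A \<in> sets borel" for A
  proof -
    have "(\<integral>x. indicator A x * g x \<partial>lborel) = (\<integral>x. indicator A x * g x \<partial>lebesgue)"
      by (rule integral_completion[symmetric]) (use that g(1) in auto)
    also have "\<dots> = (\<integral>x. indicator A x * f x \<partial>lebesgue)"
    proof (rule integral_cong_AE)
      show "AE x in lebesgue. indicator A x * g x = indicator A x * f x"
        using fg by eventually_elim simp
      have "A \<in> sets lebesgue" using that by (simp add: sets_completionI_sets)
      then have "indicator A \<in> borel_measurable lebesgue" by (rule borel_measurable_indicator)
      then show "(\<lambda>x. indicator A x * g x) \<in> borel_measurable lebesgue"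
        "(\<lambda>x. indicator A x * f x) \<in> borel_measurable lebesgue"
        using f gl by (auto intro!: borel_measurable_times)
    qed
    finally show ?thesis .
  qed
  have tot': "(\<integral>x. g x \<partial>lborel) = 0" using eq[of UNIV] tot by simp
  have "(\<integral>x. indicator A x *\<^sub>R g x \<partial>lborel) = 0" if "A \<in> sigma_sets UNIV (range (\<lambda>(a, b). box a b :: pt set))" for A
  proof -
    have "Int_stable (range (\<lambda>(a, b). box a b :: pt set))"
      by (auto simp: Int_stable_def box_Int_box)
    moreover have "range (\<lambda>(a, b). box a b :: pt set) \<subseteq> Pow UNIV" by auto
    ultimately show ?thesis using that
    proof (induction rule: sigma_sets_induct_disjoint)
      case (basic A)
      then show ?case using eq[of A] box by auto
    next
      case empty
      then show ?case by simp
    next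
      case (compl A)
      then have A: "A \<in> sets lborel" by (simp add: borel_eq_box)
      have "(\<integral>x. indicator (UNIV - A) x *\<^sub>R g x \<partial>lborel) = (\<integral>x. g x - indicator A x *\<^sub>R g x \<partial>lborel)"
        by (rule Bochner_Integration.integral_cong) (auto simp: indicator_def)
      also have "\<dots> = 0"
        using tot' compl(2) integrable_mult_indicator[OF A gi] gi by simp
      finally show ?case .
    next
      case (union A)
      then have A: "A i \<in> sets lborel" for i by (auto simp: borel_eq_box)
      have "set_integrable lborel (\<Union>i. A i) g"
        unfolding set_integrable_def using A by (intro integrable_mult_indicator gi) auto
      with lebesgue_integral_countable_add[of A lborel g] A union(1) union(3) show ?case
        by (auto simp: disjoint_family_on_def set_lebesgue_integral_def)
    qed
  qed
  then have "set_lebesgue_integral lborel A g = 0" if "A \<in> sets lborel" for A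
    using that by (simp add: set_lebesgue_integral_def borel_eq_box)
  from sigma_finite_measure.density_zero[OF sigma_finite_lborel gi this] have "AE x in lborel. g x = 0" .
  then have "AE x in lebesgue. g x = 0" by (rule AE_completion)
  with fg show ?thesis by eventually_elim simp
qed

text \<open>The test functions \<open>1 - exp (- n \<beta>)\<close> tend to the indicator of the box and stay below it, so
  dominated convergence applies.\<close>

lemma integral_box_zero_if_orthogonal:
  fixes g :: "pt \<Rightarrow> real"
  assumes U: "open U" and g: "square_integrable U g" and ab: "cbox a b \<subseteq> U"
    and orth: "\<And>\<phi>. \<phi> \<in> test_functions U \<Longrightarrow> (\<integral>x. g x * \<phi> x \<partial>lebesgue_on U) = 0"
  shows "(\<integral>x. g x * indicator (box a b) x \<partial>lebesgue_on U) = 0"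
proof -
  define \<phi> where "\<phi> n x = 1 - exp (- (real n * box_bump a b x))" for n x
  have \<phi>: "\<phi> n \<in> test_functions U" for n
    unfolding \<phi>_def[abs_def] by (rule box_indicator_test_function[OF ab])
  have bb: "0 \<le> box_bump a b x" for x
    using box_bump_pos[of x a b] box_bump_zero[of x a b] by (cases "x \<in> box a b") auto
  have sU: "U \<in> sets lebesgue" using U by (rule open_in_sets_lebesgue)
  have ind: "square_integrable U (indicator (box a b) :: pt \<Rightarrow> real)"
    using sU by (intro square_integrable_indicator) simp_all
  have lim: "(\<lambda>n. \<phi> n x) \<longlonglongrightarrow> indicator (box a b) x" for x
  proof (cases "x \<in> box a b")
    case True
    have "filterlim (\<lambda>n. - (real n * box_bump a b x)) at_bot sequentially"
      unfolding filterlim_uminus_at_top[symmetric]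
      using filterlim_at_top_mult_tendsto_pos[OF tendsto_const box_bump_pos[OF True] filterlim_real_sequentially]
      by (simp add: filterlim_uminus_at_top)
    then have "(\<lambda>n. exp (- (real n * box_bump a b x))) \<longlonglongrightarrow> 0"
      by (rule filterlim_compose[OF exp_at_bot])
    then have "(\<lambda>n. 1 - exp (- (real n * box_bump a b x))) \<longlonglongrightarrow> 1 - 0"
      by (intro tendsto_intros)
    then show ?thesis using True by (simp add: \<phi>_def)
  next
    case False
    then show ?thesis by (simp add: \<phi>_def box_bump_zero)
  qed
  have bound: "\<bar>\<phi> n x\<bar> \<le> indicator (box a b) x" for n x
    using bb[of x] box_bump_zero[of x a b] by (auto simp: \<phi>_def indicator_def)
  have "(\<lambda>n. \<integral>x. g x * \<phi> n x \<partial>lebesgue_on U) \<longlonglongrightarrow> (\<integral>x. g x * indicator (box a b) x \<partial>lebesgue_on U)"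
  proof (rule integral_dominated_convergence[where w = "\<lambda>x. \<bar>g x * indicator (box a b) x\<bar>"])
    show "(\<lambda>x. g x * \<phi> n x) \<in> borel_measurable (lebesgue_on U)" for n
    proof (intro borel_measurable_times)
      show "\<phi> n \<in> borel_measurable (lebesgue_on U)"
        using continuous_imp_measurable_on_sets_lebesgue[OF continuous_on_subset[OF test_functionD(4)[OF \<phi>]] sU] by simp
    qed (use g in \<open>simp add: square_integrable_real\<close>)
    show "integrable (lebesgue_on U) (\<lambda>x. \<bar>g x * indicator (box a b) x\<bar>)"
      by (intro integrable_abs square_integrable_mult_integrable g ind)
    show "AE x in lebesgue_on U. (\<lambda>n. g x * \<phi> n x) \<longlonglongrightarrow> g x * indicator (box a b) x"
      by (intro AE_I2 tendsto_mult tendsto_const lim)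
    show "AE x in lebesgue_on U. norm (g x * \<phi> n x) \<le> \<bar>g x * indicator (box a b) x\<bar>" for n
      using bound by (intro AE_I2) (auto simp: abs_mult intro!: mult_left_mono)
    show "(\<lambda>x. g x * indicator (box a b) x) \<in> borel_measurable (lebesgue_on U)"
      using g ind by (auto simp only: square_integrable_real intro!: borel_measurable_times)
  qed
  then show ?thesis
    using orth[OF \<phi>] by (simp add: LIMSEQ_const_iff)
qed

text \<open>\<open>U\<close> is a countable union of closed boxes. Inside one of them, every further box cuts out a box whose
  closure still lies in \<open>U\<close>, so the restriction of \<open>g\<close> integrates to zero over all boxes.\<close>

lemma AE_zero_if_orthogonal_to_test_functions:
  fixes g :: "pt \<Rightarrow> real"
  assumes U: "open U" and g: "square_integrable U g"
    and orth: "\<And>\<phi>. \<phi> \<in> test_functions U \<Longrightarrow> (\<integral>x. g x * \<phi> x \<partial>lebesgue_on U) = 0"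
  shows "AE x in lebesgue_on U. g x = 0"
proof -
  have sU: "U \<in> sets lebesgue" using U by (rule open_in_sets_lebesgue)
  have cb: "AE x in lebesgue. x \<in> cbox a b \<longrightarrow> g x = 0" if ab: "cbox a b \<subseteq> U" for a b
  proof -
    define f where "f x = indicator U x * (g x * indicator (box a b) x)" for x
    have sub: "(\<integral>x. indicator (box c d) x * f x \<partial>lebesgue) = 0" for c d
    proof -
      obtain c' d' where cd: "box c d \<inter> box a b = box c' d'"
        by (simp add: box_Int_box)
      have "(\<integral>x. g x * indicator (box c' d') x \<partial>lebesgue_on U) = 0"
      proof (cases "box c' d' = {}")
        case False
        then have "cbox c' d' = closure (box c' d')" by (simp add: closure_box)
        also have "\<dots> \<subseteq> closure (box a b)" using cd by (intro closure_mono) auto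
        also have "\<dots> \<subseteq> cbox a b" using box_subset_cbox by (intro closure_minimal) auto
        finally show ?thesis using integral_box_zero_if_orthogonal[OF U g _ orth] ab by blast
      qed simp
      moreover have "indicator (box c d) x * f x = indicator U x *\<^sub>R (g x * indicator (box c' d') x)" for x
        unfolding cd[symmetric] f_def by (auto simp: indicator_def)
      ultimately show ?thesis using sU by (simp add: integral_restrict_space)
    qed
    have f_box: "f x = indicator (box a b) x * f x" for x by (auto simp: f_def indicator_def)
    have "integrable lebesgue f"
    proof -
      have "integrable (lebesgue_on U) (\<lambda>x. g x * indicator (box a b) x)"
        using sU by (intro square_integrable_mult_integrable g square_integrable_indicator) simp_all
      then show ?thesis using sU by (simp add: integrable_restrict_space f_def[abs_def])
    qed
    moreover have "(\<integral>x. f x \<partial>lebesgue) = 0"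
      using sub[of a b] f_box by simp
    ultimately have "AE x in lebesgue. f x = 0"
      using sub by (intro integral_zero_on_boxes_imp_AE_zero)
    moreover have "AE x in lebesgue. x \<notin> cbox a b - box a b"
      by (rule AE_not_in) (simp add: negligible_frontier_interval flip: negligible_iff_null_sets)
    ultimately show ?thesis
      by eventually_elim (use ab in \<open>auto simp: f_def indicator_def split: if_splits\<close>)
  qed
  obtain D where D: "countable D" "D \<subseteq> Pow U" "\<And>X. X \<in> D \<Longrightarrow> \<exists>a b. X = cbox a b" "\<Union>D = U"
    using open_countable_Union_open_cbox[OF U] by metis
  have "\<forall>X\<in>D. AE x in lebesgue. x \<in> X \<longrightarrow> g x = 0"
    using D(2,3) cb by (metis PowD subsetD)
  then have "AE x in lebesgue. \<forall>X\<in>D. x \<in> X \<longrightarrow> g x = 0"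
    by (rule AE_ball_countable[OF D(1), THEN iffD2])
  then have "AE x in lebesgue. x \<in> U \<longrightarrow> g x = 0"
    by eventually_elim (use D(4) in auto)
  then show ?thesis using sU by (simp add: AE_restrict_space_iff)
qed

section \<open>Weak derivatives of Lipschitz functions\<close>

abbreviation pd :: "2 \<Rightarrow> (pt \<Rightarrow> real) \<Rightarrow> pt \<Rightarrow> real" where
  "pd j f x \<equiv> frechet_derivative f (at x) (axis j 1)"

lemma differentiable_imp_quotient_tendsto:
  fixes W :: "pt \<Rightarrow> real"
  assumes "W differentiable (at x)"
  shows "(\<lambda>n. (W (x + (1 / real (Suc n)) *\<^sub>R v) - W x) * real (Suc n)) \<longlonglongrightarrow> frechet_derivative W (at x) v"
proof -
  let ?D = "frechet_derivative W (at x)"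
  have D: "(W has_derivative ?D) (at x)" using assms by (simp add: frechet_derivative_works)
  have lin: "linear ?D" using D by (rule has_derivative_linear)
  have "((\<lambda>s. x + s *\<^sub>R v) has_derivative (\<lambda>s. s *\<^sub>R v)) (at (0::real))"
    by (auto intro!: derivative_eq_intros)
  with D have "((\<lambda>s. W (x + s *\<^sub>R v)) has_derivative (\<lambda>s. ?D (s *\<^sub>R v))) (at (0::real))"
    using has_derivative_compose[of "\<lambda>s. x + s *\<^sub>R v" "\<lambda>s. s *\<^sub>R v" 0 UNIV W ?D] by simp
  then have "((\<lambda>s. W (x + s *\<^sub>R v)) has_real_derivative ?D v) (at 0)"
  proof -
    have "(\<lambda>s. ?D (s *\<^sub>R v)) = (*) (?D v)" by (rule ext) (simp add: linear_scale[OF lin])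
    then show ?thesis
      using \<open>((\<lambda>s. W (x + s *\<^sub>R v)) has_derivative (\<lambda>s. ?D (s *\<^sub>R v))) (at 0)\<close>
      by (simp only: has_field_derivative_def)
  qed
  then have "((\<lambda>s. (W (x + s *\<^sub>R v) - W x) / s) \<longlongrightarrow> ?D v) (at 0)"
    by (simp add: has_field_derivative_iff)
  moreover have "filterlim (\<lambda>n. 1 / real (Suc n)) (at 0) sequentially"
    unfolding filterlim_at
  proof (intro conjI always_eventually allI)
    show "(\<lambda>n. 1 / real (Suc n)) \<longlonglongrightarrow> 0"
      using LIMSEQ_inverse_real_of_nat by (simp only: inverse_eq_divide)
  qed simp_all
  ultimately have "(\<lambda>n. (W (x + (1 / real (Suc n)) *\<^sub>R v) - W x) / (1 / real (Suc n))) \<longlonglongrightarrow> ?D v"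
    by (rule filterlim_compose)
  then show ?thesis by simp
qed

lemma borel_measurable_frechet_derivative:
  fixes W :: "pt \<Rightarrow> real"
  assumes W: "continuous_on UNIV W" and diff: "AE x in lebesgue. W differentiable (at x)"
  shows "(\<lambda>x. frechet_derivative W (at x) v) \<in> borel_measurable lebesgue"
proof (rule borel_measurable_AE)
  let ?d = "\<lambda>n x. (W (x + (1 / real (Suc n)) *\<^sub>R v) - W x) * real (Suc n)"
  have c: "continuous_on UNIV (?d n)" for n
    by (intro continuous_intros continuous_on_compose2[OF W]) auto
  have "?d n \<in> borel_measurable lebesgue" for n
    by (rule measurable_completion) (use borel_measurable_continuous_onI[OF c[of n]] in simp)
  then show "(\<lambda>x. lim (\<lambda>n. ?d n x)) \<in> borel_measurable lebesgue"
    by (rule borel_measurable_lim_metric)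
  show "AE x in lebesgue. lim (\<lambda>n. ?d n x) = frechet_derivative W (at x) v"
    using diff by eventually_elim (rule limI, rule differentiable_imp_quotient_tendsto)
qed

lemma integral_lebesgue_translate:
  fixes W :: "pt \<Rightarrow> real"
  assumes W: "continuous_on UNIV W"
  shows "(\<integral>x. W (x + v) \<partial>lebesgue) = (\<integral>x. W x \<partial>lebesgue)"
proof -
  have b: "W \<in> borel_measurable borel" using W by (rule borel_measurable_continuous_onI)
  have b': "(\<lambda>x. W (x + v)) \<in> borel_measurable borel"
    by (intro borel_measurable_continuous_onI continuous_on_compose2[OF W] continuous_intros) auto
  have "(\<integral>x. W (x + v) \<partial>lebesgue) = (\<integral>x. W (v + x) \<partial>lborel)"
    using b' by (subst integral_completion) (auto simp: add.commute)
  also have "\<dots> = (\<integral>x. W x \<partial>distr lborel borel ((+) v))"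
    using b by (subst integral_distr) auto
  also have "\<dots> = (\<integral>x. W x \<partial>lborel)" by (simp only: lborel_distr_plus)
  also have "\<dots> = (\<integral>x. W x \<partial>lebesgue)" using b by (subst integral_completion) auto
  finally show ?thesis .
qed

lemma integrable_lebesgue_continuous_support:
  fixes W :: "pt \<Rightarrow> real"
  assumes W: "continuous_on UNIV W" and supp: "\<And>x. R < norm x \<Longrightarrow> W x = 0"
  shows "integrable lebesgue W"
proof -
  obtain a where a: "cball 0 R \<subseteq> cbox (- a) (a :: pt)"
    using bounded_subset_cbox_symmetric[OF bounded_cball] by blast
  have "integrable (lebesgue_on (cbox (- a) a)) W"
    by (rule continuous_imp_integrable[OF continuous_on_subset[OF W]]) simp
  moreover have "indicator (cbox (- a) a) x *\<^sub>R W x = W x" for x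
  proof (cases "x \<in> cbox (- a) a")
    case False
    then have "R < norm x" using a by force
    then show ?thesis using supp by simp
  qed simp
  then have "(\<lambda>x. indicator (cbox (- a) a) x *\<^sub>R W x) = W" by blast
  ultimately show ?thesis
    using integrable_restrict_space[of "cbox (- a) a" lebesgue W] by simp
qed

lemma abs_quotient_le_lipschitz:
  fixes W :: "pt \<Rightarrow> real"
  assumes lip: "L-lipschitz_on UNIV W"
  shows "\<bar>(W (x + (1 / real (Suc n)) *\<^sub>R v) - W x) * real (Suc n)\<bar> \<le> L * norm v"
proof -
  have "\<bar>W (x + (1 / real (Suc n)) *\<^sub>R v) - W x\<bar> \<le> L * (norm v / real (Suc n))"
    using lipschitz_onD[OF lip, of "x + (1 / real (Suc n)) *\<^sub>R v" x]
    by (simp add: dist_norm divide_inverse mult.commute)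
  then show ?thesis
    unfolding abs_mult by (simp add: pos_le_divide_eq)
qed

lemma abs_frechet_derivative_le_lipschitz:
  fixes W :: "pt \<Rightarrow> real"
  assumes lip: "L-lipschitz_on UNIV W" and "W differentiable (at x)"
  shows "\<bar>frechet_derivative W (at x) v\<bar> \<le> L * norm v"
proof (rule tendsto_le[OF _ tendsto_const tendsto_rabs[OF differentiable_imp_quotient_tendsto[OF assms(2)]]])
qed (use abs_quotient_le_lipschitz[OF lip] in \<open>auto intro!: always_eventually\<close>)

text \<open>Translation invariance makes the integral of every difference quotient vanish; the
  Lipschitz constant dominates the quotients, so the identity passes to the limit.\<close>

lemma integral_frechet_derivative_zero:
  fixes W :: "pt \<Rightarrow> real"
  assumes lip: "L-lipschitz_on UNIV W" and supp: "\<And>x. R < norm x \<Longrightarrow> W x = 0"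
    and diff: "AE x in lebesgue. W differentiable (at x)"
  shows "integrable lebesgue (\<lambda>x. frechet_derivative W (at x) v)"
    and "(\<integral>x. frechet_derivative W (at x) v \<partial>lebesgue) = 0"
proof -
  let ?d = "\<lambda>n x. (W (x + (1 / real (Suc n)) *\<^sub>R v) - W x) * real (Suc n)"
  define w :: "pt \<Rightarrow> real" where "w = (\<lambda>x. L * norm v * indicator (cball 0 (R + norm v)) x)"
  have cont: "continuous_on UNIV W" using lip by (rule lipschitz_on_continuous_on)
  have cont': "continuous_on UNIV (\<lambda>x. W (x + (1 / real (Suc n)) *\<^sub>R v))" for n
    by (intro continuous_intros continuous_on_compose2[OF cont]) auto
  have sc: "norm ((1 / real (Suc n)) *\<^sub>R v) \<le> norm v" for n
    by (simp add: field_simps)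
  have supp': "W (x + (1 / real (Suc n)) *\<^sub>R v) = 0" if "R + norm v < norm x" for x n
  proof (rule supp)
    have "norm x \<le> norm (x + (1 / real (Suc n)) *\<^sub>R v) + norm ((1 / real (Suc n)) *\<^sub>R v)"
      using norm_triangle_ineq4[of "x + (1 / real (Suc n)) *\<^sub>R v" "(1 / real (Suc n)) *\<^sub>R v"] by simp
    then show "R < norm (x + (1 / real (Suc n)) *\<^sub>R v)" using sc[of n] that by linarith
  qed
  have i1: "integrable lebesgue W" by (rule integrable_lebesgue_continuous_support[OF cont supp])
  have i2: "integrable lebesgue (\<lambda>x. W (x + (1 / real (Suc n)) *\<^sub>R v))" for n
    by (rule integrable_lebesgue_continuous_support[OF cont' supp'])
  have i3: "integrable lebesgue (?d n)" for n
    by (intro integrable_mult_left Bochner_Integration.integrable_diff i1 i2)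
  have z: "(\<integral>x. ?d n x \<partial>lebesgue) = 0" for n
    using i1 i2[of n] integral_lebesgue_translate[OF cont, of "(1 / real (Suc n)) *\<^sub>R v"] by simp
  have wi: "integrable lebesgue w"
    unfolding w_def by (intro integrable_mult_right) (simp flip: lmeasurable_iff_integrable)
  have lim: "AE x in lebesgue. (\<lambda>n. ?d n x) \<longlonglongrightarrow> frechet_derivative W (at x) v"
    using diff by eventually_elim (rule differentiable_imp_quotient_tendsto)
  have dom: "AE x in lebesgue. norm (?d n x) \<le> w x" for n
  proof (rule AE_I2)
    fix x
    show "norm (?d n x) \<le> w x"
    proof (cases "x \<in> cball 0 (R + norm v)")
      case True
      then show ?thesis using abs_quotient_le_lipschitz[OF lip, of x n v] by (simp add: w_def)
    next
      case False
      then have "R + norm v < norm x" by simp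
      moreover have "R < norm x" using calculation norm_ge_zero[of v] by linarith
      ultimately show ?thesis using supp' supp False by (simp add: w_def)
    qed
  qed
  note dc = borel_measurable_frechet_derivative[OF cont diff] borel_measurable_integrable[OF i3] wi lim dom
  show "integrable lebesgue (\<lambda>x. frechet_derivative W (at x) v)"
    by (rule integrable_dominated_convergence[OF dc])
  have "(\<lambda>n. \<integral>x. ?d n x \<partial>lebesgue) \<longlonglongrightarrow> (\<integral>x. frechet_derivative W (at x) v \<partial>lebesgue)"
    by (rule integral_dominated_convergence[OF dc])
  then show "(\<integral>x. frechet_derivative W (at x) v \<partial>lebesgue) = 0"
    by (simp only: z LIMSEQ_const_iff)
qed

lemma frechet_derivative_partials:
  fixes f :: "pt \<Rightarrow> real"
  assumes "f differentiable (at x)"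
  shows "frechet_derivative f (at x) v = v $ 1 * pd 1 f x + v $ 2 * pd 2 f x"
proof -
  have lin: "linear (frechet_derivative f (at x))"
    using assms by (rule linear_frechet_derivative)
  have "v = v $ 1 *\<^sub>R axis 1 1 + v $ 2 *\<^sub>R axis 2 1"
    by (auto simp: vec_eq_iff axis_def forall_2)
  then have "frechet_derivative f (at x) v = frechet_derivative f (at x) (v $ 1 *\<^sub>R axis 1 1 + v $ 2 *\<^sub>R axis 2 1)"
    by simp
  also have "\<dots> = v $ 1 * pd 1 f x + v $ 2 * pd 2 f x"
    by (simp only: linear_add[OF lin] linear_scale[OF lin] real_scaleR_def)
  finally show ?thesis .
qed

lemma lipschitz_if_partials_bounded:
  fixes f :: "pt \<Rightarrow> real"
  assumes "convex S" and diff: "\<And>x. x \<in> S \<Longrightarrow> f differentiable (at x)"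
    and M: "\<And>x j. x \<in> S \<Longrightarrow> \<bar>pd j f x\<bar> \<le> M" and "M \<ge> 0"
  shows "(2 * M)-lipschitz_on S f"
proof (rule lipschitz_onI)
  fix x y assume xy: "x \<in> S" "y \<in> S"
  have "norm (f x - f y) \<le> (2 * M) * norm (x - y)"
  proof (rule differentiable_bound[OF \<open>convex S\<close> _ _ xy])
    fix z assume z: "z \<in> S"
    show "(f has_derivative frechet_derivative f (at z)) (at z within S)"
      using diff[OF z] by (simp add: frechet_derivative_works has_derivative_at_withinI)
    show "onorm (frechet_derivative f (at z)) \<le> 2 * M"
    proof (rule onorm_le)
      fix v :: pt
      have "\<bar>v $ 1 * pd 1 f z + v $ 2 * pd 2 f z\<bar> \<le> \<bar>v $ 1\<bar> * \<bar>pd 1 f z\<bar> + \<bar>v $ 2\<bar> * \<bar>pd 2 f z\<bar>"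
        by (simp add: abs_triangle_ineq[THEN order_trans] abs_mult)
      also have "\<dots> \<le> norm v * M + norm v * M"
        by (intro add_mono mult_mono M z component_le_norm_cart) auto
      finally show "norm (frechet_derivative f (at z) v) \<le> 2 * M * norm v"
        by (subst frechet_derivative_partials[OF diff[OF z]]) (simp add: mult_ac)
    qed
  qed
  then show "dist (f x) (f y) \<le> (2 * M) * dist x y" by (simp add: dist_norm)
qed (use \<open>M \<ge> 0\<close> in simp)

lemma Ck1_lipschitz_on_compact:
  assumes "Ck (Suc 0) f" "compact S" "convex S"
  obtains L where "L-lipschitz_on S f"
proof -
  have "\<exists>M. \<forall>x\<in>S. \<bar>pd j f x\<bar> \<le> M" for j
  proof -
    have "continuous_on S (pd j f)"
      using Ck_SucD(2)[OF assms(1)] continuous_on_subset by (simp, blast)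
    then have "bounded (pd j f ` S)"
      using assms(2) compact_continuous_image compact_imp_bounded by blast
    then show ?thesis by (auto simp: bounded_iff)
  qed
  then obtain M where M: "\<And>j x. x \<in> S \<Longrightarrow> \<bar>pd j f x\<bar> \<le> M j" by metis
  define m where "m = \<bar>M 1\<bar> + \<bar>M 2\<bar>"
  have "(2 * m)-lipschitz_on S f"
  proof (rule lipschitz_if_partials_bounded[OF assms(3)])
    show "f differentiable (at x)" for x
      using Ck_SucD(1)[OF assms(1)] by (auto simp: differentiable_def)
    show "\<bar>pd j f x\<bar> \<le> m" if "x \<in> S" for x j
      using M[OF that, of j] exhaust_2[of j] by (auto simp: m_def)
  qed (simp add: m_def)
  then show ?thesis by (rule that)
qed

lemma test_function_bounds:
  assumes \<phi>: "\<phi> \<in> test_functions U"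
  obtains L B where "L-lipschitz_on UNIV \<phi>" "\<And>x. \<bar>\<phi> x\<bar> \<le> B" "B \<ge> 0"
proof -
  obtain C where C: "compact C" "\<And>x. x \<notin> C \<Longrightarrow> \<phi> x = 0"
    "\<And>x v. x \<notin> C \<Longrightarrow> frechet_derivative \<phi> (at x) v = 0"
    using test_function_support[OF \<phi>] by metis
  have bd: "\<exists>M. \<forall>x. \<bar>g x\<bar> \<le> M" if "continuous_on UNIV g" "\<And>x. x \<notin> C \<Longrightarrow> g x = 0" for g :: "pt \<Rightarrow> real"
  proof -
    have "bounded (g ` C)"
      by (intro compact_imp_bounded compact_continuous_image C(1) continuous_on_subset[OF that(1)]) simp
    then obtain M where "\<And>x. x \<in> C \<Longrightarrow> \<bar>g x\<bar> \<le> M" by (auto simp: bounded_iff)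
    then have "\<bar>g x\<bar> \<le> max M 0" for x using that(2)[of x] by (cases "x \<in> C") force+
    then show ?thesis by blast
  qed
  obtain B where B: "\<And>x. \<bar>\<phi> x\<bar> \<le> B" using bd[of \<phi>] C(2) test_functionD(4)[OF \<phi>] by blast
  have "\<exists>M. \<forall>x. \<bar>pd j \<phi> x\<bar> \<le> M" for j
    using C(3) test_functionD(3)[OF \<phi>] by (intro bd)
  then obtain M where M: "\<And>j x. \<bar>pd j \<phi> x\<bar> \<le> M j" by metis
  define m where "m = \<bar>M 1\<bar> + \<bar>M 2\<bar>"
  have "(2 * m)-lipschitz_on UNIV \<phi>"
  proof (rule lipschitz_if_partials_bounded)
    show "\<phi> differentiable (at x)" for x
      using test_functionD(2)[OF \<phi>] by (auto simp: differentiable_def)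
    show "\<bar>pd j \<phi> x\<bar> \<le> m" for x j
      using M[of x j] exhaust_2[of j] by (auto simp: m_def)
  qed (auto simp: m_def)
  moreover have "B \<ge> 0" using B[of 0] by simp
  ultimately show ?thesis using that B by blast
qed

lemma lipschitz_on_mult_bounded:
  fixes f g :: "pt \<Rightarrow> real"
  assumes f: "L-lipschitz_on S f" "\<And>x. x \<in> S \<Longrightarrow> \<bar>f x\<bar> \<le> B" and g: "M-lipschitz_on S g" "\<And>x. x \<in> S \<Longrightarrow> \<bar>g x\<bar> \<le> C"
    and nn: "B \<ge> 0" "C \<ge> 0"
  shows "(B * M + C * L)-lipschitz_on S (\<lambda>x. f x * g x)"
proof (rule lipschitz_onI)
  fix x y assume xy: "x \<in> S" "y \<in> S"
  have "\<bar>f x * g x - f y * g y\<bar> = \<bar>f x * (g x - g y) + g y * (f x - f y)\<bar>"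
    by (simp add: algebra_simps)
  also have "\<dots> \<le> \<bar>f x\<bar> * \<bar>g x - g y\<bar> + \<bar>g y\<bar> * \<bar>f x - f y\<bar>"
    by (rule abs_triangle_ineq[THEN order_trans]) (simp add: abs_mult)
  also have "\<dots> \<le> B * (M * dist x y) + C * (L * dist x y)"
    using lipschitz_onD[OF f(1) xy] lipschitz_onD[OF g(1) xy] f(2)[OF xy(1)] g(2)[OF xy(2)] nn
    by (intro add_mono mult_mono) (auto simp: dist_real_def)
  finally show "dist (f x * g x) (f y * g y) \<le> (B * M + C * L) * dist x y"
    by (simp add: dist_real_def algebra_simps)
qed (use nn lipschitz_on_nonneg[OF f(1)] lipschitz_on_nonneg[OF g(1)] in auto)

lemma frechet_derivative_mult:
  fixes f g :: "pt \<Rightarrow> real"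
  assumes "f differentiable (at x)" "g differentiable (at x)"
  shows "frechet_derivative (\<lambda>x. f x * g x) (at x) v
      = f x * frechet_derivative g (at x) v + frechet_derivative f (at x) v * g x"
  by (rule frechet_derivative_at[symmetric, THEN fun_cong])
    (use has_derivative_mult[OF assms[unfolded frechet_derivative_works]] in simp)

text \<open>The product with a test function is Lipschitz with compact support, so its derivative integrates to
  zero; the product rule turns this into integration by parts. Smooth and piecewise smooth functions
  are both covered because differentiability is required almost everywhere only.\<close>

lemma lipschitz_imp_has_weak_partial:
  fixes W :: "pt \<Rightarrow> real"
  assumes U: "open U" "bounded U" and lip: "L-lipschitz_on UNIV W" and bdd: "\<And>x. \<bar>W x\<bar> \<le> B"
    and diff: "AE x in lebesgue. W differentiable (at x)"
  shows "has_weak_partial U j W (pd j W)"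
  unfolding has_weak_partial_def
proof (intro conjI ballI)
  have sU: "U \<in> sets lebesgue" using U(1) by (rule open_in_sets_lebesgue)
  have cont: "continuous_on UNIV W" using lip by (rule lipschitz_on_continuous_on)
  have B0: "B \<ge> 0" using bdd[of 0] by simp
  have Wm: "W \<in> borel_measurable (lebesgue_on U)"
    using continuous_imp_measurable_on_sets_lebesgue[OF continuous_on_subset[OF cont] sU] by simp
  show "square_integrable U W"
    by (rule square_integrable_bounded_function[OF U Wm]) (use bdd in auto)
  have dm: "pd j W \<in> borel_measurable (lebesgue_on U)"
    by (intro measurable_restrict_space1 borel_measurable_frechet_derivative cont diff)
  have "AE x in lebesgue. \<bar>pd j W x\<bar> \<le> L * norm (axis j 1 :: pt)"
    using diff by eventually_elim (rule abs_frechet_derivative_le_lipschitz[OF lip])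
  then have "AE x in lebesgue_on U. \<bar>pd j W x\<bar> \<le> L * norm (axis j 1 :: pt)"
    using sU by (simp add: AE_restrict_space_iff) (elim AE_mp, auto)
  from square_integrable_bounded_function[OF U dm this]
  show sq: "square_integrable U (pd j W)" .
  fix \<phi> assume \<phi>: "\<phi> \<in> test_functions U"
  obtain M C where \<phi>L: "M-lipschitz_on UNIV \<phi>" "\<And>x. \<bar>\<phi> x\<bar> \<le> C" "C \<ge> 0"
    using test_function_bounds[OF \<phi>] by blast
  obtain K where K: "compact K" "K \<subseteq> U" "\<And>x. x \<notin> K \<Longrightarrow> \<phi> x = 0"
    "\<And>x v. x \<notin> K \<Longrightarrow> frechet_derivative \<phi> (at x) v = 0"
    using test_function_support[OF \<phi>] by metis
  have \<phi>d: "\<phi> differentiable (at x)" for x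
    using test_functionD(2)[OF \<phi>] by (auto simp: differentiable_def)
  let ?P = "\<lambda>x. W x * \<phi> x"
  obtain R where R: "\<And>x. x \<in> K \<Longrightarrow> norm x \<le> R"
    using compact_imp_bounded[OF K(1)] by (auto simp: bounded_iff)
  have Pd: "AE x in lebesgue. ?P differentiable (at x)"
    using diff by eventually_elim (intro differentiable_mult \<phi>d)
  have "(\<integral>x. pd j ?P x \<partial>lebesgue) = 0"
  proof (rule integral_frechet_derivative_zero(2)[OF _ _ Pd])
    show "(B * M + C * L)-lipschitz_on UNIV ?P"
      using lip bdd \<phi>L B0 by (intro lipschitz_on_mult_bounded) auto
    show "W x * \<phi> x = 0" if "R < norm x" for x
      using R[of x] K(3)[of x] that by force
  qed
  moreover have "AE x in lebesgue. pd j ?P x = indicator U x *\<^sub>R (W x * pd j \<phi> x + pd j W x * \<phi> x)"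
    using diff
  proof eventually_elim
    case (elim x)
    note fd = frechet_derivative_mult[OF elim \<phi>d[of x], of "axis j 1"]
    show ?case
    proof (cases "x \<in> U")
      case False
      then have "x \<notin> K" using K(2) by blast
      then show ?thesis using fd K(3,4) False by simp
    qed (simp add: fd)
  qed
  ultimately have "(\<integral>x. indicator U x *\<^sub>R (W x * pd j \<phi> x + pd j W x * \<phi> x) \<partial>lebesgue) = 0"
  proof -
    assume 1: "(\<integral>x. pd j ?P x \<partial>lebesgue) = 0"
      and 2: "AE x in lebesgue. pd j ?P x = indicator U x *\<^sub>R (W x * pd j \<phi> x + pd j W x * \<phi> x)"
    have m: "pd j ?P \<in> borel_measurable lebesgue"
      using cont test_functionD(4)[OF \<phi>]
      by (intro borel_measurable_frechet_derivative[OF _ Pd] continuous_on_mult)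
    have "(\<integral>x. pd j ?P x \<partial>lebesgue) = (\<integral>x. indicator U x *\<^sub>R (W x * pd j \<phi> x + pd j W x * \<phi> x) \<partial>lebesgue)"
      by (rule integral_cong_AE[OF m borel_measurable_AE[OF m 2] 2])
    with 1 show ?thesis by simp
  qed
  then have z: "(\<integral>x. W x * pd j \<phi> x + pd j W x * \<phi> x \<partial>lebesgue_on U) = 0"
    using sU by (simp add: integral_restrict_space)
  have "square_integrable U \<phi>" "square_integrable U (pd j \<phi>)"
  proof -
    have m: "g \<in> borel_measurable (lebesgue_on U)" if "continuous_on UNIV g" for g :: "pt \<Rightarrow> real"
      using continuous_imp_measurable_on_sets_lebesgue[OF continuous_on_subset[OF that] sU] by simp
    show "square_integrable U \<phi>"
      by (rule square_integrable_bounded_function[OF U m[OF test_functionD(4)[OF \<phi>]]]) (use \<phi>L in auto)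
    show "square_integrable U (pd j \<phi>)"
      by (rule square_integrable_bounded_function[OF U m[OF test_functionD(3)[OF \<phi>]], where B = "M * norm (axis j 1 :: pt)"])
        (intro AE_I2 abs_frechet_derivative_le_lipschitz[OF \<phi>L(1) \<phi>d])
  qed
  then have "integrable (lebesgue_on U) (\<lambda>x. W x * pd j \<phi> x)" "integrable (lebesgue_on U) (\<lambda>x. pd j W x * \<phi> x)"
    using \<open>square_integrable U W\<close> sq by (auto intro: square_integrable_mult_integrable)
  with z show "(\<integral>x. W x * pd j \<phi> x \<partial>lebesgue_on U) = - (\<integral>x. pd j W x * \<phi> x \<partial>lebesgue_on U)"
    by simp
qed

lemma test_function_has_weak_partial:
  assumes "open U" "bounded U" "\<phi> \<in> test_functions V"
  shows "has_weak_partial U j \<phi> (pd j \<phi>)"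
proof -
  obtain M C where "M-lipschitz_on UNIV \<phi>" "\<And>x. \<bar>\<phi> x\<bar> \<le> C"
    using test_function_bounds[OF assms(3)] by metis
  then show ?thesis
    using assms(1,2) test_functionD(2)[OF assms(3)]
    by (intro lipschitz_imp_has_weak_partial) (auto simp: differentiable_def)
qed

section \<open>Calculus of weak derivatives\<close>

lemma has_weak_partialD:
  assumes "has_weak_partial U j f g"
  shows "square_integrable U f" "square_integrable U g"
    and "\<And>\<phi>. \<phi> \<in> test_functions U \<Longrightarrow>
      (\<integral>x. f x * pd j \<phi> x \<partial>lebesgue_on U) = - (\<integral>x. g x * \<phi> x \<partial>lebesgue_on U)"
  using assms by (auto simp: has_weak_partial_def)

lemma test_function_square_integrable:
  assumes "open U" "bounded U" "\<phi> \<in> test_functions V"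
  shows "square_integrable U \<phi>" "square_integrable U (pd j \<phi>)"
  using has_weak_partialD[OF test_function_has_weak_partial[OF assms, of j]] by auto

lemma has_weak_partial_unique:
  assumes U: "open U" "bounded U" and g: "has_weak_partial U j f g" and h: "has_weak_partial U j f h"
  shows "AE x in lebesgue_on U. g x = h x"
proof -
  have sq: "square_integrable U (\<lambda>x. g x + (-1) * h x)"
    by (intro square_integrable_add square_integrable_cmult has_weak_partialD(2)[OF g] has_weak_partialD(2)[OF h])
  have "AE x in lebesgue_on U. g x + (-1) * h x = 0"
  proof (rule AE_zero_if_orthogonal_to_test_functions[OF U(1) sq])
    fix \<phi> assume \<phi>: "\<phi> \<in> test_functions U"
    note s = test_function_square_integrable(1)[OF U \<phi>]
    have "(\<integral>x. g x * \<phi> x \<partial>lebesgue_on U) = (\<integral>x. h x * \<phi> x \<partial>lebesgue_on U)"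
      using has_weak_partialD(3)[OF g \<phi>] has_weak_partialD(3)[OF h \<phi>] by simp
    then show "(\<integral>x. (g x + (-1) * h x) * \<phi> x \<partial>lebesgue_on U) = 0"
      using square_integrable_mult_integrable[OF has_weak_partialD(2)[OF g] s]
        square_integrable_mult_integrable[OF has_weak_partialD(2)[OF h] s]
      by (simp add: algebra_simps)
  qed
  then show ?thesis by eventually_elim simp
qed

lemma has_weak_partial_weak_partial:
  "has_weak_partial U j f g \<Longrightarrow> has_weak_partial U j f (weak_partial U j f)"
  unfolding weak_partial_def by (rule someI[of "has_weak_partial U j f"])

text \<open>\<open>weak_partial\<close> is an arbitrary choice of a weak derivative. Uniqueness almost everywhere is what makes it
  additive and compatible with restriction to subdomains.\<close>

lemma weak_partial_AE_eq:
  assumes "open U" "bounded U" "has_weak_partial U j f g"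
  shows "AE x in lebesgue_on U. weak_partial U j f x = g x"
  using has_weak_partial_unique[OF assms(1,2) has_weak_partial_weak_partial[OF assms(3)] assms(3)] .

lemma has_weak_partial_add:
  assumes U: "open U" "bounded U" and f: "has_weak_partial U j f f'" and g: "has_weak_partial U j g g'"
  shows "has_weak_partial U j (\<lambda>x. f x + g x) (\<lambda>x. f' x + g' x)"
  unfolding has_weak_partial_def
proof (intro conjI ballI square_integrable_add has_weak_partialD(1)[OF f] has_weak_partialD(1)[OF g]
    has_weak_partialD(2)[OF f] has_weak_partialD(2)[OF g])
  fix \<phi> assume \<phi>: "\<phi> \<in> test_functions U"
  note s = test_function_square_integrable[OF U \<phi>]
  note i = square_integrable_mult_integrable[OF has_weak_partialD(1)[OF f] s(2)[of j]]
    square_integrable_mult_integrable[OF has_weak_partialD(1)[OF g] s(2)[of j]]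
    square_integrable_mult_integrable[OF has_weak_partialD(2)[OF f] s(1)]
    square_integrable_mult_integrable[OF has_weak_partialD(2)[OF g] s(1)]
  show "(\<integral>x. (f x + g x) * pd j \<phi> x \<partial>lebesgue_on U) = - (\<integral>x. (f' x + g' x) * \<phi> x \<partial>lebesgue_on U)"
    using i has_weak_partialD(3)[OF f \<phi>] has_weak_partialD(3)[OF g \<phi>]
    by (simp add: distrib_right)
qed

lemma has_weak_partial_cmult:
  assumes f: "has_weak_partial U j f f'"
  shows "has_weak_partial U j (\<lambda>x. c * f x) (\<lambda>x. c * f' x)"
  unfolding has_weak_partial_def
proof (intro conjI ballI square_integrable_cmult has_weak_partialD(1)[OF f] has_weak_partialD(2)[OF f])
  fix \<phi> assume \<phi>: "\<phi> \<in> test_functions U"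
  show "(\<integral>x. (c * f x) * pd j \<phi> x \<partial>lebesgue_on U) = - (\<integral>x. (c * f' x) * \<phi> x \<partial>lebesgue_on U)"
    using has_weak_partialD(3)[OF f \<phi>] by (simp add: mult.assoc)
qed

lemma has_weak_partial_diff:
  assumes U: "open U" "bounded U" and f: "has_weak_partial U j f f'" and g: "has_weak_partial U j g g'"
  shows "has_weak_partial U j (\<lambda>x. f x - g x) (\<lambda>x. f' x - g' x)"
  using has_weak_partial_add[OF U f has_weak_partial_cmult[OF g, of "-1"]] by simp

lemma has_weak_partial_zero: "has_weak_partial U j (\<lambda>x. 0) (\<lambda>x. 0)"
  by (simp add: has_weak_partial_def square_integrable_zero)

lemma has_weak_partial_sum:
  assumes U: "open U" "bounded U" and "\<And>i. i \<in> I \<Longrightarrow> has_weak_partial U j (f i) (f' i)"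
  shows "has_weak_partial U j (\<lambda>x. \<Sum>i\<in>I. f i x) (\<lambda>x. \<Sum>i\<in>I. f' i x)"
  using assms(3)
proof (induction I rule: infinite_finite_induct)
  case (insert k I)
  have "has_weak_partial U j (\<lambda>x. f k x + (\<Sum>i\<in>I. f i x)) (\<lambda>x. f' k x + (\<Sum>i\<in>I. f' i x))"
    by (rule has_weak_partial_add[OF U]) (use insert in auto)
  then show ?case using insert(1,2) by simp
qed (simp_all add: has_weak_partial_zero)

lemma test_functions_mono: "V \<subseteq> U \<Longrightarrow> test_functions V \<subseteq> test_functions U"
  unfolding test_functions_def by blast

lemma square_integrable_subset:
  fixes f :: "pt \<Rightarrow> real"
  assumes "V \<subseteq> U" "V \<in> sets lebesgue" "U \<in> sets lebesgue" "square_integrable U f"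
  shows "square_integrable V f"
proof -
  have VU: "V \<inter> U = V" using assms(1) by blast
  have "integrable lebesgue (\<lambda>x. indicator U x *\<^sub>R (f x)\<^sup>2)"
    using integrable_restrict_space[of U lebesgue "\<lambda>x. (f x)\<^sup>2"] assms(3,4)
    by (simp only: square_integrable_real) simp
  then have 1: "integrable lebesgue (\<lambda>x. indicator V x *\<^sub>R (indicator U x *\<^sub>R (f x)\<^sup>2))"
    by (rule integrable_mult_indicator[rotated]) (use assms(2) in simp)
  have "(\<lambda>x. indicator V x *\<^sub>R (indicator U x *\<^sub>R (f x)\<^sup>2)) = (\<lambda>x. indicator V x *\<^sub>R (f x)\<^sup>2)"
    using assms(1) by (auto simp: indicator_def fun_eq_iff)
  with 1 have "integrable (lebesgue_on V) (\<lambda>x. (f x)\<^sup>2)"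
    using integrable_restrict_space[of V lebesgue "\<lambda>x. (f x)\<^sup>2"] assms(2) by simp
  moreover have "f \<in> borel_measurable (lebesgue_on V)"
    using assms by (meson measurable_restrict_mono square_integrable_real)
  ultimately show ?thesis by (simp add: square_integrable_real)
qed

lemma has_weak_partial_subset:
  assumes VU: "V \<subseteq> U" and V: "open V" and U: "open U" and f: "has_weak_partial U j f g"
  shows "has_weak_partial V j f g"
  unfolding has_weak_partial_def
proof (intro conjI ballI)
  note s = V[THEN open_in_sets_lebesgue] U[THEN open_in_sets_lebesgue]
  show "square_integrable V f" "square_integrable V g"
    using square_integrable_subset[OF VU s] has_weak_partialD(1,2)[OF f] by blast+
  fix \<phi> assume \<phi>: "\<phi> \<in> test_functions V"
  then have \<phi>U: "\<phi> \<in> test_functions U" using test_functions_mono[OF VU] by blast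
  obtain K where K: "K \<subseteq> V" "\<And>x. x \<notin> K \<Longrightarrow> \<phi> x = 0"
    "\<And>x v. x \<notin> K \<Longrightarrow> frechet_derivative \<phi> (at x) v = 0"
    using test_function_support[OF \<phi>] by metis
  have "(\<integral>x. f x * pd j \<phi> x \<partial>lebesgue_on U) = (\<integral>x. f x * pd j \<phi> x \<partial>lebesgue_on V)"
    "(\<integral>x. g x * \<phi> x \<partial>lebesgue_on U) = (\<integral>x. g x * \<phi> x \<partial>lebesgue_on V)"
    using K by (intro integral_restrict_support VU s; force)+
  then show "(\<integral>x. f x * pd j \<phi> x \<partial>lebesgue_on V) = - (\<integral>x. g x * \<phi> x \<partial>lebesgue_on V)"
    using has_weak_partialD(3)[OF f \<phi>U] by simp
qed

lemma borel_measurable_lebesgue_on_cong_AE: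
  fixes f g :: "pt \<Rightarrow> real"
  assumes U: "U \<in> sets lebesgue" and f: "f \<in> borel_measurable (lebesgue_on U)"
    and eq: "AE x in lebesgue_on U. f x = g x"
  shows "g \<in> borel_measurable (lebesgue_on U)"
proof -
  have "(\<lambda>x. indicator U x *\<^sub>R f x) \<in> borel_measurable lebesgue"
    using f U by (simp add: borel_measurable_restrict_space_iff)
  moreover have "AE x in lebesgue. indicator U x *\<^sub>R f x = indicator U x *\<^sub>R g x"
  proof -
    have "AE x in lebesgue. x \<in> U \<longrightarrow> f x = g x" using eq U by (simp add: AE_restrict_space_iff)
    then show ?thesis by eventually_elim (auto simp: indicator_def)
  qed
  ultimately have "(\<lambda>x. indicator U x *\<^sub>R g x) \<in> borel_measurable lebesgue"
    by (rule borel_measurable_AE)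
  then show ?thesis using U by (simp add: borel_measurable_restrict_space_iff)
qed

lemma square_integrable_cong_AE:
  fixes f g :: "pt \<Rightarrow> real"
  assumes U: "U \<in> sets lebesgue" and f: "square_integrable U f"
    and eq: "AE x in lebesgue_on U. f x = g x"
  shows "square_integrable U g"
proof -
  have g: "g \<in> borel_measurable (lebesgue_on U)"
    using borel_measurable_lebesgue_on_cong_AE[OF U _ eq] f by (simp add: square_integrable_real)
  have "AE x in lebesgue_on U. (f x)\<^sup>2 = (g x)\<^sup>2" using eq by eventually_elim simp
  then have "integrable (lebesgue_on U) (\<lambda>x. (g x)\<^sup>2)"
    using f g by (subst integrable_cong_AE[symmetric]) (auto simp: square_integrable_real)
  then show ?thesis using g by (simp add: square_integrable_real)
qed

lemma has_weak_partial_cong_AE: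
  assumes U: "open U" and f: "has_weak_partial U j f f'"
    and fg: "AE x in lebesgue_on U. f x = g x" and fg': "AE x in lebesgue_on U. f' x = g' x"
  shows "has_weak_partial U j g g'"
  unfolding has_weak_partial_def
proof (intro conjI ballI)
  have sU: "U \<in> sets lebesgue" using U by (rule open_in_sets_lebesgue)
  show g: "square_integrable U g" "square_integrable U g'"
    using square_integrable_cong_AE[OF sU has_weak_partialD(1)[OF f] fg]
      square_integrable_cong_AE[OF sU has_weak_partialD(2)[OF f] fg'] .
  fix \<phi> assume \<phi>: "\<phi> \<in> test_functions U"
  have m: "h \<in> borel_measurable (lebesgue_on U)" if "continuous_on UNIV h" for h :: "pt \<Rightarrow> real"
    using continuous_imp_measurable_on_sets_lebesgue[OF continuous_on_subset[OF that] sU] by simp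
  note ms = m[OF test_functionD(4)[OF \<phi>]] m[OF test_functionD(3)[OF \<phi>]]
  have "(\<integral>x. f x * pd j \<phi> x \<partial>lebesgue_on U) = (\<integral>x. g x * pd j \<phi> x \<partial>lebesgue_on U)"
  proof (rule integral_cong_AE)
    show "AE x in lebesgue_on U. f x * pd j \<phi> x = g x * pd j \<phi> x"
      using fg by eventually_elim simp
  qed (use g has_weak_partialD(1)[OF f] ms in \<open>auto simp: square_integrable_real intro!: borel_measurable_times\<close>)
  moreover have "(\<integral>x. f' x * \<phi> x \<partial>lebesgue_on U) = (\<integral>x. g' x * \<phi> x \<partial>lebesgue_on U)"
  proof (rule integral_cong_AE)
    show "AE x in lebesgue_on U. f' x * \<phi> x = g' x * \<phi> x"
      using fg' by eventually_elim simp
  qed (use g has_weak_partialD(2)[OF f] ms in \<open>auto simp: square_integrable_real intro!: borel_measurable_times\<close>)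
  ultimately show "(\<integral>x. g x * pd j \<phi> x \<partial>lebesgue_on U) = - (\<integral>x. g' x * \<phi> x \<partial>lebesgue_on U)"
    using has_weak_partialD(3)[OF f \<phi>] by simp
qed

section \<open>The energy space\<close>

lemma H1_has_weak_partial:
  "u \<in> H1 U \<Longrightarrow> has_weak_partial U j (\<lambda>x. u x $ i) (weak_partial U j (\<lambda>x. u x $ i))"
  unfolding H1_def using has_weak_partial_weak_partial by blast

lemma borel_measurable_vec_if_components:
  fixes f :: "pt \<Rightarrow> 'a::euclidean_space^2"
  assumes "\<And>i. (\<lambda>x. f x $ i) \<in> borel_measurable M"
  shows "f \<in> borel_measurable M"
proof (subst borel_measurable_euclidean_space, intro ballI)
  fix b :: "'a^2" assume "b \<in> Basis"
  then obtain i u where "b = axis i u" by (auto simp: Basis_vec_def)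
  then show "(\<lambda>x. f x \<bullet> b) \<in> borel_measurable M"
    using assms[of i] by (simp add: inner_axis)
qed

lemma vec2_square_integrable:
  fixes u :: field
  assumes "\<And>i. square_integrable U (\<lambda>x. u x $ i)"
  shows "square_integrable U u"
proof -
  have "u \<in> borel_measurable (lebesgue_on U)"
  proof (rule borel_measurable_vec_if_components)
    show "(\<lambda>x. u x $ i) \<in> borel_measurable (lebesgue_on U)" for i
      using assms[of i] by (simp add: square_integrable_real)
  qed
  moreover have "(\<lambda>x. (norm (u x))\<^sup>2) = (\<lambda>x. \<Sum>i\<in>UNIV. (u x $ i)\<^sup>2)"
    by (simp add: norm_vec_def L2_set_def sum_nonneg)
  ultimately show ?thesis using assms by (simp add: square_integrable_def)
qed

lemma mat22_square_integrable:
  fixes A :: "pt \<Rightarrow> real^2^2"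
  assumes "\<And>i j. square_integrable U (\<lambda>x. A x $ i $ j)"
  shows "square_integrable U A"
proof -
  have "A \<in> borel_measurable (lebesgue_on U)"
  proof (intro borel_measurable_vec_if_components)
    show "(\<lambda>x. A x $ i $ j) \<in> borel_measurable (lebesgue_on U)" for i j
      using assms[of i j] by (simp add: square_integrable_real)
  qed
  moreover have "(\<lambda>x. (norm (A x))\<^sup>2) = (\<lambda>x. \<Sum>i\<in>UNIV. \<Sum>j\<in>UNIV. (A x $ i $ j)\<^sup>2)"
    by (simp add: norm_vec_def L2_set_def sum_nonneg)
  ultimately show ?thesis using assms by (simp add: square_integrable_def)
qed

lemma l2_norm_component_le:
  fixes f :: "pt \<Rightarrow> 'b::euclidean_space" and g :: "pt \<Rightarrow> real"
  assumes "square_integrable U f" "square_integrable U g" "\<And>x. \<bar>g x\<bar> \<le> norm (f x)"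
  shows "l2_norm U g \<le> l2_norm U f"
  unfolding l2_norm_def
proof (intro real_sqrt_le_mono integral_mono)
  show "(norm (g x))\<^sup>2 \<le> (norm (f x))\<^sup>2" for x
    using assms(3) by (intro power_mono) auto
qed (use assms in \<open>auto simp: square_integrable_def\<close>)

lemma l2_norm_le_h1_norm:
  assumes u: "u \<in> H1 U"
  shows "l2_norm U (\<lambda>x. u x $ i) \<le> h1_norm U u"
    and "l2_norm U (weak_partial U j (\<lambda>x. u x $ i)) \<le> h1_norm U u"
    and "square_integrable U (grad U u)"
proof -
  note w = H1_has_weak_partial[OF u]
  have su: "square_integrable U u"
    by (rule vec2_square_integrable) (rule has_weak_partialD(1)[OF w])
  show sg: "square_integrable U (grad U u)"
    by (rule mat22_square_integrable) (simp add: grad_def has_weak_partialD(2)[OF w])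
  have "l2_norm U (\<lambda>x. u x $ i) \<le> l2_norm U u"
    by (rule l2_norm_component_le[OF su has_weak_partialD(1)[OF w]]) (rule component_le_norm_cart)
  also have "\<dots> \<le> h1_norm U u" by (simp add: h1_norm_def real_le_rsqrt)
  finally show "l2_norm U (\<lambda>x. u x $ i) \<le> h1_norm U u" .
  have "\<bar>weak_partial U j (\<lambda>x. u x $ i) x\<bar> \<le> norm (grad U u x)" for x
    using component_le_norm_cart[of "grad U u x $ i" j] Finite_Cartesian_Product.norm_nth_le[of "grad U u x" i]
    by (simp add: grad_def)
  then have "l2_norm U (weak_partial U j (\<lambda>x. u x $ i)) \<le> l2_norm U (grad U u)"
    by (rule l2_norm_component_le[OF sg has_weak_partialD(2)[OF w]])
  also have "\<dots> \<le> h1_norm U u" by (simp add: h1_norm_def real_le_rsqrt)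
  finally show "l2_norm U (weak_partial U j (\<lambda>x. u x $ i)) \<le> h1_norm U u" .
qed

lemma divergence_eq: "divergence U u x = (\<Sum>i\<in>UNIV. weak_partial U i (\<lambda>x. u x $ i) x)"
  by (simp add: divergence_def trace_def grad_def)

lemma divergence_square_integrable: "u \<in> H1 U \<Longrightarrow> square_integrable U (divergence U u)"
  unfolding divergence_eq[abs_def]
  by (intro square_integrable_sum has_weak_partialD(2)[OF H1_has_weak_partial])

lemma divergence_AE_zero:
  assumes "u \<in> H1 U" "h1_norm U u = 0"
  shows "AE x in lebesgue_on U. divergence U u x = 0"
proof -
  have "l2_norm U (weak_partial U i (\<lambda>x. u x $ i)) = 0" for i
    using l2_norm_le_h1_norm(2)[OF assms(1), of i i] assms(2)
      l2_norm_nonneg[of U "weak_partial U i (\<lambda>x. u x $ i)"] by linarith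
  then have "AE x in lebesgue_on U. weak_partial U i (\<lambda>x. u x $ i) x = 0" for i
    by (intro AE_zero_if_l2_norm_zero has_weak_partialD(2)[OF H1_has_weak_partial[OF assms(1)]])
  then have "AE x in lebesgue_on U. \<forall>i\<in>UNIV. weak_partial U i (\<lambda>x. u x $ i) x = 0"
    by (intro AE_finite_allI) auto
  then show ?thesis by eventually_elim (simp add: divergence_eq)
qed

text \<open>Test functions are dense in \<open>H1_0\<close>, so integration by parts against any weakly
  differentiable factor, without boundary condition, extends from them to \<open>H1_0\<close>.\<close>

lemma H1_0_integration_by_parts:
  assumes U: "open U" "bounded U" and v: "v \<in> H1_0 U" and q: "has_weak_partial U j q r"
  shows "(\<integral>x. weak_partial U j (\<lambda>x. v x $ i) x * q x \<partial>lebesgue_on U)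
       = - (\<integral>x. v x $ i * r x \<partial>lebesgue_on U)"
proof -
  define D where "D = weak_partial U j (\<lambda>x. v x $ i)"
  have vH: "v \<in> H1 U" using v by (simp add: H1_0_def)
  note w = H1_has_weak_partial[OF vH, of j i, folded D_def]
  note sq = has_weak_partialD(1,2)[OF q] has_weak_partialD(1,2)[OF w]
  define X where "X = (\<integral>x. D x * q x \<partial>lebesgue_on U) + (\<integral>x. v x $ i * r x \<partial>lebesgue_on U)"
  have "\<bar>X\<bar> \<le> e * (l2_norm U q + l2_norm U r)" if "e > 0" for e
  proof -
    obtain \<phi> :: field where \<phi>: "\<And>i. (\<lambda>x. \<phi> x $ i) \<in> test_functions U" "h1_norm U (\<lambda>x. v x - \<phi> x) < e"
      using v \<open>e > 0\<close> unfolding H1_0_def by blast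
    note t = test_function_has_weak_partial[OF U \<phi>(1)]
    have dH: "has_weak_partial U j (\<lambda>x. (v x - \<phi> x) $ i) (\<lambda>x. weak_partial U j (\<lambda>x. v x $ i) x - pd j (\<lambda>x. \<phi> x $ i) x)" for i j
      using has_weak_partial_diff[OF U H1_has_weak_partial[OF vH] t] by simp
    then have H: "(\<lambda>x. v x - \<phi> x) \<in> H1 U" unfolding H1_def by blast
    let ?f = "\<lambda>x. \<phi> x $ i"
    define d where "d = (\<lambda>x. v x $ i - ?f x)"
    define d' where "d' = weak_partial U j (\<lambda>x. (v x - \<phi> x) $ i)"
    have n: "l2_norm U d \<le> e" "l2_norm U d' \<le> e"
      using l2_norm_le_h1_norm(1)[OF H, of i] l2_norm_le_h1_norm(2)[OF H, of j i] \<phi>(2)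
      by (simp_all add: d_def d'_def)
    have sd: "square_integrable U d" "square_integrable U d'"
      using has_weak_partialD(1,2)[OF H1_has_weak_partial[OF H, of j i]] by (simp_all add: d_def d'_def)
    have d': "AE x in lebesgue_on U. d' x = D x - pd j ?f x"
      unfolding d'_def D_def by (rule weak_partial_AE_eq[OF U dH])
    note st = test_function_square_integrable[OF U \<phi>(1)[of i]]
    have "(\<integral>x. d' x * q x \<partial>lebesgue_on U) = (\<integral>x. (D x - pd j ?f x) * q x \<partial>lebesgue_on U)"
    proof (rule integral_cong_AE)
      show "AE x in lebesgue_on U. d' x * q x = (D x - pd j ?f x) * q x"
        using d' by eventually_elim simp
    qed (use sd sq st in \<open>auto simp: square_integrable_real intro!: borel_measurable_times borel_measurable_diff\<close>)
    also have "\<dots> = (\<integral>x. D x * q x \<partial>lebesgue_on U) - (\<integral>x. q x * pd j ?f x \<partial>lebesgue_on U)"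
      using square_integrable_mult_integrable[OF sq(4,1)] square_integrable_mult_integrable[OF sq(1) st(2)]
      by (simp add: left_diff_distrib mult.commute[of "pd j ?f _"])
    finally have 1: "(\<integral>x. d' x * q x \<partial>lebesgue_on U) = (\<integral>x. D x * q x \<partial>lebesgue_on U) + (\<integral>x. r x * ?f x \<partial>lebesgue_on U)"
      using has_weak_partialD(3)[OF q \<phi>(1)] by simp
    have 2: "(\<integral>x. d x * r x \<partial>lebesgue_on U) = (\<integral>x. v x $ i * r x \<partial>lebesgue_on U) - (\<integral>x. r x * ?f x \<partial>lebesgue_on U)"
      using square_integrable_mult_integrable[OF sq(3,2)] square_integrable_mult_integrable[OF sq(2) st(1)]
      by (simp add: d_def left_diff_distrib mult.commute[of "\<phi> _ $ i"])
    have "X = (\<integral>x. d' x * q x \<partial>lebesgue_on U) + (\<integral>x. d x * r x \<partial>lebesgue_on U)"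
      unfolding X_def 1 2 by simp
    then have "\<bar>X\<bar> \<le> l2_norm U d' * l2_norm U q + l2_norm U d * l2_norm U r"
      using abs_integral_mult_le_l2_norm[OF sd(2) sq(1)] abs_integral_mult_le_l2_norm[OF sd(1) sq(2)]
      by linarith
    also have "\<dots> \<le> e * l2_norm U q + e * l2_norm U r"
      using n by (intro add_mono mult_right_mono l2_norm_nonneg)
    finally show ?thesis by (simp add: distrib_left)
  qed
  then have bound: "\<bar>X\<bar> \<le> e * (l2_norm U q + l2_norm U r + 1)" if "e > 0" for e
    using that by (smt (verit) mult_left_mono)
  have "X = 0"
  proof (rule ccontr)
    assume "X \<noteq> 0"
    have p: "l2_norm U q + l2_norm U r + 1 > 0"
      using l2_norm_nonneg[of U q] l2_norm_nonneg[of U r] by linarith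
    define S where "S = l2_norm U q + l2_norm U r + 1"
    have "\<bar>X\<bar> / 2 / S > 0" "\<bar>X\<bar> / 2 / S * S = \<bar>X\<bar> / 2"
      using p \<open>X \<noteq> 0\<close> by (simp_all add: S_def[symmetric])
    with bound[of "\<bar>X\<bar> / 2 / S", folded S_def] \<open>X \<noteq> 0\<close> show False by simp
  qed
  then show ?thesis by (simp add: X_def D_def)
qed

section \<open>Boundary values of continuous functions\<close>

text \<open>A bump function of class \<open>C1\<close>, supported in the ball of radius \<open>s\<close> around \<open>x0\<close>, whose derivative in
  direction \<open>\<nu>\<close> has the sign of \<open>- (x - x0) \<bullet> \<nu>\<close>.\<close>

definition cutoff :: "pt \<Rightarrow> real \<Rightarrow> pt \<Rightarrow> real" where
  "cutoff x0 s x = (max 0 (1 - ((x - x0) \<bullet> (x - x0)) / s\<^sup>2))\<^sup>2"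

lemma max_zero_square_has_derivative:
  "((\<lambda>y::real. (max 0 y)\<^sup>2) has_real_derivative 2 * max 0 y) (at y)"
proof -
  consider "y > 0" | "y < 0" | "y = 0" by linarith
  then show ?thesis
  proof cases
    case 1
    have "((\<lambda>y::real. y\<^sup>2) has_real_derivative 2 * max 0 y) (at y)"
      using 1 by (auto intro!: derivative_eq_intros)
    then show ?thesis
      by (rule has_field_derivative_transform_within_open[where S = "{0<..}"]) (use 1 in auto)
  next
    case 2
    have "((\<lambda>y::real. 0) has_real_derivative 2 * max 0 y) (at y)"
      using 2 by auto
    then show ?thesis
      by (rule has_field_derivative_transform_within_open[where S = "{..<0}"]) (use 2 in auto)
  next
    case 3
    have "((\<lambda>h::real. \<bar>h\<bar>) \<longlongrightarrow> 0) (at 0)"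
      by (rule tendsto_eq_intros refl)+ simp
    moreover have "\<bar>(max 0 h)\<^sup>2 / h\<bar> \<le> \<bar>h\<bar>" for h :: real
      by (cases "h > 0") (auto simp: power2_eq_square)
    ultimately have "((\<lambda>h::real. (max 0 h)\<^sup>2 / h) \<longlongrightarrow> 0) (at 0)"
      by (intro Lim_null_comparison[of "\<lambda>h. (max 0 h)\<^sup>2 / h" "\<lambda>h. \<bar>h\<bar>"]) auto
    then show ?thesis using 3 by (simp add: has_field_derivative_iff)
  qed
qed

lemma cutoff_has_derivative:
  "(cutoff x0 s has_derivative
     (\<lambda>v. - 4 * max 0 (1 - ((x - x0) \<bullet> (x - x0)) / s\<^sup>2) * ((x - x0) \<bullet> v) / s\<^sup>2)) (at x)"
proof -
  have "((\<lambda>x. 1 - ((x - x0) \<bullet> (x - x0)) / s\<^sup>2) has_derivative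
      (\<lambda>v. - (2 * ((x - x0) \<bullet> v) / s\<^sup>2))) (at x)"
  proof -
    have "((\<lambda>x. x - x0) has_derivative (\<lambda>v. v)) (at x)"
      by (auto intro!: derivative_eq_intros)
    from has_derivative_inner[OF this this]
    have "((\<lambda>x. (x - x0) \<bullet> (x - x0)) has_derivative (\<lambda>v. 2 * ((x - x0) \<bullet> v))) (at x)"
      by (simp add: inner_commute)
    from has_derivative_diff[OF has_derivative_const[of 1] has_derivative_mult_left[OF this, of "1 / s\<^sup>2"]]
    show ?thesis by simp
  qed
  from DERIV_compose_FDERIV[OF max_zero_square_has_derivative this]
  have "((\<lambda>x. (max 0 (1 - ((x - x0) \<bullet> (x - x0)) / s\<^sup>2))\<^sup>2) has_derivative
     (\<lambda>v. - (2 * ((x - x0) \<bullet> v) / s\<^sup>2) * (2 * max 0 (1 - ((x - x0) \<bullet> (x - x0)) / s\<^sup>2)))) (at x)" .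
  then show ?thesis
    unfolding cutoff_def[abs_def] by (rule has_derivative_eq_rhs) (simp add: fun_eq_iff)
qed

lemma cutoff_derivative:
  "frechet_derivative (cutoff x0 s) (at x) v =
     - 4 * max 0 (1 - ((x - x0) \<bullet> (x - x0)) / s\<^sup>2) * ((x - x0) \<bullet> v) / s\<^sup>2"
  using frechet_derivative_at[OF cutoff_has_derivative] by metis

lemma cutoff_bounds:
  assumes "s > 0"
  shows "0 \<le> cutoff x0 s x" "cutoff x0 s x \<le> 1"
    and "x \<notin> ball x0 s \<Longrightarrow> cutoff x0 s x = 0"
    and "x \<notin> ball x0 s \<Longrightarrow> frechet_derivative (cutoff x0 s) (at x) v = 0"
proof -
  have q: "0 \<le> ((x - x0) \<bullet> (x - x0)) / s\<^sup>2" by simp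
  show "0 \<le> cutoff x0 s x" by (simp add: cutoff_def)
  show "cutoff x0 s x \<le> 1" unfolding cutoff_def using q by (intro power_le_one) auto
  have "1 \<le> ((x - x0) \<bullet> (x - x0)) / s\<^sup>2" if "x \<notin> ball x0 s"
  proof -
    have "s \<le> norm (x - x0)" using that by (simp add: dist_norm norm_minus_commute)
    then have "s\<^sup>2 \<le> (norm (x - x0))\<^sup>2" using assms by (intro power_mono) auto
    then show ?thesis using assms by (simp add: power2_norm_eq_inner)
  qed
  then show "x \<notin> ball x0 s \<Longrightarrow> cutoff x0 s x = 0"
    "x \<notin> ball x0 s \<Longrightarrow> frechet_derivative (cutoff x0 s) (at x) v = 0"
    by (simp_all add: cutoff_def cutoff_derivative)
qed

lemma cutoff_lipschitz:
  assumes "s > 0"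
  shows "(2 * (4 / s))-lipschitz_on UNIV (cutoff x0 s)"
proof (rule lipschitz_if_partials_bounded)
  show "cutoff x0 s differentiable (at x)" for x
    using cutoff_has_derivative differentiable_def by blast
  show "\<bar>pd j (cutoff x0 s) x\<bar> \<le> 4 / s" for x j
  proof (cases "x \<in> ball x0 s")
    case True
    have 1: "\<bar>max 0 (1 - ((x - x0) \<bullet> (x - x0)) / s\<^sup>2)\<bar> \<le> 1" by simp
    have "\<bar>(x - x0) \<bullet> axis j 1\<bar> \<le> norm (x - x0) * norm (axis j 1 :: pt)"
      by (rule Cauchy_Schwarz_ineq2)
    also have "\<dots> \<le> s" using True by (simp add: dist_norm norm_minus_commute norm_axis_1)
    finally have "\<bar>max 0 (1 - ((x - x0) \<bullet> (x - x0)) / s\<^sup>2)\<bar> * \<bar>(x - x0) \<bullet> axis j 1\<bar> \<le> 1 * s"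
      using 1 by (intro mult_mono) auto
    then have "4 * (\<bar>max 0 (1 - ((x - x0) \<bullet> (x - x0)) / s\<^sup>2)\<bar> * \<bar>(x - x0) \<bullet> axis j 1\<bar>) / s\<^sup>2 \<le> 4 * s / s\<^sup>2"
      by (intro divide_right_mono) auto
    also have "4 * s / s\<^sup>2 = 4 / s" using assms by (simp add: power2_eq_square)
    finally show ?thesis unfolding cutoff_derivative abs_mult abs_divide by (simp add: mult.assoc)
  qed (use cutoff_bounds(4)[OF assms] assms in simp)
qed (use assms in auto)

lemma square_integrable_mult_indicator:
  fixes f :: "pt \<Rightarrow> real"
  assumes U: "U \<in> sets lebesgue" and f: "square_integrable U f" and S: "S \<in> sets borel"
  shows "square_integrable U (\<lambda>x. f x * indicator S x)"
proof -
  have Sl: "S \<in> sets lebesgue" using S by (simp add: sets_completionI_sets)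
  have m: "(indicator S :: pt \<Rightarrow> real) \<in> borel_measurable (lebesgue_on U)"
    by (intro measurable_restrict_space1 borel_measurable_indicator Sl)
  have fm: "f \<in> borel_measurable (lebesgue_on U)" and fi: "integrable (lebesgue_on U) (\<lambda>x. (f x)\<^sup>2)"
    using f by (auto simp: square_integrable_real)
  have pm: "(\<lambda>x. f x * indicator S x) \<in> borel_measurable (lebesgue_on U)"
    by (intro borel_measurable_times fm m)
  have "integrable (lebesgue_on U) (\<lambda>x. (f x * indicator S x)\<^sup>2)"
    by (rule Bochner_Integration.integrable_bound[OF fi])
      (use pm in \<open>auto simp: indicator_def intro!: borel_measurable_power\<close>)
  then show ?thesis using pm by (simp add: square_integrable_real)
qed

text \<open>Absolute continuity of the integral; it provides the factor \<open>o(1)\<close> in the comparison of orders below.\<close>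

lemma l2_norm_shrinking_ball:
  fixes f :: "pt \<Rightarrow> real"
  assumes U: "U \<in> sets lebesgue" and f: "square_integrable U f" and s: "s \<longlonglongrightarrow> 0"
  shows "(\<lambda>n. l2_norm U (\<lambda>x. f x * indicator (ball x0 (s n)) x)) \<longlonglongrightarrow> 0"
proof -
  have "(\<lambda>n. \<integral>x. (f x * indicator (ball x0 (s n)) x)\<^sup>2 \<partial>lebesgue_on U) \<longlonglongrightarrow> (\<integral>x. 0 \<partial>lebesgue_on U)"
  proof (rule integral_dominated_convergence[where w = "\<lambda>x. (f x)\<^sup>2"])
    show "integrable (lebesgue_on U) (\<lambda>x. (f x)\<^sup>2)" using f by (simp add: square_integrable_real)
    show "(\<lambda>x. (f x * indicator (ball x0 (s n)) x)\<^sup>2) \<in> borel_measurable (lebesgue_on U)" for n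
      using square_integrable_mult_indicator[OF U f, of "ball x0 (s n)"]
      by (simp add: square_integrable_real borel_measurable_power)
    show "AE x in lebesgue_on U. norm ((f x * indicator (ball x0 (s n)) x)\<^sup>2) \<le> (f x)\<^sup>2" for n
      by (intro AE_I2) (simp add: indicator_def)
    have "AE x in lebesgue. x \<noteq> x0"
      using AE_not_in[of "{x0}" lebesgue] by (simp flip: negligible_iff_null_sets)
    then have "AE x in lebesgue_on U. x \<noteq> x0"
      using U by (subst AE_restrict_space_iff) (auto elim: AE_mp)
    then show "AE x in lebesgue_on U. (\<lambda>n. (f x * indicator (ball x0 (s n)) x)\<^sup>2) \<longlonglongrightarrow> 0"
    proof eventually_elim
      case (elim x)
      then have "eventually (\<lambda>n. s n < dist x0 x) sequentially"
        using order_tendstoD(2)[OF s, of "dist x0 x"] by simp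
      then have "eventually (\<lambda>n. (f x * indicator (ball x0 (s n)) x)\<^sup>2 = 0) sequentially"
        by eventually_elim (simp add: indicator_def)
      then show ?case by (rule tendsto_eventually)
    qed
  qed simp
  then have "(\<lambda>n. sqrt (\<integral>x. (f x * indicator (ball x0 (s n)) x)\<^sup>2 \<partial>lebesgue_on U)) \<longlonglongrightarrow> sqrt 0"
    by (intro tendsto_real_sqrt) simp
  then show ?thesis by (simp add: l2_norm_real)
qed

text \<open>If \<open>h\<close> satisfies the integration by parts formula without boundary term, then \<open>h\<close> has trace
  zero. Were \<open>h x0 \<noteq> 0\<close>, test with bumps of radius \<open>s\<close> around \<open>x0\<close>, differentiated in the outward
  normal direction: on \<open>t\<close> these derivatives have one sign, so the right-hand side is at least of
  order \<open>s\<close>, whereas Cauchy-Schwarz makes the left-hand side \<open>o(s)\<close>.\<close>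

lemma continuous_vanishes_at_boundary_point:
  fixes h :: "pt \<Rightarrow> real" and \<gamma> :: "2 \<Rightarrow> pt \<Rightarrow> real" and \<nu> :: pt
  assumes U: "open U" "bounded U" and t: "convex t" "interior t \<noteq> {}" "interior t \<subseteq> U"
    and x0: "x0 \<in> t" "\<nu> \<noteq> 0" "\<And>y. y \<in> t \<Longrightarrow> \<nu> \<bullet> (y - x0) \<le> 0"
    and r: "r > 0" "ball x0 r \<inter> U \<subseteq> t"
    and h: "continuous_on t h" "square_integrable U h" and \<gamma>: "\<And>j. square_integrable U (\<gamma> j)"
    and ibp: "\<And>j s. s > 0 \<Longrightarrow> (\<integral>x. \<gamma> j x * cutoff x0 s x \<partial>lebesgue_on U)
        = - (\<integral>x. h x * pd j (cutoff x0 s) x \<partial>lebesgue_on U)"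
  shows "h x0 = 0"
proof (rule ccontr)
  assume h0: "h x0 \<noteq> 0"
  have sU: "U \<in> sets lebesgue" using U(1) by (rule open_in_sets_lebesgue)
  define \<sigma> \<delta> where "\<sigma> = sgn (h x0)" and "\<delta> = \<bar>h x0\<bar> / 2"
  have \<delta>: "\<delta> > 0" using h0 by (simp add: \<delta>_def)
  obtain r1 where r1: "r1 > 0" "\<And>y. y \<in> t \<Longrightarrow> dist y x0 < r1 \<Longrightarrow> dist (h y) (h x0) < \<delta>"
    using h(1) x0(1) \<delta> unfolding continuous_on_iff by metis
  have hy: "\<delta> \<le> \<sigma> * h y" if "y \<in> t" "dist y x0 < r1" for y
    using r1(2)[OF that] h0 by (auto simp: \<sigma>_def \<delta>_def dist_real_def sgn_if abs_if split: if_splits)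
  obtain z where z: "z \<in> interior t" using t(2) by blast
  have zneg: "\<nu> \<bullet> (z - x0) < 0"
  proof -
    obtain e where e: "e > 0" "ball z e \<subseteq> t" using z mem_interior by blast
    let ?y = "z + (e / (2 * norm \<nu>)) *\<^sub>R \<nu>"
    have "?y \<in> t" using e x0(2) by (intro subsetD[OF e(2)]) (simp add: dist_norm)
    from x0(3)[OF this] have "\<nu> \<bullet> (z - x0) + (e / (2 * norm \<nu>)) * (\<nu> \<bullet> \<nu>) \<le> 0"
      by (simp add: algebra_simps inner_add_right inner_diff_right)
    moreover have "(e / (2 * norm \<nu>)) * (\<nu> \<bullet> \<nu>) > 0" using e x0(2) by simp
    ultimately show ?thesis by linarith
  qed
  define \<eta> where "\<eta> = - (\<nu> \<bullet> (z - x0)) / 2"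
  have \<eta>: "\<eta> > 0" using zneg by (simp add: \<eta>_def)
  obtain e where e: "e > 0" "ball z e \<subseteq> t" using z mem_interior by blast
  \<comment> \<open>On the ball of this radius around \<open>z\<close>, the distance to the supporting line is at least \<open>\<eta>\<close>.\<close>
  define \<rho> where "\<rho> = min e (\<eta> / norm \<nu>)"
  have \<rho>: "\<rho> > 0" using e \<eta> x0(2) by (simp add: \<rho>_def)
  have zb: "y \<in> t \<and> \<nu> \<bullet> (y - x0) \<le> - \<eta>" if "y \<in> ball z \<rho>" for y
  proof -
    have "\<nu> \<bullet> (y - z) \<le> norm \<nu> * norm (y - z)" by (rule norm_cauchy_schwarz)
    also have "\<dots> \<le> norm \<nu> * (\<eta> / norm \<nu>)"
      using that by (intro mult_left_mono) (auto simp: \<rho>_def dist_norm norm_minus_commute)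
    also have "\<dots> = \<eta>" using x0(2) by simp
    finally have "\<nu> \<bullet> (y - z) \<le> \<eta>" .
    then have "\<nu> \<bullet> (y - x0) \<le> - \<eta>" unfolding \<eta>_def by (simp add: inner_diff_right field_simps)
    moreover have "y \<in> t" using that e(2) by (auto simp: \<rho>_def)
    ultimately show ?thesis by blast
  qed
  \<comment> \<open>Contracting a ball around \<open>z\<close> towards \<open>x0\<close> by the factor \<open>\<kappa> * s\<close> keeps it in \<open>t\<close>; this \<open>\<kappa>\<close> also keeps it
      within distance \<open>s / 2\<close> of \<open>x0\<close>, where the normal derivative of the bump is of order \<open>1 / s\<close>.\<close>
  define \<kappa> where "\<kappa> = 1 / (2 * (norm (z - x0) + \<rho>) + 1)"
  have den: "2 * (norm (z - x0) + \<rho>) + 1 \<ge> 1" using \<rho> by simp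
  then have \<kappa>: "\<kappa> > 0" "\<kappa> \<le> 1" by (simp_all add: \<kappa>_def)
  have \<kappa>1: "\<kappa> * (norm (z - x0) + \<rho>) \<le> 1 / 2"
    using den by (simp add: \<kappa>_def field_simps)
  define v where "v = unit_ball_vol (real DIM(pt))"
  have v: "v > 0" by (simp add: v_def)
  have vol: "measure lebesgue (ball a s) = v * s\<^sup>2" if "s \<ge> 0" for a :: pt and s
    using content_ball[OF that, of a] by (simp add: v_def)
  define c where "c = 3 * \<kappa> * \<eta> * \<delta> * v * (\<kappa> * \<rho>)\<^sup>2"
  have c: "c > 0" using \<kappa> \<eta> \<delta> v \<rho> by (simp add: c_def)
  define E where "E j s = l2_norm U (\<lambda>x. \<gamma> j x * indicator (ball x0 s) x)" for j s
  have key: "c \<le> sqrt v * (\<bar>\<nu> $ 1\<bar> * E 1 s + \<bar>\<nu> $ 2\<bar> * E 2 s)" if s: "0 < s" "s \<le> r" "s \<le> r1" "s \<le> 1" for s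
  proof -
    define \<psi> where "\<psi> = cutoff x0 s"
    define B where "B = ball (x0 + (\<kappa> * s) *\<^sub>R (z - x0)) (\<kappa> * s * \<rho>)"
    define N where "N x = \<nu> $ 1 * pd 1 \<psi> x + \<nu> $ 2 * pd 2 \<psi> x" for x
    have ks: "\<kappa> * s > 0" "\<kappa> * s \<le> 1" using \<kappa> s by (auto simp: mult_le_one)
    have \<psi>d: "\<psi> differentiable (at x)" for x
      unfolding \<psi>_def using cutoff_has_derivative differentiable_def by blast
    have N: "N x = - 4 * max 0 (1 - ((x - x0) \<bullet> (x - x0)) / s\<^sup>2) * ((x - x0) \<bullet> \<nu>) / s\<^sup>2" for x
      unfolding N_def using frechet_derivative_partials[OF \<psi>d, of x \<nu>]
      by (simp add: cutoff_derivative \<psi>_def)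
    have N0: "N x \<ge> 0" if "x \<in> t" for x
    proof -
      have "(x - x0) \<bullet> \<nu> \<le> 0" using x0(3)[OF that] by (simp add: inner_commute)
      then have "0 \<le> (4 * max 0 (1 - ((x - x0) \<bullet> (x - x0)) / s\<^sup>2)) * (- ((x - x0) \<bullet> \<nu>)) / s\<^sup>2"
        by (intro divide_nonneg_nonneg mult_nonneg_nonneg) auto
      then show ?thesis unfolding N by simp
    qed
    have Nout: "N x = 0" if "x \<notin> ball x0 s" for x
      using cutoff_bounds(4)[OF s(1) that] by (simp add: N_def \<psi>_def)
    have B: "x \<in> t \<and> x \<in> ball x0 s \<and> N x \<ge> 3 * \<kappa> * \<eta> / s" if x: "x \<in> B" for x
    proof -
      define y where "y = x0 + (1 / (\<kappa> * s)) *\<^sub>R (x - x0)"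
      define M where "M = max 0 (1 - ((x - x0) \<bullet> (x - x0)) / s\<^sup>2)"
      have xy: "x - x0 = (\<kappa> * s) *\<^sub>R (y - x0)" using ks(1) by (simp add: y_def) (metis less_irrefl mult_zero_left mult_zero_right)
      have "x0 + (\<kappa> * s) *\<^sub>R (z - x0) - x = (\<kappa> * s) *\<^sub>R (z - y)"
        using xy by (simp add: algebra_simps)
      then have "(\<kappa> * s) * norm (z - y) < (\<kappa> * s) * \<rho>"
        using x ks by (simp add: B_def dist_norm)
      then have yb: "norm (z - y) < \<rho>" by (rule mult_left_less_imp_less) (use ks in simp)
      then have yz: "y \<in> ball z \<rho>" by (simp add: dist_norm)
      have xt: "x \<in> t"
      proof -
        have "x = (1 - \<kappa> * s) *\<^sub>R x0 + (\<kappa> * s) *\<^sub>R y" using xy by (simp add: algebra_simps)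
        then show ?thesis using convexD_alt[OF t(1) x0(1), of y "\<kappa> * s"] zb[OF yz] ks by auto
      qed
      have "norm (y - x0) \<le> norm (z - x0) + norm (z - y)"
        using norm_triangle_ineq4[of "z - x0" "z - y"] by simp
      then have "norm (x - x0) \<le> \<kappa> * s * (norm (z - x0) + \<rho>)"
        unfolding xy using ks yb by (simp add: mult_left_mono)
      also have "\<dots> \<le> s / 2" using \<kappa>1 s(1) by (simp add: mult.commute mult.left_commute)
      finally have xs: "norm (x - x0) \<le> s / 2" .
      then have "(norm (x - x0))\<^sup>2 \<le> (s / 2)\<^sup>2" by (intro power_mono) auto
      then have "((x - x0) \<bullet> (x - x0)) / s\<^sup>2 \<le> 1 / 4"
        using s(1) by (simp add: power2_norm_eq_inner[symmetric] power_divide field_simps)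
      then have m: "3 / 4 \<le> M" unfolding M_def by linarith
      have "\<kappa> * s * (\<nu> \<bullet> (y - x0)) \<le> \<kappa> * s * (- \<eta>)"
        using zb[OF yz] ks by (intro mult_left_mono) auto
      then have n: "\<kappa> * s * \<eta> \<le> - ((x - x0) \<bullet> \<nu>)"
        unfolding xy by (simp add: inner_commute)
      have "(3 / 4) * (\<kappa> * s * \<eta>) \<le> M * (- ((x - x0) \<bullet> \<nu>))"
        by (rule mult_mono[OF m n]) (use ks \<eta> m in auto)
      then have "4 * ((3 / 4) * (\<kappa> * s * \<eta>)) / s\<^sup>2 \<le> 4 * (M * (- ((x - x0) \<bullet> \<nu>))) / s\<^sup>2"
        by (intro divide_right_mono mult_left_mono) auto
      also have "\<dots> = N x" unfolding N M_def by simp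
      finally have "4 * ((3 / 4) * (\<kappa> * s * \<eta>)) / s\<^sup>2 \<le> N x" .
      moreover have "4 * ((3 / 4) * (\<kappa> * s * \<eta>)) / s\<^sup>2 = 3 * \<kappa> * \<eta> / s"
        using s(1) by (simp add: power2_eq_square)
      ultimately show ?thesis using xt xs s(1) by (simp add: dist_norm norm_minus_commute)
    qed
    have BU: "B \<subseteq> U"
    proof -
      have "B \<subseteq> interior t" using B by (intro interior_maximal) (auto simp: B_def)
      then show ?thesis using t(3) by blast
    qed
    have pw: "(3 * \<kappa> * \<eta> / s * \<delta>) * indicator B x \<le> \<sigma> * h x * N x" if xU: "x \<in> U" for x
    proof (cases "x \<in> ball x0 s")
      case True
      then have xt: "x \<in> t" using xU s(2) r(2) by auto
      have d: "\<delta> \<le> \<sigma> * h x" using hy[OF xt] True s(3) by (simp add: dist_commute)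
      show ?thesis
      proof (cases "x \<in> B")
        case True
        then have "(3 * \<kappa> * \<eta> / s) * \<delta> \<le> N x * (\<sigma> * h x)"
          using B d \<delta> \<kappa> \<eta> s(1) N0[OF xt] by (intro mult_mono) auto
        then show ?thesis using True by (simp add: mult.commute)
      qed (use d \<delta> N0[OF xt] in simp)
    next
      case False
      then show ?thesis using B Nout by (auto simp: indicator_def)
    qed
    note wp = lipschitz_imp_has_weak_partial[OF U cutoff_lipschitz[OF s(1)], of x0 1, folded \<psi>_def]
    have "has_weak_partial U j \<psi> (pd j \<psi>)" for j
      using cutoff_bounds(1,2)[OF s(1), of x0] \<psi>d by (intro wp) (auto simp: \<psi>_def abs_le_iff intro: order_trans[of _ 0])
    note sq = has_weak_partialD(1,2)[OF this]
    have hi: "integrable (lebesgue_on U) (\<lambda>x. h x * pd j \<psi> x)" for j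
      by (rule square_integrable_mult_integrable[OF h(2) sq(2)])
    have "(3 * \<kappa> * \<eta> / s * \<delta>) * measure lebesgue B = (\<integral>x. (3 * \<kappa> * \<eta> / s * \<delta>) * indicator B x \<partial>lebesgue_on U)"
    proof -
      have "(\<integral>x. indicator B x \<partial>lebesgue_on U) = (\<integral>x. indicator U x *\<^sub>R (indicator B x :: real) \<partial>lebesgue)"
        by (rule integral_restrict_space) (simp add: sU)
      also have "\<dots> = (\<integral>x. indicator B x \<partial>lebesgue)"
        using BU by (intro Bochner_Integration.integral_cong) (auto simp: indicator_def)
      also have "\<dots> = measure lebesgue B" by simp
      finally show ?thesis by simp
    qed
    also have "\<dots> \<le> (\<integral>x. \<sigma> * h x * N x \<partial>lebesgue_on U)"
    proof (rule integral_mono)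
      have "B \<in> lmeasurable" by (simp add: B_def)
      from square_integrable_mult_integrable[OF square_integrable_indicator[OF sU this] square_integrable_indicator[OF sU this]]
      have "integrable (lebesgue_on U) (\<lambda>x. indicator B x * indicator B x :: real)" .
      moreover have "(\<lambda>x. indicator B x * indicator B x :: real) = indicator B"
        by (auto simp: indicator_def)
      ultimately show "integrable (lebesgue_on U) (\<lambda>x. 3 * \<kappa> * \<eta> / s * \<delta> * indicator B x)" by simp
      have "integrable (lebesgue_on U) (\<lambda>x. \<sigma> * (\<nu> $ 1 * (h x * pd 1 \<psi> x) + \<nu> $ 2 * (h x * pd 2 \<psi> x)))"
        using hi by simp
      then show "integrable (lebesgue_on U) (\<lambda>x. \<sigma> * h x * N x)"
        by (simp add: N_def algebra_simps)
    qed (use pw in simp)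
    also have "\<dots> = (\<integral>x. \<sigma> * (\<nu> $ 1 * (h x * pd 1 \<psi> x) + \<nu> $ 2 * (h x * pd 2 \<psi> x)) \<partial>lebesgue_on U)"
      by (simp add: N_def algebra_simps)
    also have "\<dots> = \<sigma> * (\<nu> $ 1 * (\<integral>x. h x * pd 1 \<psi> x \<partial>lebesgue_on U) + \<nu> $ 2 * (\<integral>x. h x * pd 2 \<psi> x \<partial>lebesgue_on U))"
      using hi by simp
    also have "\<dots> = - \<sigma> * (\<nu> $ 1 * (\<integral>x. \<gamma> 1 x * \<psi> x \<partial>lebesgue_on U) + \<nu> $ 2 * (\<integral>x. \<gamma> 2 x * \<psi> x \<partial>lebesgue_on U))"
      using ibp[OF s(1), of 1] ibp[OF s(1), of 2] by (simp add: \<psi>_def algebra_simps)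
    also have "\<dots> \<le> \<bar>\<nu> $ 1\<bar> * \<bar>\<integral>x. \<gamma> 1 x * \<psi> x \<partial>lebesgue_on U\<bar> + \<bar>\<nu> $ 2\<bar> * \<bar>\<integral>x. \<gamma> 2 x * \<psi> x \<partial>lebesgue_on U\<bar>"
    proof -
      have gen: "- \<sigma> * (a * p + b * q) \<le> \<bar>a\<bar> * \<bar>p\<bar> + \<bar>b\<bar> * \<bar>q\<bar>" for a b p q :: real
      proof -
        have "- \<sigma> * (a * p + b * q) \<le> \<bar>- \<sigma> * (a * p + b * q)\<bar>" by simp
        also have "\<dots> = \<bar>a * p + b * q\<bar>" using h0 by (simp add: abs_mult \<sigma>_def abs_sgn_eq)
        also have "\<dots> \<le> \<bar>a\<bar> * \<bar>p\<bar> + \<bar>b\<bar> * \<bar>q\<bar>"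
          by (rule abs_triangle_ineq[THEN order_trans]) (simp add: abs_mult)
        finally show ?thesis .
      qed
      show ?thesis by (rule gen)
    qed
    also have "\<dots> \<le> \<bar>\<nu> $ 1\<bar> * (E 1 s * (sqrt v * s)) + \<bar>\<nu> $ 2\<bar> * (E 2 s * (sqrt v * s))"
    proof -
      have bnd: "\<bar>\<integral>x. \<gamma> j x * \<psi> x \<partial>lebesgue_on U\<bar> \<le> E j s * (sqrt v * s)" for j
      proof -
        let ?b = "\<lambda>x. \<gamma> j x * indicator (ball x0 s) x"
        have "(\<lambda>x. \<gamma> j x * \<psi> x) = (\<lambda>x. ?b x * \<psi> x)"
          using cutoff_bounds(3)[OF s(1)] by (auto simp: \<psi>_def indicator_def fun_eq_iff)
        then have "\<bar>\<integral>x. \<gamma> j x * \<psi> x \<partial>lebesgue_on U\<bar> \<le> E j s * l2_norm U \<psi>"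
          unfolding E_def
          using abs_integral_mult_le_l2_norm[OF square_integrable_mult_indicator[OF sU \<gamma>, of "ball x0 s" j] sq(1)] by simp
        moreover have "l2_norm U \<psi> \<le> sqrt v * s"
        proof -
          have "l2_norm U \<psi> \<le> l2_norm U (indicator (ball x0 s) :: pt \<Rightarrow> real)"
          proof (rule l2_norm_component_le[OF square_integrable_indicator[OF sU] sq(1)])
            show "\<bar>\<psi> x\<bar> \<le> norm (indicator (ball x0 s) x :: real)" for x
              using cutoff_bounds(1,2)[OF s(1), of x0 x] cutoff_bounds(3)[OF s(1), of x x0]
              by (cases "x \<in> ball x0 s") (auto simp: \<psi>_def)
          qed simp
          also have "\<dots> = sqrt (\<integral>x. indicator (U \<inter> ball x0 s) x \<partial>lebesgue)"
          proof -
            have "(\<lambda>x. indicator U x *\<^sub>R (indicator (ball x0 s) x :: real)\<^sup>2) = indicator (U \<inter> ball x0 s)"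
              by (auto simp: indicator_def)
            then show ?thesis
              unfolding l2_norm_real using integral_restrict_space[of U lebesgue "\<lambda>x. (indicator (ball x0 s) x :: real)\<^sup>2"] sU
              by simp
          qed
          also have "\<dots> = sqrt (measure lebesgue (U \<inter> ball x0 s))" by simp
          also have "\<dots> \<le> sqrt (measure lebesgue (ball x0 s))"
            using U by (intro real_sqrt_le_mono measure_mono_fmeasurable) (auto simp: sU)
          also have "\<dots> = sqrt v * s" using s(1) vol[of s x0] by (simp add: real_sqrt_mult)
          finally show ?thesis .
        qed
        ultimately show ?thesis
          by (rule order_trans[OF _ mult_left_mono]) (simp add: E_def l2_norm_nonneg)
      qed
      show ?thesis by (intro add_mono mult_left_mono bnd) auto
    qed
    finally have "(3 * \<kappa> * \<eta> / s * \<delta>) * measure lebesgue B \<le> \<bar>\<nu> $ 1\<bar> * (E 1 s * (sqrt v * s)) + \<bar>\<nu> $ 2\<bar> * (E 2 s * (sqrt v * s))" .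
    moreover have "(3 * \<kappa> * \<eta> / s * \<delta>) * measure lebesgue B = c * s"
      using ks \<rho> s(1) vol[of "\<kappa> * s * \<rho>" "x0 + (\<kappa> * s) *\<^sub>R (z - x0)"]
      by (simp add: B_def c_def power2_eq_square)
    ultimately have "c * s \<le> (sqrt v * (\<bar>\<nu> $ 1\<bar> * E 1 s + \<bar>\<nu> $ 2\<bar> * E 2 s)) * s"
      by (simp add: algebra_simps)
    then show ?thesis using s(1) by simp
  qed
  define s where "s n = min (min r r1) 1 / real (Suc n)" for n
  have s: "0 < s n" "s n \<le> r" "s n \<le> r1" "s n \<le> 1" for n
  proof -
    have m: "0 < min (min r r1) 1" using r(1) r1(1) by simp
    then show "0 < s n" by (simp add: s_def)
    have "s n \<le> min (min r r1) 1"
      unfolding s_def using m by (intro divide_le_eq[THEN iffD2]) (auto simp: algebra_simps)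
    then show "s n \<le> r" "s n \<le> r1" "s n \<le> 1" by auto
  qed
  have "s \<longlonglongrightarrow> 0"
    unfolding s_def[abs_def] using LIMSEQ_Suc[OF lim_const_over_n] by simp
  then have E0: "(\<lambda>n. E j (s n)) \<longlonglongrightarrow> 0" for j
    unfolding E_def by (intro l2_norm_shrinking_ball sU \<gamma>)
  have "(\<lambda>n. sqrt v * (\<bar>\<nu> $ 1\<bar> * E 1 (s n) + \<bar>\<nu> $ 2\<bar> * E 2 (s n))) \<longlonglongrightarrow> sqrt v * (\<bar>\<nu> $ 1\<bar> * 0 + \<bar>\<nu> $ 2\<bar> * 0)"
    by (intro tendsto_intros E0)
  then have "c \<le> sqrt v * (\<bar>\<nu> $ 1\<bar> * 0 + \<bar>\<nu> $ 2\<bar> * 0)"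
    by (rule LIMSEQ_le_const) (use key[OF s] in blast)
  with c show False by simp
qed

section \<open>Triangulations of planar regions\<close>

lemma triangle_vertices:
  fixes T :: "pt set"
  assumes "2 simplex T"
  obtains S where "finite S" "\<not> affine_dependent S" "card S = 3" "T = convex hull S"
proof -
  obtain S where S: "finite S" "\<not> affine_dependent S" "int (card S) = 2 + 1" "T = convex hull S"
    using assms unfolding simplex by blast
  then have "card S = 3" by linarith
  then show ?thesis using that S by blast
qed

lemma triangle_properties:
  fixes T :: "pt set"
  assumes T: "2 simplex T"
  shows "compact T" "closed T" "convex T" "interior T \<noteq> {}" "T = closure (interior T)"
    "rel_interior T = interior T" "aff_dim T = 2" "negligible (frontier T)"
proof -
  obtain S where S: "finite S" "T = convex hull S"
    using triangle_vertices[OF T] by metis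
  show cT: "compact T" using S finite_imp_compact_convex_hull by blast
  then show clT: "closed T" by (rule compact_imp_closed)
  show cv: "convex T" using S by simp
  show ad: "aff_dim T = 2" using T by (rule aff_dim_simplex)
  then have "affine hull T = UNIV" using aff_dim_eq_full[of T] by simp
  then show ri: "rel_interior T = interior T" by (rule rel_interior_interior)
  have "T \<noteq> {}" using ad by auto
  then show ne: "interior T \<noteq> {}" using rel_interior_eq_empty[OF cv] ri by simp
  show "T = closure (interior T)" using convex_closure_interior[OF cv ne] clT by simp
  show "negligible (frontier T)" using cv by (rule negligible_convex_frontier)
qed

lemma edge_segment:
  fixes e :: "pt set"
  assumes "1 simplex e"
  obtains a b where "a \<noteq> b" "e = closed_segment a b"
proof -
  obtain C where C: "finite C" "card C = 2" "e = convex hull C"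
  proof -
    obtain C where C: "finite C" "int (card C) = 1 + 1" "e = convex hull C"
      using assms unfolding simplex by blast
    then have "card C = 2" by linarith
    then show thesis using that C by blast
  qed
  then obtain a b where "C = {a, b}" "a \<noteq> b" by (meson card_2_iff)
  then show ?thesis using that C by (simp add: segment_convex_hull)
qed

lemma triangle_edge_vertices:
  fixes T :: "pt set"
  assumes T: "2 simplex T" and e: "1 simplex e" "e face_of T"
  obtains a b c where "a \<noteq> b" "e = closed_segment a b" "T = convex hull {a, b, c}"
    "\<not> affine_dependent {a, b, c}" "c \<noteq> a" "c \<noteq> b"
proof -
  obtain S where S: "finite S" "\<not> affine_dependent S" "card S = 3" "T = convex hull S"
    using triangle_vertices[OF T] .
  obtain C where C: "C \<subseteq> S" "e = convex hull C"
    using e(2) face_of_convex_hull_affine_independent[OF S(2)] S(4) by auto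
  have iC: "\<not> affine_dependent C" using affine_dependent_subset[OF _ C(1)] S(2) by blast
  have "int (card C) - 1 = aff_dim e" using C(2) aff_dim_affine_independent[OF iC] by (simp add: aff_dim_convex_hull)
  then have "card C = 2" using aff_dim_simplex[OF e(1)] by simp
  then obtain a b where ab: "C = {a, b}" "a \<noteq> b" by (meson card_2_iff)
  have "card (S - C) = 1" using S(1,3) C(1) \<open>card C = 2\<close> by (simp add: card_Diff_subset finite_subset)
  then obtain c where c: "S - C = {c}" by (meson card_1_singletonE)
  then have Sabc: "S = {a, b, c}" and "c \<noteq> a" "c \<noteq> b" using C(1) ab by blast+
  then show ?thesis using that[of a b c] ab S C by (simp add: segment_convex_hull)
qed

lemma triangle_boundary_point_on_edge:
  fixes T :: "pt set"
  assumes T: "2 simplex T" and y: "y \<in> T" "y \<notin> interior T"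
  obtains e where "1 simplex e" "e face_of T" "y \<in> e"
proof -
  obtain S where S: "finite S" "\<not> affine_dependent S" "card S = 3" "T = convex hull S"
    using triangle_vertices[OF T] .
  have "y \<in> rel_frontier T"
    using y triangle_properties(6)[OF T] closure_subset by (auto simp: rel_frontier_def)
  then obtain x where x: "x \<in> S" "y \<in> convex hull (S - {x})"
    unfolding S(4) rel_frontier_convex_hull_cases[OF S(2)] by auto
  have "\<not> affine_dependent (S - {x})" using S(2) affine_dependent_subset by blast
  moreover have "card (S - {x}) = 2" using S x by simp
  ultimately have "1 simplex (convex hull (S - {x}))"
    using simplex_convex_hull[of "S - {x}" 1] by simp
  moreover have "convex hull (S - {x}) face_of T"
    using face_of_convex_hull_affine_independent[OF S(2)] S(4) by blast
  ultimately show ?thesis using that x by blast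
qed

text \<open>For a function that vanishes on all edges but one, this gives vanishing at the vertices as well.\<close>

lemma edge_endpoint_on_other_edge:
  fixes T :: "pt set"
  assumes T: "2 simplex T" and e: "1 simplex e" "e face_of T" and y: "y \<in> e" "y \<notin> rel_interior e"
  obtains e' where "1 simplex e'" "e' face_of T" "y \<in> e'" "e' \<noteq> e"
proof -
  obtain a b c where abc: "a \<noteq> b" "e = closed_segment a b" "T = convex hull {a, b, c}"
    "\<not> affine_dependent {a, b, c}" "c \<noteq> a" "c \<noteq> b"
    using triangle_edge_vertices[OF T e] .
  have "y = a \<or> y = b"
    using y abc(1,2) by (auto simp: rel_interior_closed_segment open_segment_def)
  have *: "1 simplex (convex hull {y, c}) \<and> convex hull {y, c} face_of T \<and> convex hull {y, c} \<noteq> e"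
  proof (intro conjI)
    have yc: "y \<noteq> c" using \<open>y = a \<or> y = b\<close> abc(5,6) by blast
    show "1 simplex (convex hull {y, c})"
      using one_simplex_segment[OF yc] by (simp add: segment_convex_hull)
    show "convex hull {y, c} face_of T"
      unfolding abc(3)
      by (rule face_of_convex_hull_affine_independent[OF abc(4), THEN iffD2], rule exI[of _ "{y, c}"])
        (use \<open>y = a \<or> y = b\<close> in auto)
    show "convex hull {y, c} \<noteq> e"
    proof
      assume "convex hull {y, c} = e"
      then have "c \<in> convex hull {a, b}"
        using hull_subset[of "{y, c}" convex] abc(2) by (simp add: segment_convex_hull)
      then have "c \<in> affine hull ({a, b, c} - {c})"
        using convex_hull_subset_affine_hull abc(5,6) by (auto simp: insert_Diff_if)
      then show False using abc(4) unfolding affine_dependent_def by blast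
    qed
  qed
  then show ?thesis using that hull_inc[of y "{y, c}"] by blast
qed

text \<open>Barycentric coordinates of a triangle are quotients of two-dimensional cross products.\<close>

definition cross2 :: "pt \<Rightarrow> pt \<Rightarrow> real" where
  "cross2 u v = u $ 1 * v $ 2 - u $ 2 * v $ 1"

lemma cross2_linear:
  "cross2 (u + v) w = cross2 u w + cross2 v w" "cross2 w (u + v) = cross2 w u + cross2 w v"
  "cross2 (k *\<^sub>R u) w = k * cross2 u w" "cross2 w (k *\<^sub>R u) = k * cross2 w u"
  "cross2 u u = 0"
  by (simp_all add: cross2_def algebra_simps)

lemma cross2_nonzero:
  fixes a b c :: pt
  assumes "\<not> affine_dependent {a, b, c}" "a \<noteq> b" "c \<noteq> a" "c \<noteq> b"
  shows "cross2 (b - a) (c - a) \<noteq> 0"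
proof
  assume z: "cross2 (b - a) (c - a) = 0"
  define u v where "u = b - a" and "v = c - a"
  have u: "u \<bullet> u \<noteq> 0" using assms(2) by (simp add: u_def)
  have uv: "u $ 1 * v $ 2 = u $ 2 * v $ 1" using z by (simp add: cross2_def u_def v_def)
  have "(u \<bullet> u) *\<^sub>R v = (v \<bullet> u) *\<^sub>R u"
  proof (simp add: vec_eq_iff forall_2 inner_vec_def sum_2, intro conjI)
    show "(u $ 1 * u $ 1 + u $ 2 * u $ 2) * v $ 1 = (v $ 1 * u $ 1 + v $ 2 * u $ 2) * u $ 1"
      using uv by algebra
    show "(u $ 1 * u $ 1 + u $ 2 * u $ 2) * v $ 2 = (v $ 1 * u $ 1 + v $ 2 * u $ 2) * u $ 2"
      using uv by algebra
  qed
  then have "v = ((v \<bullet> u) / (u \<bullet> u)) *\<^sub>R u"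
    using u by (metis (no_types, lifting) divide_inverse_commute left_inverse scaleR_one scaleR_scaleR)
  then have "collinear {0, u, v}" by (auto simp: collinear_lemma)
  then have "collinear {b, a, c}" unfolding u_def v_def collinear_def by auto
  moreover have "{b, a, c} = {a, b, c}" by blast
  ultimately show False using assms collinear_3_eq_affine_dependent[of b a c] by simp
qed

lemma barycentric_in_triangle:
  fixes a b c z :: pt
  defines "D \<equiv> cross2 (b - a) (c - a)"
  defines "s \<equiv> cross2 (z - a) (c - a) / D" and "t \<equiv> cross2 (b - a) (z - a) / D"
  assumes D: "D \<noteq> 0" and st: "s \<ge> 0" "t \<ge> 0" "s + t \<le> 1"
  shows "z \<in> convex hull {a, b, c}"
proof -
  have "D *\<^sub>R (z - a) = (D * s) *\<^sub>R (b - a) + (D * t) *\<^sub>R (c - a)"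
  proof -
    have st: "D * s = cross2 (z - a) (c - a)" "D * t = cross2 (b - a) (z - a)"
      using D by (simp_all add: s_def t_def)
    show ?thesis
      unfolding st by (simp add: vec_eq_iff forall_2 cross2_def D_def) (simp add: algebra_simps)
  qed
  then have "D *\<^sub>R (z - a) = D *\<^sub>R (s *\<^sub>R (b - a) + t *\<^sub>R (c - a))"
    by (simp add: scaleR_add_right)
  then have "z - a = s *\<^sub>R (b - a) + t *\<^sub>R (c - a)" using D by simp
  then have "z = (1 - s - t) *\<^sub>R a + s *\<^sub>R b + t *\<^sub>R c" by (simp add: algebra_simps)
  then show ?thesis unfolding convex_hull_3 using st by force
qed

lemma triangulation_face:
  assumes "triangular_mesh \<T>" "T \<in> \<T>" "T' \<in> \<T>"
  shows "T \<inter> T' face_of T" "T \<inter> T' face_of T'" "2 simplex T"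
proof -
  have *: "S \<inter> S' face_of S" if "S \<in> \<T>" "S' \<in> \<T>" for S S'
    using assms(1) that unfolding triangular_mesh_def triangulation_def by blast
  show "T \<inter> T' face_of T" using * assms(2,3) .
  show "T \<inter> T' face_of T'" using *[OF assms(3,2)] by (simp only: Int_commute)
  show "2 simplex T" using assms(1,2) unfolding triangular_mesh_def by blast
qed

lemma triangles_disjoint_interior:
  assumes m: "triangular_mesh \<T>" and T: "T \<in> \<T>" "T' \<in> \<T>" "T \<noteq> T'"
  shows "interior T \<inter> T' = {}"
proof -
  have "T \<inter> T' \<noteq> T"
  proof
    assume "T \<inter> T' = T"
    then have "T face_of T'" using triangulation_face(2)[OF m T(1,2)] by simp
    then have "aff_dim T < aff_dim T'"
      using T(3) triangulation_face(3)[OF m T(2) T(2)] triangle_properties(3) by (intro face_of_aff_dim_lt) auto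
    then show False
      using triangle_properties(7) triangulation_face(3)[OF m T(1) T(1)] triangulation_face(3)[OF m T(2) T(2)] by simp
  qed
  then show ?thesis
    using face_of_disjoint_interior[OF triangulation_face(1)[OF m T(1,2)]] interior_subset by blast
qed

text \<open>Triangles of a triangulation intersect in a common face, and a face containing a relative interior
  point of \<open>e\<close> contains all of \<open>e\<close>.\<close>

lemma edge_subset_if_relint_point:
  assumes m: "triangular_mesh \<T>" and T: "T \<in> \<T>" "T' \<in> \<T>" and e: "e face_of T"
    and y: "y \<in> rel_interior e" "y \<in> T'"
  shows "e \<subseteq> T'" "e face_of T'"
proof -
  have eT: "e \<subseteq> T" using e by (rule face_of_imp_subset)
  have "y \<in> (T \<inter> T') \<inter> rel_interior e" using y eT rel_interior_subset by blast
  then have s: "e \<subseteq> T \<inter> T'"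
    using subset_of_face_of[OF triangulation_face(1)[OF m T] eT] by blast
  then show "e \<subseteq> T'" by blast
  have "e face_of T \<inter> T'" using face_of_subset[OF e s] by blast
  then show "e face_of T'" using triangulation_face(2)[OF m T] by (rule face_of_trans)
qed

text \<open>The intersection is a proper face of \<open>T\<close>, hence of dimension at most one, and has the face \<open>e\<close> of
  dimension one.\<close>

lemma shared_edge_eq_intersection:
  assumes m: "triangular_mesh \<T>" and T: "T \<in> \<T>" "T' \<in> \<T>" "T \<noteq> T'"
    and e: "1 simplex e" "e face_of T" "e \<subseteq> T'"
  shows "T \<inter> T' = e"
proof (rule ccontr)
  assume ne: "T \<inter> T' \<noteq> e"
  have eT: "e \<subseteq> T \<inter> T'" using e face_of_imp_subset by blast
  have "e face_of T \<inter> T'" using face_of_subset[OF e(2) eT] by blast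
  moreover have cv: "convex (T \<inter> T')"
    using triangulation_face(3)[OF m T(1) T(1)] triangulation_face(3)[OF m T(2) T(2)] triangle_properties(3)
    by (intro convex_Int) auto
  ultimately have 1: "aff_dim e < aff_dim (T \<inter> T')" using ne by (intro face_of_aff_dim_lt) auto
  have "T \<inter> T' \<noteq> T"
    using triangles_disjoint_interior[OF m T] triangle_properties(4)[OF triangulation_face(3)[OF m T(1) T(1)]] interior_subset by blast
  then have "aff_dim (T \<inter> T') < aff_dim T"
    using triangulation_face(1)[OF m T(1,2)] triangle_properties(3)[OF triangulation_face(3)[OF m T(1) T(1)]]
    by (intro face_of_aff_dim_lt) auto
  with 1 show False
    using aff_dim_simplex[OF e(1)] triangle_properties(7)[OF triangulation_face(3)[OF m T(1) T(1)]] by simp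
qed

text \<open>The third vertices lie on opposite sides of the edge: otherwise points near the midpoint of the edge,
  moved towards the third vertex of \<open>T2\<close>, would be interior to \<open>T1\<close>. Near the relative interior of
  the edge, one of the two barycentric coordinates that vanish on it is then nonnegative and the other
  coordinates are positive.\<close>

lemma two_triangles_surround_edge:
  assumes m: "triangular_mesh \<T>" and T: "T1 \<in> \<T>" "T2 \<in> \<T>" "T1 \<noteq> T2"
    and e: "1 simplex e" "e face_of T1" "e face_of T2"
  shows "rel_interior e \<subseteq> interior (T1 \<union> T2)"
proof
  note s1 = triangulation_face(3)[OF m T(1) T(1)] and s2 = triangulation_face(3)[OF m T(2) T(2)]
  obtain a b c where abc: "a \<noteq> b" "e = closed_segment a b" "T1 = convex hull {a, b, c}"
    "\<not> affine_dependent {a, b, c}" "c \<noteq> a" "c \<noteq> b"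
    using triangle_edge_vertices[OF s1 e(1,2)] .
  obtain a' b' d where abd': "a' \<noteq> b'" "e = closed_segment a' b'" "T2 = convex hull {a', b', d}"
    "\<not> affine_dependent {a', b', d}" "d \<noteq> a'" "d \<noteq> b'"
    using triangle_edge_vertices[OF s2 e(1,3)] .
  have "{a', b'} = {a, b}" using abc(2) abd'(2) by (metis closed_segment_eq)
  then have "{a', b', d} = {a, b, d}" "d \<noteq> a" "d \<noteq> b" using abd'(5,6) by auto
  then have abd: "T2 = convex hull {a, b, d}" "\<not> affine_dependent {a, b, d}" "d \<noteq> a" "d \<noteq> b"
    using abd'(3,4) by auto
  define D E where "D = cross2 (b - a) (c - a)" and "E = cross2 (b - a) (d - a)"
  have D: "D \<noteq> 0" unfolding D_def by (rule cross2_nonzero) (use abc in auto)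
  have E: "E \<noteq> 0" unfolding E_def by (rule cross2_nonzero) (use abc abd in auto)
  define s t s' t' where "s z = cross2 (z - a) (c - a) / D" and "t z = cross2 (b - a) (z - a) / D"
    and "s' z = cross2 (z - a) (d - a) / E" and "t' z = cross2 (b - a) (z - a) / E" for z
  have in1: "z \<in> T1" if "s z \<ge> 0" "t z \<ge> 0" "s z + t z \<le> 1" for z
    using barycentric_in_triangle[of b a c z] that D unfolding abc(3) s_def t_def D_def by blast
  have in2: "z \<in> T2" if "s' z \<ge> 0" "t' z \<ge> 0" "s' z + t' z \<le> 1" for z
    using barycentric_in_triangle[of b a d z] that E unfolding abd(1) s'_def t'_def E_def by blast
  have cont: "continuous_on UNIV s" "continuous_on UNIV t" "continuous_on UNIV s'" "continuous_on UNIV t'"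
    unfolding s_def t_def s'_def t'_def cross2_def by (intro continuous_intros; simp add: D E)+
  have opp: "D * E < 0"
  proof (rule ccontr)
    assume "\<not> D * E < 0"
    then have DE: "E / D > 0" using D E by (simp add: zero_less_divide_iff mult_less_0_iff) linarith
    define k where "k = cross2 (d - a) (c - a) / D"
    define y where "y \<epsilon> = a + (1 / 2) *\<^sub>R (b - a) + \<epsilon> *\<^sub>R (d - a)" for \<epsilon>
    have ya: "y \<epsilon> - a = (1 / 2) *\<^sub>R (b - a) + \<epsilon> *\<^sub>R (d - a)" for \<epsilon>
      by (simp add: y_def)
    have sy: "s (y \<epsilon>) = 1 / 2 + \<epsilon> * k" for \<epsilon>
    proof -
      have "cross2 (y \<epsilon> - a) (c - a) = (1 / 2) * D + \<epsilon> * cross2 (d - a) (c - a)"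
        by (simp only: ya cross2_linear D_def)
      then show ?thesis using D by (simp add: s_def k_def add_divide_distrib)
    qed
    have ty: "t (y \<epsilon>) = \<epsilon> * (E / D)" for \<epsilon>
    proof -
      have "cross2 (b - a) (y \<epsilon> - a) = \<epsilon> * E"
        by (simp add: ya cross2_linear E_def)
      then show ?thesis by (simp add: t_def)
    qed
    have s'y: "s' (y \<epsilon>) = 1 / 2" "t' (y \<epsilon>) = \<epsilon>" for \<epsilon>
    proof -
      have "cross2 (y \<epsilon> - a) (d - a) = (1 / 2) * E" "cross2 (b - a) (y \<epsilon> - a) = \<epsilon> * E"
        by (simp_all add: ya cross2_linear E_def)
      then show "s' (y \<epsilon>) = 1 / 2" "t' (y \<epsilon>) = \<epsilon>" using E by (simp_all add: s'_def t'_def)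
    qed
    \<comment> \<open>So small that the three barycentric coordinates of \<open>y \<epsilon>\<close> with respect to \<open>T1\<close> are positive.\<close>
    define \<epsilon> where "\<epsilon> = 1 / (4 * (1 + \<bar>k\<bar> + E / D))"
    have den: "1 + \<bar>k\<bar> + E / D > 0" using DE by simp
    then have \<epsilon>: "\<epsilon> > 0" by (simp add: \<epsilon>_def)
    have \<epsilon>': "\<epsilon> * (1 + \<bar>k\<bar> + E / D) = 1 / 4"
      unfolding \<epsilon>_def using den by (simp only: field_simps) simp
    have p: "\<epsilon> * (E / D) > 0" "\<epsilon> * \<bar>k\<bar> \<ge> 0"
      using mult_pos_pos[OF \<epsilon> DE] \<epsilon> by simp_all
    have sum: "\<epsilon> + \<epsilon> * \<bar>k\<bar> + \<epsilon> * (E / D) = 1 / 4" using \<epsilon>' by (simp add: distrib_left)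
    have absk: "\<bar>\<epsilon> * k\<bar> = \<epsilon> * \<bar>k\<bar>" using \<epsilon> by (simp add: abs_mult)
    have "y \<epsilon> \<in> T2" using in2[of "y \<epsilon>"] s'y \<epsilon> sum p by simp
    moreover have "y \<epsilon> \<in> interior T1"
    proof (rule interiorI)
      let ?W = "{z. 0 < s z} \<inter> {z. 0 < t z} \<inter> {z. s z + t z < 1}"
      show "open ?W"
        by (intro open_Int open_Collect_less continuous_on_const continuous_on_add cont)
      have "0 < 1 / 2 + \<epsilon> * k" "1 / 2 + \<epsilon> * k + \<epsilon> * (E / D) < 1"
        using p sum absk \<epsilon> by linarith+
      then show "y \<epsilon> \<in> ?W"
        unfolding Int_iff mem_Collect_eq sy ty using p(1) by blast
      show "?W \<subseteq> T1" using in1 by auto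
    qed
    ultimately show False using triangles_disjoint_interior[OF m T] by blast
  qed
  fix y assume "y \<in> rel_interior e"
  then have "y \<in> open_segment a b" using abc(1,2) by (simp add: rel_interior_closed_segment)
  then obtain u where u: "0 < u" "u < 1" "y = (1 - u) *\<^sub>R a + u *\<^sub>R b"
    by (auto simp: in_segment)
  have ya: "y - a = u *\<^sub>R (b - a)" using u(3) by (simp add: algebra_simps)
  have "cross2 (y - a) (c - a) = u * D" "cross2 (b - a) (y - a) = 0" "cross2 (y - a) (d - a) = u * E"
    unfolding ya D_def E_def by (simp_all add: cross2_linear)
  then have st: "s y = u" "t y = 0" "s' y = u" "t' y = 0"
    using D E by (simp_all add: s_def t_def s'_def t'_def)
  show "y \<in> interior (T1 \<union> T2)"
  proof (rule interiorI)
    let ?W = "{z. 0 < s z} \<inter> {z. s z + t z < 1} \<inter> ({z. 0 < s' z} \<inter> {z. s' z + t' z < 1})"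
    show "open ?W"
      by (intro open_Int open_Collect_less continuous_on_const continuous_on_add cont)
    show "y \<in> ?W" using u st by simp
    show "?W \<subseteq> T1 \<union> T2"
    proof
      fix z assume z: "z \<in> ?W"
      have "t z * D = t' z * E" using D E by (simp add: t_def t'_def)
      have "t z \<ge> 0 \<or> t' z \<ge> 0"
      proof (rule ccontr)
        assume "\<not> (t z \<ge> 0 \<or> t' z \<ge> 0)"
        then have "t z * t' z > 0" by (simp add: mult_neg_neg)
        moreover have "(t z * t' z) * (D * E) = (cross2 (b - a) (z - a))\<^sup>2"
          using D E by (simp add: t_def t'_def power2_eq_square)
        ultimately show False using opp by (metis mult_pos_neg not_less zero_le_power2)
      qed
      then show "z \<in> T1 \<union> T2" using z in1[of z] in2[of z] by auto
    qed
  qed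
qed

text \<open>The interior of a third triangle would meet the neighborhood of the edge covered by the first two.\<close>

lemma at_most_two_triangles_at_edge:
  assumes m: "triangular_mesh \<T>" and T: "T1 \<in> \<T>" "T2 \<in> \<T>" "T1 \<noteq> T2" "T \<in> \<T>"
    and e: "1 simplex e" "e face_of T1" "e face_of T2" and y: "y \<in> rel_interior e" "y \<in> T"
  shows "T = T1 \<or> T = T2"
proof (rule ccontr)
  assume "\<not> (T = T1 \<or> T = T2)"
  then have d: "interior T \<inter> (T1 \<union> T2) = {}"
    using triangles_disjoint_interior[OF m T(4)] T(1,2) by blast
  have "y \<in> interior (T1 \<union> T2)" using two_triangles_surround_edge[OF m T(1-3) e] y(1) by blast
  moreover have "y \<in> closure (interior T)"
    using y(2) triangle_properties(5)[OF triangulation_face(3)[OF m T(4) T(4)]] by blast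
  ultimately have "interior (T1 \<union> T2) \<inter> interior T \<noteq> {}"
    using open_Int_closure_eq_empty[OF open_interior] by blast
  then show False using d interior_subset by blast
qed

lemma finite_mesh_vertices:
  assumes m: "triangular_mesh \<T>"
  shows "finite (mesh_vertices \<T>)"
proof -
  have "mesh_vertices \<T> = (\<Union>T\<in>\<T>. {x. x extreme_point_of T})"
    by (auto simp: mesh_vertices_def)
  moreover have "finite {x. x extreme_point_of T}" if "T \<in> \<T>" for T
    using triangulation_face(3)[OF m that that]
    by (metis finite_polyhedron_extreme_points simplex_imp_polyhedron)
  moreover have "finite \<T>" using m by (simp add: triangular_mesh_def triangulation_def)
  ultimately show ?thesis by simp
qed

section \<open>Geometry of the perforated grid\<close>

context perforated_grid begin

definition block :: "pt set \<Rightarrow> pt set set" where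
  "block T = {t \<in> \<T>h. t \<subseteq> G ` T}"

lemma block_in_blocks: "T \<in> \<T>H \<Longrightarrow> block T \<noteq> {} \<Longrightarrow> block T \<in> blocks"
  by (auto simp: blocks_def block_def)

lemma blocksE:
  assumes "K \<in> blocks"
  obtains T where "T \<in> \<T>H" "K = block T" "K \<noteq> {}"
  using assms by (auto simp: blocks_def block_def)

lemma meshes_finite: "finite \<T>H" "finite \<T>h"
  using meshes by (auto simp: triangular_mesh_def triangulation_def)

lemma coarse_triangle: "T \<in> \<T>H \<Longrightarrow> 2 simplex T"
  and fine_triangle: "t \<in> \<T>h \<Longrightarrow> 2 simplex t"
  using meshes by (auto simp: triangular_mesh_def)

lemma block_subset: "K \<in> blocks \<Longrightarrow> K \<subseteq> \<T>h"
  by (auto simp: blocks_def)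

lemma closed_Union_fine: "S \<subseteq> \<T>h \<Longrightarrow> closed (\<Union>S)"
  using meshes_finite(2) fine_triangle triangle_properties(2)
  by (intro closed_Union) (auto intro: finite_subset)

lemma compact_Union_fine: "S \<subseteq> \<T>h \<Longrightarrow> compact (\<Union>S)"
  using meshes_finite(2) fine_triangle triangle_properties(1)
  by (intro compact_Union) (auto intro: finite_subset)

lemma bounded_subset_fine: "S \<subseteq> \<Union>\<T>h \<Longrightarrow> bounded S"
  using compact_Union_fine[of \<T>h] compact_imp_bounded bounded_subset by blast

lemma G_inj: "inj G"
  and G_surj: "surj G"
  and G_continuous: "continuous_on UNIV G"
  and G_open: "open S \<Longrightarrow> open (G ` S)"
  and G_closed: "closed S \<Longrightarrow> closed (G ` S)"
proof -
  obtain G' where G': "homeomorphism UNIV UNIV G G'" using homeo by blast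
  show "inj G" using G' by (metis homeomorphism_apply1 UNIV_I injI)
  show "surj G" using G' by (simp add: homeomorphism_def)
  show "continuous_on UNIV G" using G' by (simp add: homeomorphism_def)
  show "open S \<Longrightarrow> open (G ` S)"
    using homeomorphism_imp_open_map[OF G'] by simp
  show "closed S \<Longrightarrow> closed (G ` S)"
    using homeomorphism_imp_closed_map[OF G'] by simp
qed

lemma G_mem: "G y \<in> G ` S \<longleftrightarrow> y \<in> S"
  using G_inj by (simp add: inj_image_mem_iff)

lemma G_closure: "G ` closure S \<subseteq> closure (G ` S)"
  by (rule image_closure_subset[OF continuous_on_subset[OF G_continuous] closed_closure closure_subset]) simp

lemma perf_dom_open: "open perf_dom"
  using fine_cover by simp

lemma closure_perf_dom: "closure perf_dom = \<Union>\<T>h"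
proof
  show "closure perf_dom \<subseteq> \<Union>\<T>h"
    unfolding fine_cover by (intro closure_minimal interior_subset closed_Union_fine) simp
  show "\<Union>\<T>h \<subseteq> closure perf_dom"
  proof
    fix x assume "x \<in> \<Union>\<T>h"
    then obtain t where t: "t \<in> \<T>h" "x \<in> t" by blast
    then have "x \<in> closure (interior t)" using triangle_properties(5)[OF fine_triangle[OF t(1)]] by blast
    moreover have "interior t \<subseteq> perf_dom" unfolding fine_cover using t(1) by (intro interior_mono) auto
    ultimately show "x \<in> closure perf_dom" using closure_mono by blast
  qed
qed

lemma perf_dom_subset_fine: "perf_dom \<subseteq> \<Union>\<T>h"
  unfolding fine_cover by (rule interior_subset)

lemma perf_dom_disjoint_B: "x \<in> perf_dom \<Longrightarrow> x \<notin> B"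
  by (simp add: perf_dom_def)

lemma fine_point_in_B: "x \<in> \<Union>\<T>h \<Longrightarrow> x \<in> B \<Longrightarrow> x \<in> frontier B"
proof -
  assume x: "x \<in> \<Union>\<T>h" "x \<in> B"
  have "x \<in> closure (- B)"
    using x(1) closure_mono[of perf_dom "- B"] perf_dom_disjoint_B unfolding closure_perf_dom[symmetric] by blast
  then show "x \<in> frontier B"
    using x(2) perforations(1) by (simp add: frontier_def closure_closed closure_complement)
qed

text \<open>Although \<open>\<Omega>\<close> need not be regular open (it could have slits), the part of it outside \<open>B\<close> is,
  because it is the interior of a finite union of triangles.\<close>

lemma coarse_open_subset:
  assumes "open S" "S \<subseteq> \<Union>\<T>H"
  shows "G ` S - B \<subseteq> perf_dom"
proof -
  let ?O = "G ` S \<inter> - B"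
  have "open ?O" using perforations(1) assms(1) by (intro open_Int G_open) auto
  moreover have "?O \<subseteq> \<Union>\<T>h"
  proof
    fix x assume x: "x \<in> ?O"
    then have "x \<in> closure \<Omega>" using coarse_cover(2) assms(2) by blast
    then have "x \<in> - B \<inter> closure \<Omega>" using x by blast
    then have "x \<in> closure (- B \<inter> \<Omega>)"
      using open_Int_closure_subset[of "- B" \<Omega>] perforations(1) by auto
    moreover have "- B \<inter> \<Omega> = perf_dom" by (auto simp: perf_dom_def)
    ultimately show "x \<in> \<Union>\<T>h" using closure_perf_dom by simp
  qed
  ultimately have "?O \<subseteq> perf_dom" unfolding fine_cover by (rule interior_maximal[rotated])
  then show ?thesis by blast
qed

lemma coarse_interior_subset: "T \<in> \<T>H \<Longrightarrow> G ` interior T - B \<subseteq> perf_dom"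
  using interior_subset by (intro coarse_open_subset) auto

lemma block_of_interior_point:
  assumes T: "T \<in> \<T>H" and x: "x \<in> G ` interior T" and t: "t \<in> \<T>h" "x \<in> t"
  shows "t \<in> block T"
proof -
  obtain T' where T': "T' \<in> \<T>H" "t \<subseteq> G ` T'" using refinement t(1) by blast
  obtain y where y: "y \<in> interior T" "x = G y" using x by blast
  have "y \<in> T'" using T'(2) t(2) y(2) G_mem by blast
  then have "T' = T" using triangles_disjoint_interior[OF meshes(1) T T'(1)] y(1) by blast
  then show ?thesis using T' t(1) by (simp add: block_def)
qed

text \<open>\<open>T\<close> is the closure of its interior and the complement of \<open>B\<close> is open, so points of the curved triangle
  outside \<open>B\<close> are limits of points of its interior outside \<open>B\<close>, which lie in fine triangles of the block.\<close>

lemma coarse_triangle_subset_block: "T \<in> \<T>H \<Longrightarrow> G ` T - B \<subseteq> \<Union>(block T)"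
proof -
  assume T: "T \<in> \<T>H"
  have "G ` T = G ` closure (interior T)"
    using triangle_properties(5)[OF coarse_triangle[OF T]] by simp
  also have "\<dots> \<subseteq> closure (G ` interior T)" by (rule G_closure)
  finally have "G ` T - B \<subseteq> - B \<inter> closure (G ` interior T)" by blast
  also have "\<dots> \<subseteq> closure (- B \<inter> G ` interior T)"
    using perforations(1) by (intro open_Int_closure_subset) auto
  also have "\<dots> \<subseteq> \<Union>(block T)"
  proof (rule closure_minimal)
    show "- B \<inter> G ` interior T \<subseteq> \<Union>(block T)"
    proof
      fix x assume x: "x \<in> - B \<inter> G ` interior T"
      then have "x \<in> \<Union>\<T>h" using coarse_interior_subset[OF T] perf_dom_subset_fine by blast
      then show "x \<in> \<Union>(block T)" using block_of_interior_point[OF T] x by blast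
    qed
    show "closed (\<Union>(block T))" by (rule closed_Union_fine) (auto simp: block_def)
  qed
  finally show ?thesis .
qed

text \<open>For a common fine triangle \<open>t\<close>, the preimage of its interior would be a nonempty open set in the
  intersection of two triangles of the coarse mesh.\<close>

lemma blocks_disjoint:
  assumes T: "T \<in> \<T>H" "T' \<in> \<T>H" and t: "t \<in> block T" "t \<in> block T'"
  shows "T = T'"
proof (rule ccontr)
  assume ne: "T \<noteq> T'"
  have tt: "t \<in> \<T>h" "t \<subseteq> G ` T" "t \<subseteq> G ` T'" using t by (auto simp: block_def)
  let ?O = "G -` interior t"
  have "open ?O" using G_continuous by (intro open_vimage) auto
  moreover have "?O \<subseteq> T \<inter> T'"
    using tt(2,3) interior_subset[of t] G_mem by blast
  ultimately have "?O \<subseteq> interior T \<inter> T'" using interior_maximal[of ?O T] by blast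
  then have "?O = {}" using triangles_disjoint_interior[OF meshes(1) T ne] by blast
  then have "interior t = {}" using G_surj by (metis surj_image_vimage_eq image_empty)
  then show False using triangle_properties(4)[OF fine_triangle[OF tt(1)]] by blast
qed

lemma open_block_interior_disjoint:
  assumes K: "K \<in> blocks" "K' \<in> blocks" "K \<noteq> K'"
  shows "interior (\<Union>K) \<inter> interior (\<Union>K') = {}"
proof (rule ccontr)
  assume "interior (\<Union>K) \<inter> interior (\<Union>K') \<noteq> {}"
  then obtain x where x: "x \<in> interior (\<Union>K)" "x \<in> interior (\<Union>K')" by blast
  obtain T where T: "T \<in> \<T>H" "K = block T" using blocksE[OF K(1)] by metis
  obtain T' where T': "T' \<in> \<T>H" "K' = block T'" using blocksE[OF K(2)] by metis
  let ?O = "interior (\<Union>K) \<inter> interior (\<Union>K')"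
  obtain t where t: "t \<in> K" "x \<in> t" using x(1) interior_subset by blast
  have tT: "t \<in> \<T>h" using t(1) block_subset[OF K(1)] by blast
  have "x \<in> closure (interior t)" using t(2) triangle_properties(5)[OF fine_triangle[OF tT]] by blast
  then have "?O \<inter> interior t \<noteq> {}"
    using x open_Int_closure_eq_empty[of ?O "interior t"] by blast
  then obtain z where z: "z \<in> interior (\<Union>K')" "z \<in> interior t" by blast
  obtain t' where t': "t' \<in> K'" "z \<in> t'" using z(1) interior_subset by blast
  have "t' \<in> \<T>h" using t'(1) block_subset[OF K(2)] by blast
  then have "t = t'" using triangles_disjoint_interior[OF meshes(2) tT] z(2) t'(2) by blast
  then have "T = T'" using blocks_disjoint[OF T(1) T'(1)] t(1) t'(1) T(2) T'(2) by blast
  then show False using K(3) T(2) T'(2) by simp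
qed

text \<open>The coarse edge carried by the mesh edge \<open>e\<close>; perforations may cut it into several pieces.\<close>

definition edge_set :: "pt set \<Rightarrow> pt set" where
  "edge_set e = closure (G ` e - B)"

lemma edge_set_subset_block:
  assumes "T \<in> \<T>H" "e \<subseteq> T"
  shows "edge_set e \<subseteq> \<Union>(block T)"
  unfolding edge_set_def
  using coarse_triangle_subset_block[OF assms(1)] assms(2)
  by (intro closure_minimal closed_Union_fine) (auto simp: block_def)

lemma mesh_edge:
  assumes "e \<in> mesh_edges \<T>H"
  obtains T where "T \<in> \<T>H" "1 simplex e" "e face_of T" "e \<subseteq> T"
  using assms face_of_imp_subset unfolding mesh_edges_def by blast

text \<open>The two curved triangles surround the edge, so its neighborhood consists of their two blocks.\<close>

lemma block_contains_edge_set_iff: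
  assumes T: "T1 \<in> \<T>H" "T2 \<in> \<T>H" "T1 \<noteq> T2" and e: "e face_of T1" "e face_of T2" "1 simplex e"
    and y: "y \<in> rel_interior e" "G y \<in> perf_dom"
  shows "{K \<in> blocks. edge_set e \<subseteq> \<Union>K} = {block T1, block T2}"
    and "block T1 \<in> blocks" "block T2 \<in> blocks" "block T1 \<noteq> block T2"
proof -
  have ye: "y \<in> e" using y(1) rel_interior_subset by blast
  have Gy: "G y \<in> edge_set e"
    using ye perf_dom_disjoint_B[OF y(2)] by (auto simp: edge_set_def intro!: subsetD[OF closure_subset])
  have in1: "edge_set e \<subseteq> \<Union>(block T1)" "edge_set e \<subseteq> \<Union>(block T2)"
    using edge_set_subset_block T e face_of_imp_subset by blast+
  then have "block T1 \<noteq> {}" "block T2 \<noteq> {}" using Gy by blast+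
  then show b: "block T1 \<in> blocks" "block T2 \<in> blocks" using block_in_blocks T by blast+
  show "block T1 \<noteq> block T2"
    using blocks_disjoint[OF T(1,2)] T(3) \<open>block T1 \<noteq> {}\<close> by blast
  show "{K \<in> blocks. edge_set e \<subseteq> \<Union>K} = {block T1, block T2}"
  proof
    show "{block T1, block T2} \<subseteq> {K \<in> blocks. edge_set e \<subseteq> \<Union>K}" using b in1 by blast
    show "{K \<in> blocks. edge_set e \<subseteq> \<Union>K} \<subseteq> {block T1, block T2}"
    proof
      fix K assume K: "K \<in> {K \<in> blocks. edge_set e \<subseteq> \<Union>K}"
      then obtain T where T': "T \<in> \<T>H" "K = block T" using blocksE by blast
      then have "G y \<in> G ` T" using K Gy by (auto simp: block_def)
      then have "y \<in> T" by (simp add: G_mem)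
      then have "T = T1 \<or> T = T2"
        using at_most_two_triangles_at_edge[OF meshes(1) T T'(1) e(3,1,2) y(1)] by blast
      then show "K \<in> {block T1, block T2}" using T'(2) by blast
    qed
  qed
qed

text \<open>A partition function of the coarse edge carried by \<open>e\<close> vanishes on the edges not containing it; by this
  lemma these are all the edges other than \<open>e\<close>.\<close>

lemma edge_eq_if_edge_set_subset:
  assumes e: "e \<in> mesh_edges \<T>H" and y: "y \<in> rel_interior e" "G y \<in> perf_dom"
    and e': "e' \<in> mesh_edges \<T>H" "edge_set e \<subseteq> G ` e'"
  shows "e' = e"
proof -
  obtain T where T: "T \<in> \<T>H" "1 simplex e" "e face_of T" "e \<subseteq> T" using mesh_edge[OF e] .
  obtain T' where T': "T' \<in> \<T>H" "1 simplex e'" "e' face_of T'" "e' \<subseteq> T'" using mesh_edge[OF e'(1)] .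
  have ye: "y \<in> e" using y(1) rel_interior_subset by blast
  have "G y \<in> edge_set e"
    using ye perf_dom_disjoint_B[OF y(2)] by (auto simp: edge_set_def intro!: subsetD[OF closure_subset])
  then have ye': "y \<in> e'" using e'(2) G_mem by blast
  have f: "e \<subseteq> T'" "e face_of T'"
    using edge_subset_if_relint_point[OF meshes(1) T(1) T'(1) T(3) y(1)] ye' T'(4) by blast+
  have "e \<subseteq> e'"
    by (rule subset_of_face_of[OF T'(3) f(1)]) (use y(1) ye' in blast)
  then have "e face_of e'" using face_of_subset[OF f(2)] T'(4) by blast
  show ?thesis
  proof (rule ccontr)
    assume "e' \<noteq> e"
    then have "aff_dim e < aff_dim e'"
      using \<open>e face_of e'\<close> face_of_imp_convex[OF T'(3)] triangle_properties(3)[OF coarse_triangle[OF T'(1)]]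
      by (intro face_of_aff_dim_lt) auto
    then show False using aff_dim_simplex[OF T(2)] aff_dim_simplex[OF T'(2)] by simp
  qed
qed

end

section \<open>Piecewise smooth functions\<close>

lemma Ck_coordinate: "Ck k (\<lambda>x. x $ i)"
proof (cases k)
  case (Suc m)
  have "Ck (Suc m) (\<lambda>x. x $ i)"
  proof (rule Ck_SucI)
    show "((\<lambda>x. x $ i) has_derivative (\<lambda>v. v $ i)) (at x)" for x :: pt
      by (rule bounded_linear_imp_has_derivative[OF bounded_linear_vec_nth])
    show "Ck m (\<lambda>x. v $ i)" for v :: pt by (rule Ck_const)
  qed
  then show ?thesis using Suc by simp
qed (simp add: continuous_on_component)

definition piecewise_C1 :: "pt set set \<Rightarrow> (pt \<Rightarrow> real) \<Rightarrow> bool" where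
  "piecewise_C1 \<S> f \<longleftrightarrow> (\<forall>t\<in>\<S>. \<exists>g. Ck (Suc 0) g \<and> (\<forall>x\<in>t. f x = g x))"

lemma piecewise_C1_zero: "piecewise_C1 \<S> (\<lambda>x. 0)"
  unfolding piecewise_C1_def using Ck_const by blast

lemma piecewise_C1_add:
  assumes "piecewise_C1 \<S> f" "piecewise_C1 \<S> g"
  shows "piecewise_C1 \<S> (\<lambda>x. f x + g x)"
  unfolding piecewise_C1_def
proof
  fix t assume "t \<in> \<S>"
  then obtain f' g' where "Ck (Suc 0) f'" "\<forall>x\<in>t. f x = f' x" "Ck (Suc 0) g'" "\<forall>x\<in>t. g x = g' x"
    using assms unfolding piecewise_C1_def by blast
  then show "\<exists>h. Ck (Suc 0) h \<and> (\<forall>x\<in>t. f x + g x = h x)"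
    by (intro exI[of _ "\<lambda>x. f' x + g' x"] conjI Ck_add) auto
qed

lemma piecewise_C1_mult:
  assumes "piecewise_C1 \<S> f" "piecewise_C1 \<S> g"
  shows "piecewise_C1 \<S> (\<lambda>x. f x * g x)"
  unfolding piecewise_C1_def
proof
  fix t assume "t \<in> \<S>"
  then obtain f' g' where "Ck (Suc 0) f'" "\<forall>x\<in>t. f x = f' x" "Ck (Suc 0) g'" "\<forall>x\<in>t. g x = g' x"
    using assms unfolding piecewise_C1_def by blast
  then show "\<exists>h. Ck (Suc 0) h \<and> (\<forall>x\<in>t. f x * g x = h x)"
    by (intro exI[of _ "\<lambda>x. f' x * g' x"] conjI Ck_mult) auto
qed

lemma piecewise_C1_sum:
  "(\<And>i. i \<in> I \<Longrightarrow> piecewise_C1 \<S> (f i)) \<Longrightarrow> piecewise_C1 \<S> (\<lambda>x. \<Sum>i\<in>I. f i x)"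
proof (induction I rule: infinite_finite_induct)
  case (insert k I)
  have "piecewise_C1 \<S> (\<lambda>x. f k x + (\<Sum>i\<in>I. f i x))"
    by (rule piecewise_C1_add) (use insert in auto)
  then show ?case using insert(1,2) by simp
qed (simp_all add: piecewise_C1_zero)

lemma piecewise_C1_const: "piecewise_C1 \<S> (\<lambda>x. c)"
  unfolding piecewise_C1_def using Ck_const by blast

lemma quadratic_imp_C1:
  assumes "quadratic_on t f"
  shows "\<exists>g. Ck (Suc 0) g \<and> (\<forall>x\<in>t. f x = g x)"
proof -
  obtain a b A where q: "\<And>x. x \<in> t \<Longrightarrow> f x = a + b \<bullet> x + x \<bullet> (A *v x)"
    using assms unfolding quadratic_on_def by blast
  let ?g = "\<lambda>x::pt. a + (b $ 1 * x $ 1 + b $ 2 * x $ 2) + (x $ 1 * (A $ 1 $ 1 * x $ 1 + A $ 1 $ 2 * x $ 2)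
      + x $ 2 * (A $ 2 $ 1 * x $ 1 + A $ 2 $ 2 * x $ 2))"
  have "Ck (Suc 0) ?g" by (intro Ck_add Ck_mult Ck_const Ck_coordinate)
  moreover have "f x = ?g x" if "x \<in> t" for x
    using q[OF that] by (simp add: inner_vec_def sum_2 matrix_vector_mult_def)
  ultimately show ?thesis by blast
qed

lemma Ck1_continuous: "Ck (Suc 0) g \<Longrightarrow> continuous_on S g"
  using Ck_Suc_imp_Ck[of 0 g] continuous_on_subset by auto

text \<open>On a segment, the triangles and the closure of the complement of their union cut out finitely
  many closed pieces; the Lipschitz bounds on the pieces combine to one on the segment.\<close>

lemma piecewise_C1_lipschitz:
  assumes S: "finite \<S>" "\<And>t. t \<in> \<S> \<Longrightarrow> 2 simplex t" and W: "piecewise_C1 \<S> W"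
    and out: "\<And>x. x \<notin> interior (\<Union>\<S>) \<Longrightarrow> W x = 0"
  obtains L where "L-lipschitz_on UNIV W"
proof -
  have "\<exists>L. L-lipschitz_on t W" if t: "t \<in> \<S>" for t
  proof -
    obtain g where g: "Ck (Suc 0) g" "\<forall>x\<in>t. W x = g x" using W t unfolding piecewise_C1_def by blast
    obtain L where L: "L-lipschitz_on t g"
      using Ck1_lipschitz_on_compact[OF g(1)] triangle_properties(1,3)[OF S(2)[OF t]] by metis
    have "L-lipschitz_on t W"
      by (rule lipschitz_on_transform[OF L]) (use g in auto)
    then show ?thesis by blast
  qed
  then obtain L where L: "\<And>t. t \<in> \<S> \<Longrightarrow> (L t)-lipschitz_on t W" by metis
  define M where "M = (\<Sum>t\<in>\<S>. \<bar>L t\<bar>)"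
  have M0: "M \<ge> 0" by (simp add: M_def sum_nonneg)
  have LM: "M-lipschitz_on t W" if "t \<in> \<S>" for t
  proof (rule lipschitz_on_mono[OF L[OF that] order_refl])
    have "\<bar>L t\<bar> \<le> M" unfolding M_def using that S(1) by (intro member_le_sum) auto
    then show "L t \<le> M" by simp
  qed
  define I where "I = insert (closure (- \<Union>\<S>)) \<S>"
  have LI: "M-lipschitz_on V W" if "V \<in> I" for V
  proof (cases "V \<in> \<S>")
    case False
    then have V: "V = - interior (\<Union>\<S>)" using that by (simp add: I_def closure_complement)
    have "M-lipschitz_on V (\<lambda>x. 0 :: real)" using M0 by (intro lipschitz_onI) auto
    then show ?thesis by (rule lipschitz_on_transform) (use V out in auto)
  qed (rule LM)
  have cI: "closed V" if "V \<in> I" for V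
    using that S(2) triangle_properties(2) by (auto simp: I_def)
  have "M-lipschitz_on UNIV W"
  proof (rule lipschitz_onI[OF _ M0])
    fix x y :: pt
    let ?l = "\<lambda>s::real. x + s *\<^sub>R (y - x)"
    have lip: "(M * norm (y - x))-lipschitz_on {0..1} (W \<circ> ?l)"
    proof (rule lipschitz_on_closed_Union[where I = I and U = "\<lambda>V. {s. ?l s \<in> V}"])
      fix V assume V: "V \<in> I"
      show "(M * norm (y - x))-lipschitz_on {s. ?l s \<in> V} (W \<circ> ?l)"
      proof (rule lipschitz_onI)
        fix s s' assume "s \<in> {s. ?l s \<in> V}" "s' \<in> {s. ?l s \<in> V}"
        then have "dist (W (?l s)) (W (?l s')) \<le> M * dist (?l s) (?l s')"
          using lipschitz_onD[OF LI[OF V]] by blast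
        also have "dist (?l s) (?l s') = norm (y - x) * dist s s'"
          by (simp add: dist_norm scaleR_diff_left[symmetric] mult.commute del: scaleR_diff_right)
        finally show "dist ((W \<circ> ?l) s) ((W \<circ> ?l) s') \<le> M * norm (y - x) * dist s s'"
          by (simp add: mult.assoc)
      qed (use M0 in simp)
      have "continuous_on UNIV ?l" by (intro continuous_intros)
      then show "closed {s. ?l s \<in> V}"
        using closed_vimage[OF cI[OF V], of ?l] by (simp add: vimage_def)
    next
      show "finite I" using S(1) by (simp add: I_def)
      show "{0..1} \<subseteq> (\<Union>V\<in>I. {s. ?l s \<in> V})"
      proof
        fix s :: real
        show "s \<in> (\<Union>V\<in>I. {s. ?l s \<in> V})"
          using closure_subset[of "- \<Union>\<S>"] by (cases "?l s \<in> \<Union>\<S>") (auto simp: I_def)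
      qed
    qed (use M0 in simp)
    show "dist (W x) (W y) \<le> M * dist x y"
      using lipschitz_onD[OF lip, of 0 1] by (simp add: dist_norm norm_minus_commute)
  qed
  then show ?thesis by (rule that)
qed

lemma AE_not_in_triangle_frontiers:
  fixes \<S> :: "pt set set"
  assumes "finite \<S>" "\<And>t. t \<in> \<S> \<Longrightarrow> 2 simplex t"
  shows "AE x in lebesgue. \<forall>t\<in>\<S>. x \<notin> frontier t"
proof (rule AE_finite_allI[OF assms(1)])
  fix t assume "t \<in> \<S>"
  then show "AE x in lebesgue. x \<notin> frontier t"
    using triangle_properties(8)[OF assms(2)[OF \<open>t \<in> \<S>\<close>]]
    by (intro AE_not_in) (simp add: negligible_iff_null_sets)
qed

lemma piecewise_C1_AE_differentiable:
  assumes S: "finite \<S>" "\<And>t. t \<in> \<S> \<Longrightarrow> 2 simplex t" and W: "piecewise_C1 \<S> W"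
    and out: "\<And>x. x \<notin> interior (\<Union>\<S>) \<Longrightarrow> W x = 0"
  shows "AE x in lebesgue. W differentiable (at x)"
    and "AE x in lebesgue. x \<notin> interior (\<Union>\<S>) \<longrightarrow> frechet_derivative W (at x) v = 0"
proof -
  have op: "open (- \<Union>\<S>)"
    using S triangle_properties(2) by (intro open_Compl closed_Union) auto
  have fr: "AE x in lebesgue. \<forall>t\<in>\<S>. x \<notin> frontier t"
    by (rule AE_not_in_triangle_frontiers) (use S in auto)
  have W0: "W x = 0" if "x \<notin> \<Union>\<S>" for x
    using out[of x] that interior_subset by blast
  have z: "(W has_derivative (\<lambda>_. 0)) (at x)" if "x \<notin> \<Union>\<S>" for x
    by (rule has_derivative_transform_within_open[of "\<lambda>_. 0" "\<lambda>_. 0" x UNIV "- \<Union>\<S>"])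
      (use that op W0 in auto)
  have i: "x \<in> interior t" if "t \<in> \<S>" "x \<in> t" "\<forall>t\<in>\<S>. x \<notin> frontier t" for x t
    using that closure_subset by (auto simp: frontier_def)
  show "AE x in lebesgue. W differentiable (at x)"
    using fr
  proof eventually_elim
    case (elim x)
    show ?case
    proof (cases "x \<in> \<Union>\<S>")
      case True
      then obtain t where t: "t \<in> \<S>" "x \<in> t" by blast
      obtain g where g: "Ck (Suc 0) g" "\<forall>x\<in>t. W x = g x" using W t unfolding piecewise_C1_def by blast
      have "(W has_derivative frechet_derivative g (at x)) (at x)"
        by (rule has_derivative_transform_within_open[of g _ x UNIV "interior t"])
          (use Ck_SucD(1)[OF g(1)] i[OF t elim] g(2) in \<open>auto dest: subsetD[OF interior_subset]\<close>)
      then show ?thesis by (auto simp: differentiable_def)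
    qed (use z in \<open>auto simp: differentiable_def\<close>)
  qed
  show "AE x in lebesgue. x \<notin> interior (\<Union>\<S>) \<longrightarrow> frechet_derivative W (at x) v = 0"
    using fr
  proof eventually_elim
    case (elim x)
    show ?case
    proof
      assume "x \<notin> interior (\<Union>\<S>)"
      then have "x \<notin> \<Union>\<S>" using i[OF _ _ elim] interior_mono[of _ "\<Union>\<S>"] by blast
      then show "frechet_derivative W (at x) v = 0"
        using frechet_derivative_at[OF z] by metis
    qed
  qed
qed

text \<open>Vanishing outside the interior of the union makes \<open>W\<close> Lipschitz on the whole plane. The second claim says
  that no flux leaves the region.\<close>

lemma piecewise_C1_has_weak_partial:
  assumes S: "finite \<S>" "\<And>t. t \<in> \<S> \<Longrightarrow> 2 simplex t" and W: "piecewise_C1 \<S> W"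
    and out: "\<And>x. x \<notin> interior (\<Union>\<S>) \<Longrightarrow> W x = 0"
  shows "has_weak_partial (interior (\<Union>\<S>)) j W (pd j W)"
    and "(\<integral>x. pd j W x \<partial>lebesgue_on (interior (\<Union>\<S>))) = 0"
proof -
  let ?U = "interior (\<Union>\<S>)"
  obtain L where L: "L-lipschitz_on UNIV W"
    using piecewise_C1_lipschitz[of \<S> W] assms by blast
  have d: "AE x in lebesgue. W differentiable (at x)"
    by (rule piecewise_C1_AE_differentiable(1)[of \<S>]) (use assms in auto)
  have d0: "AE x in lebesgue. x \<notin> ?U \<longrightarrow> pd j W x = 0"
    by (rule piecewise_C1_AE_differentiable(2)) (use assms in auto)
  have "compact (\<Union>\<S>)" using S triangle_properties(1) by (intro compact_Union) auto
  then have bd: "bounded (\<Union>\<S>)" by (rule compact_imp_bounded)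
  then obtain R where R: "\<And>x. x \<in> \<Union>\<S> \<Longrightarrow> norm x \<le> R" by (auto simp: bounded_iff)
  have supp: "W x = 0" if "R < norm x" for x
    using out[of x] R[of x] interior_subset that by force
  have "\<bar>W x\<bar> \<le> \<bar>W 0\<bar> + L * \<bar>R\<bar>" for x
  proof (cases "norm x \<le> R")
    case True
    have "\<bar>W x - W 0\<bar> \<le> L * norm x" using lipschitz_onD[OF L, of x 0] by (simp add: dist_real_def)
    also have "\<dots> \<le> L * \<bar>R\<bar>" using True lipschitz_on_nonneg[OF L] by (intro mult_left_mono) auto
    finally show ?thesis by linarith
  next
    case False
    then show ?thesis using supp[of x] lipschitz_on_nonneg[OF L] by simp
  qed
  from lipschitz_imp_has_weak_partial[OF open_interior bounded_subset[OF bd interior_subset] L this d]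
  show "has_weak_partial ?U j W (pd j W)" .
  have "continuous_on UNIV W" using L by (rule lipschitz_on_continuous_on)
  note m = borel_measurable_frechet_derivative[OF this d, of "axis j 1"]
  have sU: "?U \<in> sets lebesgue" by (rule open_in_sets_lebesgue) simp
  have "(\<integral>x. pd j W x \<partial>lebesgue_on ?U) = (\<integral>x. indicator ?U x *\<^sub>R pd j W x \<partial>lebesgue)"
    by (rule integral_restrict_space) (simp add: sU)
  also have "\<dots> = (\<integral>x. pd j W x \<partial>lebesgue)"
  proof (rule integral_cong_AE)
    show "AE x in lebesgue. indicator ?U x *\<^sub>R pd j W x = pd j W x"
      using d0 by eventually_elim (auto simp: indicator_def)
    show "(\<lambda>x. indicator ?U x *\<^sub>R pd j W x) \<in> borel_measurable lebesgue"
      by (intro borel_measurable_scaleR borel_measurable_indicator sU m)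
  qed (rule m)
  also have "\<dots> = 0" by (rule integral_frechet_derivative_zero(2)[OF L supp d])
  finally show "(\<integral>x. pd j W x \<partial>lebesgue_on ?U) = 0" .
qed

section \<open>Extension by zero\<close>

lemma square_integrable_extend_zero:
  fixes f :: "pt \<Rightarrow> real"
  assumes U: "U \<in> sets lebesgue" "V \<in> sets lebesgue" and f: "square_integrable U f"
  shows "square_integrable V (\<lambda>x. indicator U x * f x)"
proof -
  have m: "(\<lambda>x. indicator U x *\<^sub>R f x) \<in> borel_measurable lebesgue"
    using f U borel_measurable_restrict_space_iff[of U lebesgue f] by (simp add: square_integrable_real)
  have "integrable lebesgue (\<lambda>x. indicator U x *\<^sub>R (f x)\<^sup>2)"
    using f U integrable_restrict_space[of U lebesgue "\<lambda>x. (f x)\<^sup>2"] by (simp add: square_integrable_real)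
  then have "integrable lebesgue (\<lambda>x. indicator V x *\<^sub>R (indicator U x *\<^sub>R (f x)\<^sup>2))"
    by (rule integrable_mult_indicator[rotated]) (rule U)
  moreover have "(\<lambda>x. indicator V x *\<^sub>R (indicator U x *\<^sub>R (f x)\<^sup>2)) =
      (\<lambda>x. indicator V x *\<^sub>R (indicator U x * f x)\<^sup>2)"
    by (auto simp: indicator_def fun_eq_iff)
  ultimately have "integrable lebesgue (\<lambda>x. indicator V x *\<^sub>R (indicator U x * f x)\<^sup>2)"
    by (simp only:)
  then have "integrable (lebesgue_on V) (\<lambda>x. (indicator U x * f x)\<^sup>2)"
    by (subst integrable_restrict_space) (use U in auto)
  then show ?thesis
    using m by (auto simp: square_integrable_real intro: measurable_restrict_space1)
qed

lemma integral_indicator_on_subset: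
  fixes f :: "pt \<Rightarrow> real"
  assumes "U \<subseteq> V" "U \<in> sets lebesgue" "V \<in> sets lebesgue"
  shows "(\<integral>x. indicator U x * f x \<partial>lebesgue_on V) = (\<integral>x. f x \<partial>lebesgue_on U)"
proof -
  have "(\<integral>x. indicator U x * f x \<partial>lebesgue_on V) = (\<integral>x. indicator U x * f x \<partial>lebesgue_on U)"
    by (rule integral_restrict_support) (use assms in auto)
  also have "\<dots> = (\<integral>x. f x \<partial>lebesgue_on U)"
    by (rule Bochner_Integration.integral_cong) auto
  finally show ?thesis .
qed

lemma const_has_weak_partial:
  assumes "open U" "bounded U"
  shows "has_weak_partial U j (\<lambda>x. c) (\<lambda>x. 0)"
proof -
  have "has_weak_partial U j (\<lambda>x. c) (pd j (\<lambda>x. c))"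
    by (rule lipschitz_imp_has_weak_partial[OF assms, where L = 0 and B = "\<bar>c\<bar>"])
      (auto intro!: lipschitz_onI)
  moreover have "pd j (\<lambda>x. c) = (\<lambda>x. 0)" by (simp add: frechet_derivative_const)
  ultimately show ?thesis by simp
qed

text \<open>Integration by parts in \<open>H1_0 U\<close> needs no boundary condition on the second factor. With test functions of
  \<open>V\<close> as second factor it gives the weak derivative of the extension, with the constant \<open>1\<close> its mean.\<close>

lemma H1_0_extend_zero:
  assumes U: "open U" "U \<subseteq> V" and V: "open V" "bounded V" and v: "v \<in> H1_0 U"
  shows "has_weak_partial V j (\<lambda>x. indicator U x * v x $ i)
      (\<lambda>x. indicator U x * weak_partial U j (\<lambda>x. v x $ i) x)"
    and "(\<integral>x. indicator U x * weak_partial U j (\<lambda>x. v x $ i) x \<partial>lebesgue_on V) = 0"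
proof -
  have bU: "bounded U" using V(2) U(2) by (rule bounded_subset)
  note s = U(1)[THEN open_in_sets_lebesgue] V(1)[THEN open_in_sets_lebesgue]
  have "v \<in> H1 U" using v by (simp add: H1_0_def)
  note w = H1_has_weak_partial[OF this, of j i]
  show "has_weak_partial V j (\<lambda>x. indicator U x * v x $ i)
      (\<lambda>x. indicator U x * weak_partial U j (\<lambda>x. v x $ i) x)"
    unfolding has_weak_partial_def
  proof (intro conjI ballI square_integrable_extend_zero s has_weak_partialD(1,2)[OF w])
    fix \<phi> assume \<phi>: "\<phi> \<in> test_functions V"
    show "(\<integral>x. indicator U x * v x $ i * pd j \<phi> x \<partial>lebesgue_on V)
        = - (\<integral>x. indicator U x * weak_partial U j (\<lambda>x. v x $ i) x * \<phi> x \<partial>lebesgue_on V)"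
      using H1_0_integration_by_parts[OF U(1) bU v test_function_has_weak_partial[OF U(1) bU \<phi>], of j i]
      by (simp add: mult.assoc integral_indicator_on_subset[OF U(2) s])
  qed
  show "(\<integral>x. indicator U x * weak_partial U j (\<lambda>x. v x $ i) x \<partial>lebesgue_on V) = 0"
    using H1_0_integration_by_parts[OF U(1) bU v const_has_weak_partial[OF U(1) bU, of j 1], of i]
    by (simp add: integral_indicator_on_subset[OF U(2) s])
qed

section \<open>Offline basis functions of interior edges\<close>

lemma continuous_zero_on_closure:
  fixes f :: "pt \<Rightarrow> real"
  assumes "continuous_on (closure S) f" "\<And>x. x \<in> S \<Longrightarrow> f x = 0" "x \<in> closure S"
  shows "f x = 0"
  using continuous_constant_on_closure[of S f 0 x] assms by auto

lemma segment_subset_closure_minus_finite: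
  fixes f :: "pt set"
  assumes "1 simplex f" "finite F"
  shows "f \<subseteq> closure (f - F)"
proof
  fix x assume x: "x \<in> f"
  obtain a b where ab: "a \<noteq> b" "f = closed_segment a b" using edge_segment[OF assms(1)] .
  have "connected f" "\<not> (\<exists>c. f = {c})" using ab by (auto simp: closed_segment_eq_sing)
  then have "x islimpt f" using x connected_imp_perfect by blast
  then have "x islimpt (f - F)" using islimpt_Un_finite[OF assms(2), of x "f - F"] by (simp add: islimpt_Un Un_commute)
  then show "x \<in> closure (f - F)" by (simp add: closure_def)
qed

lemma edge_integral_cong:
  assumes "\<And>x. x \<in> e \<Longrightarrow> f x = g x"
  shows "edge_integral e f = edge_integral e g"
proof -
  have "integral {0..1} (\<lambda>\<tau>. f (linepath a b \<tau>)) = integral {0..1} (\<lambda>\<tau>. g (linepath a b \<tau>))"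
    if "e = closed_segment a b" for a b
    using that assms linepath_in_path[of _ a b] by (intro Henstock_Kurzweil_Integration.integral_cong) auto
  then show ?thesis unfolding edge_integral_def by (metis (no_types, lifting))
qed

lemma edge_integral_zero:
  assumes "1 simplex e" "\<And>x. x \<in> e \<Longrightarrow> f x = 0"
  shows "edge_integral e f = 0"
proof -
  obtain a b where "e = closed_segment a b" using edge_segment[OF assms(1)] by metis
  then have "edge_integral e (\<lambda>x. 0) = 0"
    unfolding edge_integral_def by (intro the_equality) auto
  moreover have "edge_integral e f = edge_integral e (\<lambda>x. 0)"
    by (rule edge_integral_cong) (rule assms(2))
  ultimately show ?thesis by simp
qed

lemma finite_boundary_edges:
  assumes "finite R" "\<And>t. t \<in> R \<Longrightarrow> 2 simplex t"
  shows "finite (boundary_edges R)"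
proof (rule finite_subset)
  show "boundary_edges R \<subseteq> (SIGMA t:R. {F. F face_of t})"
    by (auto simp: boundary_edges_def mesh_edges_def)
  show "finite (SIGMA t:R. {F. F face_of t})"
    using assms simplex_imp_polytope finite_polytope_faces by (intro finite_SigmaI) blast+
qed

context perforated_grid begin

lemma nbhd_subset: "nbhd X \<subseteq> \<T>h"
  unfolding nbhd_def using block_subset by blast

text \<open>A triangle outside the neighborhood may share an edge with it, but its interior does not meet the
  neighborhood; continuity extends the vanishing from the interior to the triangle.\<close>

lemma pou_zero_off_nbhd:
  assumes pou: "partition_of_unity pou" and X: "X \<in> anchors" and t: "t \<in> \<T>h" "t \<notin> nbhd X" "x \<in> t"
  shows "pou X x = 0"
proof -
  note tp = triangle_properties[OF fine_triangle[OF t(1)]]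
  have "pou X y = 0" if y: "y \<in> interior t" for y
  proof -
    have "y \<notin> t'" if t': "t' \<in> nbhd X" for t'
    proof -
      have "t' \<in> \<T>h" "t' \<noteq> t" using t' nbhd_subset t(2) by blast+
      then show ?thesis using triangles_disjoint_interior[OF meshes(2) t(1), of t'] y by blast
    qed
    moreover have "y \<in> \<Union>\<T>h" using y t(1) interior_subset by blast
    ultimately show ?thesis using pou X unfolding partition_of_unity_def by blast
  qed
  moreover have "continuous_on (closure (interior t)) (pou X)"
  proof -
    have "continuous_on (\<Union>\<T>h) (pou X)" using pou X unfolding partition_of_unity_def by blast
    then show ?thesis
      unfolding tp(5)[symmetric] by (rule continuous_on_subset) (use t(1) in blast)
  qed
  ultimately show ?thesis
    using continuous_zero_on_closure[of "interior t" "pou X" x] t(3) tp(5) by blast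
qed

lemma pou_piecewise_C1:
  assumes "partition_of_unity pou" "X \<in> anchors"
  shows "piecewise_C1 \<T>h (pou X)"
  using assms unfolding partition_of_unity_def piecewise_C1_def by simp

lemma snapshot_properties:
  assumes u: "is_snapshot \<delta> X e d u"
  shows "piecewise_C1 (nbhd X) (\<lambda>x. u x $ i)"
    and "x \<in> \<Union>(nbhd X) \<inter> frontier B \<Longrightarrow> u x = 0"
proof -
  have uV: "u \<in> V_h_loc X" using u unfolding is_snapshot_def Let_def by blast
  then obtain v where v: "v \<in> V_h" "\<And>x. u x = (if x \<in> \<Union>(nbhd X) then v x else 0)"
    unfolding V_h_loc_def by auto
  show "piecewise_C1 (nbhd X) (\<lambda>x. u x $ i)"
    unfolding piecewise_C1_def
  proof
    fix t assume t: "t \<in> nbhd X"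
    then have "quadratic_on t (\<lambda>x. v x $ i)"
      using v(1) nbhd_subset unfolding V_h_def by blast
    from quadratic_imp_C1[OF this] obtain g where "Ck (Suc 0) g" "\<forall>x\<in>t. v x $ i = g x" by blast
    moreover have "u x = v x" if "x \<in> t" for x using v(2) t that by auto
    ultimately show "\<exists>g. Ck (Suc 0) g \<and> (\<forall>x\<in>t. u x $ i = g x)" by auto
  qed
  show "x \<in> \<Union>(nbhd X) \<inter> frontier B \<Longrightarrow> u x = 0"
    using u unfolding is_snapshot_def Let_def by blast
qed

lemma snap_space_properties:
  assumes u: "u \<in> snap_space \<delta> X"
  shows "piecewise_C1 (nbhd X) (\<lambda>x. u x $ i)"
    and "x \<in> \<Union>(nbhd X) \<inter> frontier B \<Longrightarrow> u x = 0"
proof -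
  obtain S c where S: "finite S" "S \<subseteq> {u. \<exists>e\<in>snap_edges X. \<exists>d. is_snapshot \<delta> X e d u}"
    "u = (\<lambda>x. \<Sum>f\<in>S. c f *\<^sub>R f x)"
    using u unfolding snap_space_def field_span_def by blast
  have "(\<lambda>x. u x $ i) = (\<lambda>x. \<Sum>f\<in>S. c f * (f x $ i))"
    unfolding S(3) by simp
  moreover have "piecewise_C1 (nbhd X) (\<lambda>x. \<Sum>f\<in>S. c f * (f x $ i))"
  proof (intro piecewise_C1_sum piecewise_C1_mult piecewise_C1_const)
    fix f assume "f \<in> S"
    then obtain e d where "is_snapshot \<delta> X e d f" using S(2) by blast
    then show "piecewise_C1 (nbhd X) (\<lambda>x. f x $ i)" by (rule snapshot_properties(1))
  qed
  ultimately show "piecewise_C1 (nbhd X) (\<lambda>x. u x $ i)" by simp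
  assume x: "x \<in> \<Union>(nbhd X) \<inter> frontier B"
  have "f x = 0" if "f \<in> S" for f
  proof -
    obtain e d where "is_snapshot \<delta> X e d f" using S(2) \<open>f \<in> S\<close> by blast
    then show ?thesis using x by (rule snapshot_properties(2))
  qed
  then show "u x = 0" unfolding S(3) by (simp add: sum.neutral)
qed

text \<open>The products \<open>\<omega> = \<chi> \<Phi>\<close> of a partition function and a component of a discrete field are
  the boundary data of the offline basis functions.\<close>

lemma weighted_field_properties:
  fixes d :: 2
  assumes pou: "partition_of_unity pou" and X: "X \<in> anchors" and u: "u \<in> snap_space \<delta> X"
  defines "\<omega> \<equiv> \<lambda>x. pou X x * u x $ d"
  shows "piecewise_C1 \<T>h \<omega>"
    and "\<And>t x. t \<in> \<T>h \<Longrightarrow> t \<notin> nbhd X \<Longrightarrow> x \<in> t \<Longrightarrow> \<omega> x = 0"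
    and "\<And>x. x \<in> \<Union>\<T>h \<Longrightarrow> x \<in> B \<Longrightarrow> \<omega> x = 0"
    and "\<And>e' x. e' \<in> mesh_edges \<T>H \<Longrightarrow> \<not> X \<subseteq> G ` e' \<Longrightarrow> x \<in> G ` e' - B \<Longrightarrow> \<omega> x = 0"
proof -
  have z: "pou X x = 0" if "t \<in> \<T>h" "t \<notin> nbhd X" "x \<in> t" for t x
    using pou_zero_off_nbhd[OF pou X that] .
  show z': "\<And>t x. t \<in> \<T>h \<Longrightarrow> t \<notin> nbhd X \<Longrightarrow> x \<in> t \<Longrightarrow> \<omega> x = 0"
    using z by (simp add: \<omega>_def)
  show "piecewise_C1 \<T>h \<omega>"
    unfolding piecewise_C1_def
  proof
    fix t assume t: "t \<in> \<T>h"
    show "\<exists>g. Ck (Suc 0) g \<and> (\<forall>x\<in>t. \<omega> x = g x)"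
    proof (cases "t \<in> nbhd X")
      case True
      obtain g where g: "Ck (Suc 0) g" "\<forall>x\<in>t. pou X x = g x"
        using pou_piecewise_C1[OF pou X] t unfolding piecewise_C1_def by blast
      obtain h where h: "Ck (Suc 0) h" "\<forall>x\<in>t. u x $ d = h x"
        using snap_space_properties(1)[OF u, of d] True unfolding piecewise_C1_def by blast
      have "Ck (Suc 0) (\<lambda>x. g x * h x)" using g(1) h(1) by (rule Ck_mult)
      moreover have "\<forall>x\<in>t. \<omega> x = g x * h x" using g(2) h(2) by (simp add: \<omega>_def)
      ultimately show ?thesis by (intro exI[of _ "\<lambda>x. g x * h x"] conjI)
    next
      case False
      then show ?thesis using z'[OF t] Ck_const[of "Suc 0" 0] by blast
    qed
  qed
  show "\<omega> x = 0" if "x \<in> \<Union>\<T>h" "x \<in> B" for x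
  proof (cases "x \<in> \<Union>(nbhd X)")
    case True
    then have "u x = 0" using snap_space_properties(2)[OF u, of x] fine_point_in_B[OF that] by blast
    then show ?thesis by (simp add: \<omega>_def)
  next
    case False
    then show ?thesis using that(1) z' by blast
  qed
  show "\<And>e' x. e' \<in> mesh_edges \<T>H \<Longrightarrow> \<not> X \<subseteq> G ` e' \<Longrightarrow> x \<in> G ` e' - B \<Longrightarrow> \<omega> x = 0"
    using pou X unfolding partition_of_unity_def \<omega>_def by (metis mult_zero_left)
qed

end

text \<open>An interior coarse edge with its two adjacent triangles, and a function with the properties
  of the boundary data of the associated offline basis functions.\<close>

locale edge_data = perforated_grid +
  fixes e T1 T2 :: "pt set" and y0 :: pt and \<omega> :: "pt \<Rightarrow> real"
  assumes T12: "T1 \<in> \<T>H" "T2 \<in> \<T>H" "T1 \<noteq> T2" "e face_of T1" "e face_of T2" "1 simplex e"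
    and y0: "y0 \<in> rel_interior e" "G y0 \<in> perf_dom"
    and \<omega>C1: "piecewise_C1 \<T>h \<omega>"
    and \<omega>_off: "\<And>t x. t \<in> \<T>h \<Longrightarrow> t \<notin> nbhd (edge_set e) \<Longrightarrow> x \<in> t \<Longrightarrow> \<omega> x = 0"
    and \<omega>_B: "\<And>x. x \<in> \<Union>\<T>h \<Longrightarrow> x \<in> B \<Longrightarrow> \<omega> x = 0"
    and \<omega>_edges: "\<And>e' x. e' \<in> mesh_edges \<T>H \<Longrightarrow> \<not> edge_set e \<subseteq> G ` e' \<Longrightarrow> x \<in> G ` e' - B \<Longrightarrow> \<omega> x = 0"
begin

lemma e_mesh_edge: "e \<in> mesh_edges \<T>H"
  using T12 by (auto simp: mesh_edges_def)

lemma nbhd_edge_set: "nbhd (edge_set e) = block T1 \<union> block T2"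
  unfolding nbhd_def
  using block_contains_edge_set_iff(1)[OF T12 y0] by simp

text \<open>A boundary point of a coarse triangle that is not in the relative interior of \<open>e\<close> lies on an edge other
  than \<open>e\<close>, where \<open>\<omega>\<close> vanishes.\<close>

lemma \<omega>_nonzero_location:
  assumes T: "T \<in> \<T>H" and x: "x \<in> G ` T" "x \<in> \<Union>\<T>h" "\<omega> x \<noteq> 0"
  shows "x \<notin> B" and "x \<in> G ` interior T \<or> x \<in> G ` rel_interior e \<and> e face_of T"
proof -
  show xB: "x \<notin> B" using \<omega>_B x(2,3) by blast
  obtain y where y: "y \<in> T" "x = G y" using x(1) by blast
  have on_edge: "e' = e" if e': "1 simplex e'" "e' face_of T" "y \<in> e'" for e'
  proof -
    have m: "e' \<in> mesh_edges \<T>H" using e' T by (auto simp: mesh_edges_def)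
    have "x \<in> G ` e' - B" using e'(3) y(2) xB by blast
    then have "edge_set e \<subseteq> G ` e'" using \<omega>_edges[OF m] x(3) by blast
    then show ?thesis by (rule edge_eq_if_edge_set_subset[OF e_mesh_edge y0 m])
  qed
  show "x \<in> G ` interior T \<or> x \<in> G ` rel_interior e \<and> e face_of T"
  proof (cases "y \<in> interior T")
    case False
    obtain e1 where e1: "1 simplex e1" "e1 face_of T" "y \<in> e1"
      using triangle_boundary_point_on_edge[OF coarse_triangle[OF T] y(1) False] .
    then have eT: "e face_of T" "y \<in> e" using on_edge by blast+
    have "y \<in> rel_interior e"
    proof (rule ccontr)
      assume "y \<notin> rel_interior e"
      then obtain e' where "1 simplex e'" "e' face_of T" "y \<in> e'" "e' \<noteq> e"
        using edge_endpoint_on_other_edge[OF coarse_triangle[OF T] T12(6) eT] by metis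
      then show False using on_edge by blast
    qed
    then show ?thesis using y(2) eT by blast
  qed (use y(2) in blast)
qed

text \<open>The points where \<open>\<omega>\<close> may be nonzero are interior to one curved triangle or to the union of the two at
  \<open>e\<close>, and not in \<open>B\<close>.\<close>

lemma \<omega>_zero_outside:
  assumes x: "x \<in> \<Union>\<T>h" "x \<notin> perf_dom"
  shows "\<omega> x = 0"
proof (rule ccontr)
  assume nz: "\<omega> x \<noteq> 0"
  obtain t where t: "t \<in> \<T>h" "x \<in> t" using x(1) by blast
  obtain T where T: "T \<in> \<T>H" "t \<subseteq> G ` T" using refinement t(1) by blast
  then have xT: "x \<in> G ` T" using t(2) by blast
  note loc = \<omega>_nonzero_location[OF T(1) xT x(1) nz]
  show False using loc(2)
  proof
    assume "x \<in> G ` interior T"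
    then show False using coarse_interior_subset[OF T(1)] loc(1) x(2) by blast
  next
    assume "x \<in> G ` rel_interior e \<and> e face_of T"
    then have "x \<in> G ` interior (T1 \<union> T2)"
      using two_triangles_surround_edge[OF meshes(1) T12(1-3,6,4,5)] by blast
    moreover have "interior (T1 \<union> T2) \<subseteq> \<Union>\<T>H" using T12(1,2) interior_subset by blast
    ultimately show False
      using coarse_open_subset[of "interior (T1 \<union> T2)"] loc(1) x(2) by blast
  qed
qed

text \<open>A fine edge may run around the image of a coarse vertex, so it need not lie on one coarse edge. But
  where \<open>\<omega>\<close> does not vanish, \<open>f\<close> is inside the domain and has a second fine triangle, which belongs to the
  other block. So \<open>f\<close> lies in both curved triangles, that is, on the image of \<open>e\<close>, and it meets \<open>B\<close> in
  finitely many points only.\<close>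

lemma \<omega>_zero_on_other_boundary_edges:
  assumes T0: "T0 \<in> {T1, T2}" and tf: "(t, f) \<in> boundary_edges (block T0)" and f: "\<not> f \<subseteq> edge_set e" and xf: "x \<in> f"
  shows "\<omega> x = 0"
proof -
  have T0H: "T0 \<in> \<T>H" "e face_of T0" using T0 T12 by auto
  have t: "t \<in> block T0" "1 simplex f" "f face_of t" and uniq: "\<And>t'. t' \<in> block T0 \<Longrightarrow> f \<subseteq> t' \<Longrightarrow> t' = t"
    using tf by (auto simp: boundary_edges_def mesh_edges_def)
  have tT: "t \<in> \<T>h" "t \<subseteq> G ` T0" using t(1) by (auto simp: block_def)
  have ft: "f \<subseteq> t" using t(3) by (rule face_of_imp_subset)
  note tp = triangle_properties[OF fine_triangle[OF tT(1)]]
  have nint: "x \<notin> interior t" if "x \<in> f" for x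
  proof -
    have "f \<noteq> t" using aff_dim_simplex[OF t(2)] tp(7) by auto
    then show ?thesis using face_of_disjoint_interior[OF t(3)] that by blast
  qed
  have rel: "\<omega> x = 0" if x: "x \<in> rel_interior f" for x
  proof (rule ccontr)
    assume nz: "\<omega> x \<noteq> 0"
    have xf: "x \<in> f" using x rel_interior_subset by blast
    then have xt: "x \<in> t" and xTh: "x \<in> \<Union>\<T>h" and xT0: "x \<in> G ` T0" using ft tT by blast+
    have xp: "x \<in> perf_dom" using \<omega>_zero_outside[OF xTh] nz by blast
    note loc = \<omega>_nonzero_location[OF T0H(1) xT0 xTh nz]
    have face: "f \<subseteq> t'" if "t' \<in> \<T>h" "x \<in> t'" for t'
      using edge_subset_if_relint_point(1)[OF meshes(2) tT(1) that(1) t(3) x that(2)] .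
    show False using loc(2)
    proof
      assume xi: "x \<in> G ` interior T0"
      let ?O = "perf_dom \<inter> G ` interior T0 \<inter> - \<Union>(block T0 - {t})"
      have "closed (\<Union>(block T0 - {t}))" by (rule closed_Union_fine) (auto simp: block_def)
      then have "open ?O" using perf_dom_open G_open by (intro open_Int) auto
      moreover have "x \<in> ?O"
        using xp xi face uniq by (auto simp: block_def)
      moreover have "?O \<subseteq> t"
      proof
        fix z assume z: "z \<in> ?O"
        then obtain t' where t': "t' \<in> \<T>h" "z \<in> t'" using perf_dom_subset_fine by blast
        then have "t' \<in> block T0" using block_of_interior_point[OF T0H(1)] z by blast
        then show "z \<in> t" using z t' by blast
      qed
      ultimately show False using nint[OF xf] interiorI by blast
    next
      assume xe: "x \<in> G ` rel_interior e \<and> e face_of T0"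
      then obtain y where y: "y \<in> rel_interior e" "x = G y" by blast
      have "\<exists>t'\<in>\<T>h. t' \<noteq> t \<and> x \<in> t'"
      proof (rule ccontr)
        assume none: "\<not> (\<exists>t'\<in>\<T>h. t' \<noteq> t \<and> x \<in> t')"
        let ?O = "perf_dom \<inter> - \<Union>(\<T>h - {t})"
        have "closed (\<Union>(\<T>h - {t}))" by (rule closed_Union_fine) auto
        then have "open ?O" using perf_dom_open by (intro open_Int) auto
        moreover have "x \<in> ?O" using xp none by blast
        moreover have "?O \<subseteq> t" using perf_dom_subset_fine by blast
        ultimately show False using nint[OF xf] interiorI by blast
      qed
      then obtain t' where t': "t' \<in> \<T>h" "t' \<noteq> t" "x \<in> t'" by blast
      have ft': "f \<subseteq> t'" using face[OF t'(1,3)] .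
      obtain T' where T': "T' \<in> \<T>H" "t' \<subseteq> G ` T'" using refinement t'(1) by blast
      have ne: "T0 \<noteq> T'"
      proof
        assume "T0 = T'"
        then have "t' \<in> block T0" using t'(1) T'(2) by (simp add: block_def)
        then show False using uniq ft' t'(2) by blast
      qed
      have yT': "y \<in> T'" using y(2) t'(3) T'(2) G_mem by blast
      have "e \<subseteq> T'" using edge_subset_if_relint_point(1)[OF meshes(1) T0H(1) T'(1) T0H(2) y(1) yT'] .
      then have int: "T0 \<inter> T' = e"
        using shared_edge_eq_intersection[OF meshes(1) T0H(1) T'(1) ne T12(6) T0H(2)] by blast
      have fe: "f \<subseteq> G ` e"
      proof
        fix z assume "z \<in> f"
        then have "z \<in> G ` T0" "z \<in> G ` T'" using ft tT(2) ft' T'(2) by blast+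
        then show "z \<in> G ` e" unfolding int[symmetric] using G_mem by auto
      qed
      have "x \<notin> frontier B" using loc(1) perforations(1) by (auto simp: frontier_def)
      then have "\<not> f \<subseteq> frontier B" using xf by blast
      moreover have "f \<in> mesh_edges \<T>h" using t(2,3) tT(1) by (auto simp: mesh_edges_def)
      ultimately have "f \<inter> frontier B \<subseteq> mesh_vertices \<T>h" using resolved by blast
      moreover have "f \<inter> B \<subseteq> frontier B" using fine_point_in_B ft tT(1) by blast
      ultimately have fB: "f - mesh_vertices \<T>h \<subseteq> G ` e - B" using fe by blast
      have "f \<subseteq> closure (f - mesh_vertices \<T>h)"
        using segment_subset_closure_minus_finite[OF t(2) finite_mesh_vertices[OF meshes(2)]] .
      also have "\<dots> \<subseteq> edge_set e" unfolding edge_set_def using fB by (rule closure_mono)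
      finally show False using assms(3) by blast
    qed
  qed
  obtain g where g: "Ck (Suc 0) g" "\<forall>x\<in>t. \<omega> x = g x" using \<omega>C1 tT(1) unfolding piecewise_C1_def by blast
  have cl: "closure (rel_interior f) = f"
  proof -
    obtain a b where "f = closed_segment a b" using edge_segment[OF t(2)] by metis
    then show ?thesis by (simp add: convex_closure_rel_interior)
  qed
  have "continuous_on f g" using g(1) by (rule Ck1_continuous)
  then have "continuous_on f \<omega>" by (rule continuous_on_eq) (use g(2) ft in auto)
  then show ?thesis
    using continuous_zero_on_closure[of "rel_interior f" \<omega> x] rel xf unfolding cl by blast
qed

end

text \<open>An offline basis function \<open>\<Phi>\<close> of the edge with boundary data \<open>(\<omega>, 0)\<close> or \<open>(0, \<omega>)\<close>, and a continuous
  representative \<open>g\<close> of its trace on one of the blocks, with nonzero flux through the edge.\<close>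

locale edge_basis_function = edge_data +
  fixes d :: 2 and \<Phi> :: field and K0 :: "pt set set" and g :: field
  assumes minimizer: "\<And>K. K \<in> {block T1, block T2} \<Longrightarrow> stokes_minimizer K (\<lambda>x. axis d (\<omega> x)) \<Phi>"
    and \<Phi>_off: "\<And>x. x \<notin> \<Union>(nbhd (edge_set e)) \<Longrightarrow> \<Phi> x = 0"
    and K0: "K0 \<in> {block T1, block T2}"
    and g: "has_trace K0 \<Phi> g" "flux {(t, f) \<in> boundary_edges K0. f \<subseteq> edge_set e} g \<noteq> 0"
begin

abbreviation U :: "pt set set \<Rightarrow> pt set" where
  "U K \<equiv> interior (\<Union>K)"

definition W :: "pt \<Rightarrow> real" where
  "W x = (if x \<in> \<Union>\<T>h then \<omega> x else 0)"

definition v :: field where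
  "v x = \<Phi> x - axis d (\<omega> x)"

lemma perf_bounded: "bounded perf_dom"
  by (rule bounded_subset_fine[OF perf_dom_subset_fine])

lemma K12: "block T1 \<noteq> block T2" "K \<in> {block T1, block T2} \<Longrightarrow> K \<in> blocks" "finite {block T1, block T2}"
  using block_contains_edge_set_iff[OF T12 y0] by auto

lemma U_properties:
  assumes "K \<in> {block T1, block T2}"
  shows "open (U K)" "bounded (U K)" "U K \<subseteq> perf_dom" "U K \<in> sets lebesgue" "K \<subseteq> \<T>h" "K \<noteq> {}"
    "U K \<in> lmeasurable" "measure lebesgue (U K) > 0"
proof -
  have Kb: "K \<in> blocks" using K12(2)[OF assms] .
  then show Kh: "K \<subseteq> \<T>h" by (rule block_subset)
  show "K \<noteq> {}" using Kb by (auto simp: blocks_def)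
  then obtain t where t: "t \<in> K" by blast
  show op: "open (U K)" by simp
  show sub: "U K \<subseteq> perf_dom" unfolding fine_cover using Kh by (intro interior_mono) auto
  show bd: "bounded (U K)" using bounded_subset[OF perf_bounded sub] .
  show "U K \<in> sets lebesgue" using op by (rule open_in_sets_lebesgue)
  show lm: "U K \<in> lmeasurable" using bd op by (rule lmeasurable_open)
  have "interior t \<noteq> {}" using triangle_properties(4)[OF fine_triangle] t Kh by blast
  moreover have "interior t \<subseteq> U K" using t by (intro interior_mono) auto
  ultimately have "\<not> negligible (U K)" using open_not_negligible[OF op] by blast
  then show "measure lebesgue (U K) > 0"
    using lm by (simp add: negligible_iff_measure zero_less_measure_iff less_le)
qed

lemma perf_lebesgue: "perf_dom \<in> sets lebesgue"
  using perf_dom_open by (rule open_in_sets_lebesgue)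

lemma admissible:
  assumes "K \<in> {block T1, block T2}"
  shows "\<Phi> \<in> H1 (U K)" "v \<in> H1_0 (U K)"
    "AE x in lebesgue_on (U K). divergence (U K) \<Phi> x = flux (boundary_edges K) (\<lambda>x. axis d (\<omega> x)) / area K"
  using minimizer[OF assms]
  by (simp_all add: stokes_minimizer_def stokes_admissible_def has_trace_def v_def[abs_def])

lemma W_piecewise: "piecewise_C1 \<T>h W"
proof -
  have "\<forall>t\<in>\<T>h. \<forall>x\<in>t. W x = \<omega> x" by (auto simp: W_def)
  then show ?thesis using \<omega>C1 unfolding piecewise_C1_def by metis
qed

lemma W_zero: "x \<notin> perf_dom \<Longrightarrow> W x = 0"
  by (simp add: W_def \<omega>_zero_outside)

lemma W_weak_partial:
  "has_weak_partial perf_dom j W (pd j W)" "(\<integral>x. pd j W x \<partial>lebesgue_on perf_dom) = 0"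
proof -
  have "x \<notin> interior (\<Union>\<T>h) \<Longrightarrow> W x = 0" for x using W_zero fine_cover by blast
  then show "has_weak_partial perf_dom j W (pd j W)" "(\<integral>x. pd j W x \<partial>lebesgue_on perf_dom) = 0"
    unfolding fine_cover
    using piecewise_C1_has_weak_partial[OF meshes_finite(2) fine_triangle W_piecewise] by blast+
qed

text \<open>The weak gradient of \<open>\<Phi>\<close>: the derivative of the Lipschitz extension \<open>W\<close> of the boundary data and the
  corrections inside the two blocks.\<close>

definition D :: "2 \<Rightarrow> 2 \<Rightarrow> pt \<Rightarrow> real" where
  "D i j x = (if i = d then 1 else 0) * pd j W x
     + (\<Sum>K\<in>{block T1, block T2}. indicator (U K) x * weak_partial (U K) j (\<lambda>x. v x $ i) x)"

lemma AE_in_fine_interior: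
  assumes "\<And>x t. t \<in> \<T>h \<Longrightarrow> x \<in> interior t \<Longrightarrow> P x"
  shows "AE x in lebesgue_on perf_dom. P x"
proof -
  have "AE x in lebesgue. \<forall>t\<in>\<T>h. x \<notin> frontier t"
    by (rule AE_not_in_triangle_frontiers) (use meshes_finite fine_triangle in auto)
  then have "AE x in lebesgue. x \<in> perf_dom \<longrightarrow> P x"
  proof eventually_elim
    case (elim x)
    show ?case
    proof
      assume "x \<in> perf_dom"
      then obtain t where t: "t \<in> \<T>h" "x \<in> t" using perf_dom_subset_fine by blast
      then have "x \<in> interior t" using elim closure_subset[of t] by (auto simp: frontier_def)
      then show "P x" using assms t(1) by blast
    qed
  qed
  then show ?thesis using perf_lebesgue by (simp add: AE_restrict_space_iff)
qed

lemma fine_interior_block: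
  assumes t: "t \<in> \<T>h" "x \<in> interior t" and K: "K \<in> blocks"
  shows "x \<in> \<Union>K \<longleftrightarrow> t \<in> K" "x \<in> U K \<longleftrightarrow> t \<in> K"
proof -
  have 1: "t \<in> K" if x: "x \<in> \<Union>K"
  proof -
    obtain t' where t': "t' \<in> K" "x \<in> t'" using x by blast
    then have "t' \<in> \<T>h" using block_subset[OF K] by blast
    then have "t = t'" using triangles_disjoint_interior[OF meshes(2) t(1)] t(2) t'(2) by blast
    then show ?thesis using t' by simp
  qed
  have 2: "x \<in> U K" if "t \<in> K"
    using interior_mono[of t "\<Union>K"] that t(2) by blast
  show "x \<in> \<Union>K \<longleftrightarrow> t \<in> K" "x \<in> U K \<longleftrightarrow> t \<in> K"
    using 1 2 interior_subset by blast+
qed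

text \<open>Off the neighborhood, \<open>\<Phi>\<close> and its boundary data vanish; on each of the two blocks they differ by a
  field in \<open>H1_0\<close>. Hence \<open>\<Phi>\<close> is the sum of a Lipschitz field and two extensions by zero.\<close>

lemma \<Phi>_weak_partial: "has_weak_partial perf_dom j (\<lambda>x. \<Phi> x $ i) (D i j)"
proof -
  have zp: "has_weak_partial perf_dom j (\<lambda>x. \<Sum>K\<in>{block T1, block T2}. indicator (U K) x * v x $ i)
      (\<lambda>x. \<Sum>K\<in>{block T1, block T2}. indicator (U K) x * weak_partial (U K) j (\<lambda>x. v x $ i) x)"
  proof (rule has_weak_partial_sum[OF perf_dom_open perf_bounded])
    fix K assume K: "K \<in> {block T1, block T2}"
    show "has_weak_partial perf_dom j (\<lambda>x. indicator (U K) x * v x $ i)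
      (\<lambda>x. indicator (U K) x * weak_partial (U K) j (\<lambda>x. v x $ i) x)"
      by (rule H1_0_extend_zero(1)[OF U_properties(1,3)[OF K] perf_dom_open perf_bounded admissible(2)[OF K]])
  qed
  have wp: "has_weak_partial perf_dom j (\<lambda>x. (if i = d then 1 else 0) * W x) (\<lambda>x. (if i = d then 1 else 0) * pd j W x)"
    by (rule has_weak_partial_cmult[OF W_weak_partial(1)])
  have s: "has_weak_partial perf_dom j (\<lambda>x. (if i = d then 1 else 0) * W x + (\<Sum>K\<in>{block T1, block T2}. indicator (U K) x * v x $ i)) (D i j)"
    unfolding D_def[abs_def] by (rule has_weak_partial_add[OF perf_dom_open perf_bounded wp zp])
  show ?thesis
  proof (rule has_weak_partial_cong_AE[OF perf_dom_open s])
    show "AE x in lebesgue_on perf_dom. (if i = d then 1 else 0) * W x + (\<Sum>K\<in>{block T1, block T2}. indicator (U K) x * v x $ i) = \<Phi> x $ i"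
    proof (rule AE_in_fine_interior)
      fix x t assume t: "t \<in> \<T>h" "x \<in> interior t"
      then have xt: "x \<in> t" using interior_subset by blast
      note fb1 = fine_interior_block(2)[OF t K12(2)[of "block T1"]] and fb2 = fine_interior_block(2)[OF t K12(2)[of "block T2"]]
      have W: "W x = \<omega> x" using xt t(1) by (auto simp: W_def)
      have sum: "(\<Sum>K\<in>{block T1, block T2}. indicator (U K) x * v x $ i)
          = (if t \<in> block T1 then v x $ i else 0) + (if t \<in> block T2 then v x $ i else 0)"
        using K12(1) fb1 fb2 by (simp add: indicator_def)
      have disj: "\<not> (t \<in> block T1 \<and> t \<in> block T2)"
        using blocks_disjoint[OF T12(1,2)] T12(3) by blast
      have ax: "axis d (\<omega> x) $ i = (if i = d then 1 else 0) * \<omega> x" by (simp add: axis_def)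
      show "(if i = d then 1 else 0) * W x + (\<Sum>K\<in>{block T1, block T2}. indicator (U K) x * v x $ i) = \<Phi> x $ i"
      proof (cases "t \<in> block T1 \<or> t \<in> block T2")
        case True
        then show ?thesis unfolding sum W using disj by (auto simp: v_def ax)
      next
        case False
        then have nb: "t \<notin> nbhd (edge_set e)" by (simp add: nbhd_edge_set)
        have "x \<notin> \<Union>(nbhd (edge_set e))"
          using fine_interior_block(1)[OF t K12(2)[of "block T1"]] fine_interior_block(1)[OF t K12(2)[of "block T2"]] False
          unfolding nbhd_edge_set by blast
        then show ?thesis unfolding sum W using False \<omega>_off[OF t(1) nb xt] \<Phi>_off by simp
      qed
    qed
  qed simp
qed

lemma \<Phi>_H1: "\<Phi> \<in> H1 perf_dom"
  unfolding H1_def using \<Phi>_weak_partial by blast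

lemma integral_D: "(\<integral>x. D i j x \<partial>lebesgue_on perf_dom) = 0"
proof -
  have int: "integrable (lebesgue_on perf_dom) f" if "square_integrable perf_dom f" for f :: "pt \<Rightarrow> real"
    using square_integrable_mult_integrable[OF that has_weak_partialD(1)[OF const_has_weak_partial[OF perf_dom_open perf_bounded, of j 1]]] by simp
  have i1: "integrable (lebesgue_on perf_dom) (pd j W)"
    by (rule int[OF has_weak_partialD(2)[OF W_weak_partial(1)]])
  have z: "integrable (lebesgue_on perf_dom) (\<lambda>x. indicator (U K) x * weak_partial (U K) j (\<lambda>x. v x $ i) x)"
    "(\<integral>x. indicator (U K) x * weak_partial (U K) j (\<lambda>x. v x $ i) x \<partial>lebesgue_on perf_dom) = 0"
    if K: "K \<in> {block T1, block T2}" for K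
  proof -
    note ez = H1_0_extend_zero[OF U_properties(1,3)[OF K] perf_dom_open perf_bounded admissible(2)[OF K], of j i]
    show "integrable (lebesgue_on perf_dom) (\<lambda>x. indicator (U K) x * weak_partial (U K) j (\<lambda>x. v x $ i) x)"
      by (rule int[OF has_weak_partialD(2)[OF ez(1)]])
    show "(\<integral>x. indicator (U K) x * weak_partial (U K) j (\<lambda>x. v x $ i) x \<partial>lebesgue_on perf_dom) = 0"
      by (rule ez(2))
  qed
  let ?z = "\<lambda>K x. indicator (U K) x * weak_partial (U K) j (\<lambda>x. v x $ i) x"
  have zs: "integrable (lebesgue_on perf_dom) (\<lambda>x. \<Sum>K\<in>{block T1, block T2}. ?z K x)"
    by (rule Bochner_Integration.integrable_sum[OF z(1)])
  have "(\<integral>x. D i j x \<partial>lebesgue_on perf_dom) = (\<integral>x. (if i = d then 1 else 0) * pd j W x \<partial>lebesgue_on perf_dom)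
     + (\<integral>x. (\<Sum>K\<in>{block T1, block T2}. ?z K x) \<partial>lebesgue_on perf_dom)"
    unfolding D_def by (rule Bochner_Integration.integral_add[OF integrable_mult_right[OF i1] zs])
  also have "(\<integral>x. (\<Sum>K\<in>{block T1, block T2}. ?z K x) \<partial>lebesgue_on perf_dom)
      = (\<Sum>K\<in>{block T1, block T2}. \<integral>x. ?z K x \<partial>lebesgue_on perf_dom)"
    by (rule Bochner_Integration.integral_sum[OF z(1)])
  also have "\<dots> = 0" by (rule sum.neutral) (use z(2) in blast)
  finally show ?thesis using W_weak_partial(2) by simp
qed

lemma integral_divergence_zero: "(\<integral>x. divergence perf_dom \<Phi> x \<partial>lebesgue_on perf_dom) = 0"
proof -
  have "AE x in lebesgue_on perf_dom. weak_partial perf_dom i (\<lambda>x. \<Phi> x $ i) x = D i i x" for i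
    by (rule weak_partial_AE_eq[OF perf_dom_open perf_bounded \<Phi>_weak_partial])
  then have "AE x in lebesgue_on perf_dom. \<forall>i\<in>UNIV. weak_partial perf_dom i (\<lambda>x. \<Phi> x $ i) x = D i i x"
    by (intro AE_finite_allI) auto
  then have eq: "AE x in lebesgue_on perf_dom. divergence perf_dom \<Phi> x = (\<Sum>i\<in>UNIV. D i i x)"
    by eventually_elim (simp add: divergence_eq)
  have sD: "square_integrable perf_dom (D i j)" for i j
    by (rule has_weak_partialD(2)[OF \<Phi>_weak_partial])
  have "(\<integral>x. divergence perf_dom \<Phi> x \<partial>lebesgue_on perf_dom) = (\<integral>x. (\<Sum>i\<in>UNIV. D i i x) \<partial>lebesgue_on perf_dom)"
    by (rule integral_cong_AE)
      (use divergence_square_integrable[OF \<Phi>_H1] sD eq in \<open>auto simp: square_integrable_real intro!: borel_measurable_sum\<close>)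
  also have "\<dots> = (\<Sum>i\<in>UNIV. \<integral>x. D i i x \<partial>lebesgue_on perf_dom)"
  proof (rule Bochner_Integration.integral_sum)
    show "integrable (lebesgue_on perf_dom) (D i i)" for i
      using square_integrable_mult_integrable[OF sD has_weak_partialD(1)[OF const_has_weak_partial[OF perf_dom_open perf_bounded, of i 1]], of i i] by simp
  qed
  also have "\<dots> = 0" by (simp add: integral_D)
  finally show ?thesis .
qed

text \<open>The constant value of the divergence of \<open>\<Phi>\<close> on the block \<open>K\<close>.\<close>

definition \<alpha> :: "pt set set \<Rightarrow> real" where
  "\<alpha> K = flux (boundary_edges K) (\<lambda>x. axis d (\<omega> x)) / area K"

lemma AE_subdomain:
  assumes "O' \<subseteq> perf_dom" "O' \<in> sets lebesgue" "AE x in lebesgue_on O'. P x"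
  shows "AE x in lebesgue_on perf_dom. x \<in> O' \<longrightarrow> P x"
proof -
  have "AE x in lebesgue. x \<in> O' \<longrightarrow> P x" using assms(2,3) by (simp add: AE_restrict_space_iff)
  then have "AE x in lebesgue. x \<in> perf_dom \<longrightarrow> x \<in> O' \<longrightarrow> P x" by eventually_elim blast
  then show ?thesis using perf_lebesgue by (simp add: AE_restrict_space_iff)
qed

lemma divergence_AE:
  "AE x in lebesgue_on perf_dom. divergence perf_dom \<Phi> x =
     \<alpha> (block T1) * indicator (U (block T1)) x + \<alpha> (block T2) * indicator (U (block T2)) x"
proof -
  have loc: "AE x in lebesgue_on O'. divergence perf_dom \<Phi> x = divergence O' \<Phi> x"
    if O': "open O'" "O' \<subseteq> perf_dom" for O'
  proof -
    have "AE x in lebesgue_on O'. weak_partial perf_dom i (\<lambda>x. \<Phi> x $ i) x = weak_partial O' i (\<lambda>x. \<Phi> x $ i) x" for i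
    proof -
      have w: "has_weak_partial O' i (\<lambda>x. \<Phi> x $ i) (weak_partial perf_dom i (\<lambda>x. \<Phi> x $ i))"
        by (rule has_weak_partial_subset[OF O'(2,1) perf_dom_open H1_has_weak_partial[OF \<Phi>_H1]])
      show ?thesis
        using weak_partial_AE_eq[OF O'(1) bounded_subset[OF perf_bounded O'(2)] w] by eventually_elim simp
    qed
    then have "AE x in lebesgue_on O'. \<forall>i\<in>UNIV. weak_partial perf_dom i (\<lambda>x. \<Phi> x $ i) x = weak_partial O' i (\<lambda>x. \<Phi> x $ i) x"
      by (intro AE_finite_allI) auto
    then show ?thesis by eventually_elim (simp add: divergence_eq)
  qed
  have onK: "AE x in lebesgue_on perf_dom. x \<in> U K \<longrightarrow> divergence perf_dom \<Phi> x = \<alpha> K"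
    if K: "K \<in> {block T1, block T2}" for K
  proof (rule AE_subdomain[OF U_properties(3,4)[OF K]])
    show "AE x in lebesgue_on (U K). divergence perf_dom \<Phi> x = \<alpha> K"
      using loc[OF U_properties(1,3)[OF K]] admissible(3)[OF K] unfolding \<alpha>_def by eventually_elim simp
  qed
  define O' where "O' = perf_dom - \<Union>(nbhd (edge_set e))"
  have O': "open O'" "O' \<subseteq> perf_dom"
    unfolding O'_def using perf_dom_open closed_Union_fine[OF nbhd_subset] by (auto intro: open_Diff)
  have off: "AE x in lebesgue_on perf_dom. x \<in> O' \<longrightarrow> divergence perf_dom \<Phi> x = 0"
  proof (rule AE_subdomain[OF O'(2) open_in_sets_lebesgue[OF O'(1)]])
    note b = bounded_subset[OF perf_bounded O'(2)]
    have z: "has_weak_partial O' i (\<lambda>x. \<Phi> x $ i) (\<lambda>x. 0)" for i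
    proof (rule has_weak_partial_cong_AE[OF O'(1) has_weak_partial_zero])
      show "AE x in lebesgue_on O'. 0 = \<Phi> x $ i"
        using \<Phi>_off by (intro AE_I2) (auto simp: O'_def)
    qed simp
    have "AE x in lebesgue_on O'. weak_partial O' i (\<lambda>x. \<Phi> x $ i) x = 0" for i
      by (rule weak_partial_AE_eq[OF O'(1) b z])
    then have "AE x in lebesgue_on O'. \<forall>i\<in>UNIV. weak_partial O' i (\<lambda>x. \<Phi> x $ i) x = 0"
      by (intro AE_finite_allI) auto
    then show "AE x in lebesgue_on O'. divergence perf_dom \<Phi> x = 0"
      using loc[OF O'] by eventually_elim (simp add: divergence_eq)
  qed
  have cover: "AE x in lebesgue_on perf_dom. x \<in> perf_dom \<longrightarrow> x \<in> U (block T1) \<or> x \<in> U (block T2) \<or> x \<in> O'"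
  proof (rule AE_in_fine_interior)
    fix x t assume t: "t \<in> \<T>h" "x \<in> interior t"
    show "x \<in> perf_dom \<longrightarrow> x \<in> U (block T1) \<or> x \<in> U (block T2) \<or> x \<in> O'"
      using fine_interior_block[OF t K12(2)[of "block T1"]] fine_interior_block[OF t K12(2)[of "block T2"]]
      unfolding O'_def nbhd_edge_set by blast
  qed
  have inP: "AE x in lebesgue_on perf_dom. x \<in> perf_dom" by (rule AE_I2) simp
  have disj: "U (block T1) \<inter> U (block T2) = {}"
    using open_block_interior_disjoint[OF K12(2) K12(2) K12(1)] by blast
  have offU: "x \<notin> U K" if "x \<in> O'" "K \<in> {block T1, block T2}" for x K
    using that interior_subset unfolding O'_def nbhd_edge_set by blast
  show ?thesis
    using onK[of "block T1", simplified] onK[of "block T2", simplified] off cover inP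
  proof eventually_elim
    case (elim x)
    then consider "x \<in> U (block T1)" | "x \<in> U (block T2)" | "x \<in> O'" by blast
    then show ?case
    proof cases
      case 1
      then have "x \<notin> U (block T2)" using disj by blast
      then show ?thesis using elim(1) 1 by simp
    next
      case 2
      then have "x \<notin> U (block T1)" using disj by blast
      then show ?thesis using elim(2) 2 by simp
    next
      case 3
      then show ?thesis using elim(3) offU[OF 3] by auto
    qed
  qed
qed

text \<open>Both \<open>\<Phi> - g\<close> and \<open>\<Phi> - axis d \<omega>\<close> are in \<open>H1_0\<close> of the block. The continuous function \<open>g - axis d \<omega>\<close> thus
  satisfies integration by parts without boundary term and vanishes on the boundary edges.\<close>

lemma boundary_values_agree:
  assumes tf: "(t, f) \<in> boundary_edges K0" and x: "x \<in> f"
  shows "g x = axis d (\<omega> x)"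
proof -
  note Up = U_properties[OF K0]
  have t: "t \<in> K0" "1 simplex f" "f face_of t" and uniq: "\<And>t'. t' \<in> K0 \<Longrightarrow> f \<subseteq> t' \<Longrightarrow> t' = t"
    using tf by (auto simp: boundary_edges_def mesh_edges_def)
  have tT: "t \<in> \<T>h" using t(1) Up(5) by blast
  have ft: "f \<subseteq> t" using t(3) by (rule face_of_imp_subset)
  note tp = triangle_properties[OF fine_triangle[OF tT]]
  have gc: "continuous_on (\<Union>K0) g" "(\<lambda>x. \<Phi> x - g x) \<in> H1_0 (U K0)"
    using g(1) by (simp_all add: has_trace_def)
  have wc: "continuous_on (\<Union>K0) (\<lambda>x. axis d (\<omega> x))"
    using minimizer[OF K0] by (simp add: stokes_minimizer_def stokes_admissible_def has_trace_def)
  have tK: "t \<subseteq> \<Union>K0" using t(1) by blast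
  have rel: "g x $ i = axis d (\<omega> x) $ i" if x0: "x \<in> rel_interior f" for x i
  proof -
    define h where "h y = g y $ i - axis d (\<omega> y) $ i" for y
    define \<gamma> where "\<gamma> j y = weak_partial (U K0) j (\<lambda>y. v y $ i) y - weak_partial (U K0) j (\<lambda>y. (\<Phi> y - g y) $ i) y" for j y
    have xf: "x \<in> f" using x0 rel_interior_subset by blast
    have xt: "x \<in> t" using xf ft by blast
    have "f \<noteq> t" using aff_dim_simplex[OF t(2)] tp(7) by auto
    then have "x \<notin> rel_interior t" using face_of_disjoint_rel_interior[OF t(3)] xf by blast
    then obtain \<nu> where \<nu>: "\<nu> \<noteq> 0" "\<And>y. y \<in> t \<Longrightarrow> \<nu> \<bullet> x \<le> \<nu> \<bullet> y"
      using supporting_hyperplane_rel_boundary[OF tp(3) xt] by metis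
    have "x \<notin> \<Union>(K0 - {t})"
    proof
      assume "x \<in> \<Union>(K0 - {t})"
      then obtain t' where t': "t' \<in> K0" "t' \<noteq> t" "x \<in> t'" by blast
      have "f \<subseteq> t'"
        using edge_subset_if_relint_point(1)[OF meshes(2) tT _ t(3) x0 t'(3)] t'(1) Up(5) by blast
      then show False using uniq t' by blast
    qed
    moreover have "open (- \<Union>(K0 - {t}))"
      using closed_Union_fine[of "K0 - {t}"] Up(5) by (intro open_Compl) blast
    ultimately obtain r where r: "r > 0" "ball x r \<subseteq> - \<Union>(K0 - {t})"
      using open_contains_ball by blast
    have vH: "v \<in> H1 (U K0)" and gH: "(\<lambda>x. \<Phi> x - g x) \<in> H1 (U K0)"
      using admissible(2)[OF K0] gc(2) by (simp_all add: H1_0_def)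
    note wv = H1_has_weak_partial[OF vH, of _ i] and wg = H1_has_weak_partial[OF gH, of _ i]
    have h_eq: "h = (\<lambda>y. v y $ i + (- 1) * (\<Phi> y - g y) $ i)"
      by (simp add: h_def v_def fun_eq_iff)
    have "h x = 0"
    proof (rule continuous_vanishes_at_boundary_point[OF Up(1,2) tp(3,4), where \<nu> = "- \<nu>" and r = r and \<gamma> = \<gamma>])
      show "interior t \<subseteq> U K0" using tK by (rule interior_mono)
      show "x \<in> t" by (rule xt)
      show "- \<nu> \<noteq> 0" using \<nu>(1) by simp
      show "- \<nu> \<bullet> (y - x) \<le> 0" if "y \<in> t" for y using \<nu>(2)[OF that] by (simp add: inner_diff_right)
      show "r > 0" by (rule r(1))
      show "ball x r \<inter> U K0 \<subseteq> t"
      proof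
        fix z assume z: "z \<in> ball x r \<inter> U K0"
        then obtain t' where "t' \<in> K0" "z \<in> t'" using interior_subset by blast
        then show "z \<in> t" using z r(2) by blast
      qed
      have "continuous_on (\<Union>K0) h"
        unfolding h_def by (intro continuous_on_diff continuous_on_component gc(1) wc)
      then show "continuous_on t h" by (rule continuous_on_subset[OF _ tK])
      show "square_integrable (U K0) h"
        unfolding h_eq
        by (intro square_integrable_add square_integrable_cmult has_weak_partialD(1)[OF wv] has_weak_partialD(1)[OF wg])
      have "\<gamma> j = (\<lambda>y. weak_partial (U K0) j (\<lambda>y. v y $ i) y + (- 1) * weak_partial (U K0) j (\<lambda>y. (\<Phi> y - g y) $ i) y)" for j
        by (simp add: \<gamma>_def fun_eq_iff)
      then show "square_integrable (U K0) (\<gamma> j)" for j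
        by (simp only:) (intro square_integrable_add square_integrable_cmult has_weak_partialD(2)[OF wv] has_weak_partialD(2)[OF wg])
      fix j :: 2 and s :: real assume s: "s > 0"
      have \<psi>: "has_weak_partial (U K0) j (cutoff x s) (pd j (cutoff x s))"
      proof (rule lipschitz_imp_has_weak_partial[OF Up(1,2) cutoff_lipschitz[OF s]])
        show "\<bar>cutoff x s y\<bar> \<le> 1" for y using cutoff_bounds(1,2)[OF s, of x y] by simp
        show "AE y in lebesgue. cutoff x s differentiable (at y)"
          using cutoff_has_derivative differentiable_def by (intro AE_I2) blast
      qed
      note ib = H1_0_integration_by_parts[OF Up(1,2) admissible(2)[OF K0] \<psi>, of i]
        H1_0_integration_by_parts[OF Up(1,2) gc(2) \<psi>, of i]
      note sq = has_weak_partialD(1,2)[OF \<psi>]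
      note in1 = square_integrable_mult_integrable[OF has_weak_partialD(2)[OF wv[of j]] sq(1)]
        square_integrable_mult_integrable[OF has_weak_partialD(2)[OF wg[of j]] sq(1)]
        square_integrable_mult_integrable[OF has_weak_partialD(1)[OF wv[of j]] sq(2)]
        square_integrable_mult_integrable[OF has_weak_partialD(1)[OF wg[of j]] sq(2)]
      have "(\<integral>y. \<gamma> j y * cutoff x s y \<partial>lebesgue_on (U K0))
        = (\<integral>y. weak_partial (U K0) j (\<lambda>y. v y $ i) y * cutoff x s y \<partial>lebesgue_on (U K0))
         - (\<integral>y. weak_partial (U K0) j (\<lambda>y. (\<Phi> y - g y) $ i) y * cutoff x s y \<partial>lebesgue_on (U K0))"
        unfolding \<gamma>_def left_diff_distrib by (rule Bochner_Integration.integral_diff[OF in1(1,2)])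
      also have "\<dots> = - ((\<integral>y. v y $ i * pd j (cutoff x s) y \<partial>lebesgue_on (U K0))
         - (\<integral>y. (\<Phi> y - g y) $ i * pd j (cutoff x s) y \<partial>lebesgue_on (U K0)))"
        unfolding ib by simp
      also have "(\<integral>y. v y $ i * pd j (cutoff x s) y \<partial>lebesgue_on (U K0))
         - (\<integral>y. (\<Phi> y - g y) $ i * pd j (cutoff x s) y \<partial>lebesgue_on (U K0))
         = (\<integral>y. v y $ i * pd j (cutoff x s) y - (\<Phi> y - g y) $ i * pd j (cutoff x s) y \<partial>lebesgue_on (U K0))"
        by (rule Bochner_Integration.integral_diff[OF in1(3,4), symmetric])
      also have "\<dots> = (\<integral>y. h y * pd j (cutoff x s) y \<partial>lebesgue_on (U K0))"
        unfolding h_eq by (simp add: algebra_simps)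
      finally show "(\<integral>y. \<gamma> j y * cutoff x s y \<partial>lebesgue_on (U K0))
        = - (\<integral>y. h y * pd j (cutoff x s) y \<partial>lebesgue_on (U K0))" .
    qed
    then show ?thesis by (simp add: h_def)
  qed
  have cl: "closure (rel_interior f) = f"
  proof -
    obtain a b where "f = closed_segment a b" using edge_segment[OF t(2)] by metis
    then show ?thesis by (simp add: convex_closure_rel_interior)
  qed
  have "g x $ i - axis d (\<omega> x) $ i = 0" for i
  proof (rule continuous_zero_on_closure[of "rel_interior f" "\<lambda>x. g x $ i - axis d (\<omega> x) $ i" x])
    have "continuous_on (\<Union>K0) (\<lambda>x. g x $ i - axis d (\<omega> x) $ i)"
      by (intro continuous_on_diff continuous_on_component gc(1) wc)
    then show "continuous_on (closure (rel_interior f)) (\<lambda>x. g x $ i - axis d (\<omega> x) $ i)"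
      unfolding cl by (rule continuous_on_subset) (use ft tK in blast)
  qed (use rel x cl in auto)
  then show ?thesis by (simp add: vec_eq_iff)
qed

text \<open>The total flux of the boundary data out of \<open>K0\<close> passes through the coarse edge, where the data have the
  values of \<open>g\<close>.\<close>

lemma \<alpha>_nonzero: "\<alpha> K0 \<noteq> 0"
proof -
  note Up = U_properties[OF K0]
  let ?w = "\<lambda>x. axis d (\<omega> x) :: pt"
  let ?S = "{(t, f) \<in> boundary_edges K0. f \<subseteq> edge_set e}"
  obtain T0 where T0: "T0 \<in> {T1, T2}" "K0 = block T0" using K0 by blast
  have fin: "finite (boundary_edges K0)"
  proof (rule finite_boundary_edges)
    show "finite K0" using Up(5) meshes_finite(2) by (rule finite_subset)
    show "2 simplex t" if "t \<in> K0" for t using that Up(5) fine_triangle by blast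
  qed
  have "flux (boundary_edges K0) ?w = flux ?S ?w"
    unfolding flux_def
  proof (rule sum.mono_neutral_right[OF fin])
    show "\<forall>z\<in>boundary_edges K0 - ?S. (case z of (t, f) \<Rightarrow> edge_integral f (\<lambda>x. ?w x \<bullet> outer_normal t f)) = 0"
    proof (rule ballI)
      fix z assume z: "z \<in> boundary_edges K0 - ?S"
      obtain t f where ztf: "z = (t, f)" by (cases z)
      have tf: "(t, f) \<in> boundary_edges K0" and "\<not> f \<subseteq> edge_set e" using z ztf by auto
      then have "\<omega> x = 0" if "x \<in> f" for x
        using \<omega>_zero_on_other_boundary_edges[OF T0(1), of t f] that T0(2) by blast
      moreover have "1 simplex f" using tf by (auto simp: boundary_edges_def mesh_edges_def)
      ultimately have "edge_integral f (\<lambda>x. ?w x \<bullet> outer_normal t f) = 0"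
        by (intro edge_integral_zero) (simp_all add: axis_def vec_eq_iff inner_vec_def)
      then show "(case z of (t, f) \<Rightarrow> edge_integral f (\<lambda>x. ?w x \<bullet> outer_normal t f)) = 0"
        by (simp add: ztf)
    qed
  qed auto
  also have "\<dots> = flux ?S g"
    unfolding flux_def
  proof (rule sum.cong[OF refl], clarify)
    fix t f assume "(t, f) \<in> boundary_edges K0"
    then show "edge_integral f (\<lambda>x. ?w x \<bullet> outer_normal t f) = edge_integral f (\<lambda>x. g x \<bullet> outer_normal t f)"
      using boundary_values_agree by (intro edge_integral_cong) simp
  qed
  finally have "flux (boundary_edges K0) ?w \<noteq> 0" using g(2) by simp
  moreover have "area K0 > 0"
  proof -
    have "measure lebesgue (U K0) \<le> measure lebesgue (\<Union>K0)"
      using lmeasurable_compact[OF compact_Union_fine[OF Up(5)]] Up(4)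
      by (intro measure_mono_fmeasurable interior_subset)
    then show ?thesis using Up(8) by linarith
  qed
  ultimately show ?thesis by (simp add: \<alpha>_def)
qed

text \<open>The divergence of \<open>\<Phi>\<close> is constant on each of the two blocks and integrates to zero, so it measures
  the jump of a piecewise constant function across the edge.\<close>

lemma divergence_measures_jump:
  "\<exists>\<beta>. \<beta> \<noteq> 0 \<and> (\<forall>p c1 c2. square_integrable perf_dom p \<longrightarrow> (\<forall>x\<in>U (block T1). p x = c1) \<longrightarrow>
     (\<forall>x\<in>U (block T2). p x = c2) \<longrightarrow>
     (\<integral>x. divergence perf_dom \<Phi> x * p x \<partial>lebesgue_on perf_dom) = \<beta> * (c1 - c2))"
proof -
  let ?U1 = "U (block T1)" and ?U2 = "U (block T2)"
  define m1 m2 where "m1 = \<alpha> (block T1) * measure lebesgue ?U1" and "m2 = \<alpha> (block T2) * measure lebesgue ?U2"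
  note P1 = U_properties[of "block T1", simplified] and P2 = U_properties[of "block T2", simplified]
  have I: "integrable (lebesgue_on perf_dom) (indicator (U K) :: pt \<Rightarrow> real)"
    "(\<integral>x. indicator (U K) x \<partial>lebesgue_on perf_dom) = measure lebesgue (U K)"
    if K: "K \<in> {block T1, block T2}" for K
  proof -
    note P = U_properties[OF K]
    have "square_integrable perf_dom (indicator (U K) :: pt \<Rightarrow> real)"
      by (rule square_integrable_indicator[OF perf_lebesgue P(7)])
    from square_integrable_mult_integrable[OF this has_weak_partialD(1)[OF const_has_weak_partial[OF perf_dom_open perf_bounded, of 1 1]]]
    show "integrable (lebesgue_on perf_dom) (indicator (U K) :: pt \<Rightarrow> real)" by simp
    show "(\<integral>x. indicator (U K) x \<partial>lebesgue_on perf_dom) = measure lebesgue (U K)"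
      using integral_indicator_on_subset[OF P(3,4) perf_lebesgue, of "\<lambda>_. 1"] P(4)
      by (simp add: measure_restrict_space)
  qed
  have val: "(\<integral>x. divergence perf_dom \<Phi> x * p x \<partial>lebesgue_on perf_dom) = m1 * c1 + m2 * c2"
    if p: "square_integrable perf_dom p" "\<forall>x\<in>?U1. p x = c1" "\<forall>x\<in>?U2. p x = c2" for p c1 c2
  proof -
    let ?f = "\<lambda>x. (\<alpha> (block T1) * c1) * indicator ?U1 x + (\<alpha> (block T2) * c2) * indicator ?U2 x"
    have i1: "integrable (lebesgue_on perf_dom) (\<lambda>x. (\<alpha> (block T1) * c1) * indicator ?U1 x)"
      and i2: "integrable (lebesgue_on perf_dom) (\<lambda>x. (\<alpha> (block T2) * c2) * indicator ?U2 x)"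
      using I(1)[of "block T1"] I(1)[of "block T2"] by (intro integrable_mult_right; simp)+
    have "(\<integral>x. divergence perf_dom \<Phi> x * p x \<partial>lebesgue_on perf_dom) = (\<integral>x. ?f x \<partial>lebesgue_on perf_dom)"
    proof (rule integral_cong_AE)
      show "AE x in lebesgue_on perf_dom. divergence perf_dom \<Phi> x * p x = ?f x"
        using divergence_AE
      proof eventually_elim
        case (elim x)
        show ?case unfolding elim using p(2,3) by (cases "x \<in> ?U1"; cases "x \<in> ?U2") (auto simp: distrib_right)
      qed
      show "(\<lambda>x. divergence perf_dom \<Phi> x * p x) \<in> borel_measurable (lebesgue_on perf_dom)"
        using divergence_square_integrable[OF \<Phi>_H1] p(1)
        by (intro borel_measurable_times) (simp_all add: square_integrable_real)
      show "?f \<in> borel_measurable (lebesgue_on perf_dom)"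
        using borel_measurable_integrable[OF i1] borel_measurable_integrable[OF i2] by (rule borel_measurable_add)
    qed
    also have "\<dots> = (\<alpha> (block T1) * c1) * measure lebesgue ?U1 + (\<alpha> (block T2) * c2) * measure lebesgue ?U2"
      using Bochner_Integration.integral_add[OF i1 i2] I(2)[of "block T1"] I(2)[of "block T2"] by simp
    finally show ?thesis by (simp add: m1_def m2_def algebra_simps)
  qed
  have "(\<integral>x. divergence perf_dom \<Phi> x * 1 \<partial>lebesgue_on perf_dom) = m1 * 1 + m2 * 1"
    by (rule val) (use has_weak_partialD(1)[OF const_has_weak_partial[OF perf_dom_open perf_bounded, of 1 1]] in auto)
  then have sum: "m2 = - m1" using integral_divergence_zero by simp
  have "m1 \<noteq> 0"
  proof -
    have "\<alpha> K0 * measure lebesgue (U K0) \<noteq> 0" using \<alpha>_nonzero U_properties(8)[OF K0] by simp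
    then show ?thesis using K0 sum by (auto simp: m1_def m2_def)
  qed
  moreover have "m1 * c1 + m2 * c2 = m1 * (c1 - c2)" for c1 c2 using sum by (simp add: algebra_simps)
  ultimately show ?thesis using val by (intro exI[of _ m1]) auto
qed

end

section \<open>Piecewise constant functions without jumps\<close>

lemma AE_ball_const_unique:
  assumes "r > (0::real)" "AE z in lebesgue. z \<in> ball (x::pt) r \<longrightarrow> p z = k" "AE z in lebesgue. z \<in> ball x r \<longrightarrow> p z = k'"
  shows "k = k'"
proof (rule ccontr)
  assume ne: "k \<noteq> k'"
  have "AE z in lebesgue. z \<notin> ball x r"
    using assms(2,3) by eventually_elim (use ne in blast)
  then have "ball x r \<in> null_sets lebesgue" by (subst AE_iff_null_sets) auto
  then have "negligible (ball x r)" by (simp add: negligible_iff_null_sets)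
  then show False using open_not_negligible[of "ball x r"] assms(1) by auto
qed

context perforated_grid begin

definition jump_free :: "(pt \<Rightarrow> real) \<Rightarrow> (pt set \<Rightarrow> real) \<Rightarrow> bool" where
  "jump_free p c \<longleftrightarrow> (\<forall>T\<in>\<T>H. \<forall>x\<in>interior (\<Union>(block T)). p x = c T) \<and>
     (\<forall>T1\<in>\<T>H. \<forall>T2\<in>\<T>H. \<forall>e y. T1 \<noteq> T2 \<and> e face_of T1 \<and> e face_of T2 \<and> 1 simplex e \<and>
        y \<in> rel_interior e \<and> G y \<in> perf_dom \<longrightarrow> c T1 = c T2)"

lemma jump_freeD:
  assumes "jump_free p c"
  shows "\<And>T x. T \<in> \<T>H \<Longrightarrow> x \<in> interior (\<Union>(block T)) \<Longrightarrow> p x = c T"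
    and "\<And>e T1 T2 y. T1 \<in> \<T>H \<Longrightarrow> T2 \<in> \<T>H \<Longrightarrow> T1 \<noteq> T2 \<Longrightarrow> e face_of T1 \<Longrightarrow> e face_of T2 \<Longrightarrow>
      1 simplex e \<Longrightarrow> y \<in> rel_interior e \<Longrightarrow> G y \<in> perf_dom \<Longrightarrow> c T1 = c T2"
  using assms unfolding jump_free_def by blast+

text \<open>Around a point of the domain that is not the image of a coarse vertex, only blocks meeting in the
  interior of a common coarse edge matter, and their values agree; the finitely many vertices are then
  filled in because punctured discs are connected.\<close>

lemma AE_const_near_nonvertex:
  assumes jf: "jump_free p c"
    and x: "x \<in> perf_dom" "x \<notin> G ` mesh_vertices \<T>H"
  shows "\<exists>r>0. \<exists>k. ball x r \<subseteq> perf_dom \<and> (AE z in lebesgue. z \<in> ball x r \<longrightarrow> p z = k)"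
proof -
  note p = jump_freeD(1)[OF jf] and jump = jump_freeD(2)[OF jf]
  obtain y where y: "x = G y" using G_surj by blast
  have eq: "c T = c T'" if T: "T \<in> \<T>H" "T' \<in> \<T>H" "y \<in> T" "y \<in> T'" for T T'
  proof (cases "T = T'")
    case False
    have tri: "2 simplex T" using coarse_triangle[OF T(1)] .
    have "y \<notin> interior T" using triangles_disjoint_interior[OF meshes(1) T(1,2) False] T(4) by blast
    then obtain e where e: "1 simplex e" "e face_of T" "y \<in> e"
      using triangle_boundary_point_on_edge[OF tri T(3)] by metis
    have yr: "y \<in> rel_interior e"
    proof (rule ccontr)
      assume "y \<notin> rel_interior e"
      obtain a b where ab: "a \<noteq> b" "e = closed_segment a b" using edge_segment[OF e(1)] by metis
      then have "y = a \<or> y = b"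
        using e(3) \<open>y \<notin> rel_interior e\<close> by (auto simp: rel_interior_closed_segment open_segment_def)
      then have "y extreme_point_of e" using ab(2) by (simp add: extreme_point_of_segment)
      then have "y extreme_point_of T"
        using e(2) by (metis face_of_singleton face_of_trans)
      then have "y \<in> mesh_vertices \<T>H" using T(1) by (auto simp: mesh_vertices_def)
      then show False using x(2) y by blast
    qed
    have "e face_of T'" using edge_subset_if_relint_point(2)[OF meshes(1) T(1,2) e(2) yr T(4)] .
    then show ?thesis using jump[OF T(1,2) False e(2) _ e(1) yr] x(1) y by blast
  qed simp
  obtain T0 where T0: "T0 \<in> \<T>H" "y \<in> T0" using coarse_cover(1) x(1) y G_mem by blast
  let ?O = "perf_dom \<inter> - \<Union>((\<lambda>T. G ` T) ` {T \<in> \<T>H. y \<notin> T})"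
  have "closed (\<Union>((\<lambda>T. G ` T) ` {T \<in> \<T>H. y \<notin> T}))"
    using meshes_finite(1) coarse_triangle triangle_properties(2) G_closed by (intro closed_Union) auto
  then have "open ?O" using perf_dom_open by (intro open_Int open_Compl)
  moreover have "x \<in> ?O" using x(1) y G_mem by auto
  ultimately obtain r where r: "r > 0" "ball x r \<subseteq> ?O" by (rule openE)
  have "AE z in lebesgue. \<forall>t\<in>\<T>h. z \<notin> frontier t"
    by (rule AE_not_in_triangle_frontiers) (use meshes_finite fine_triangle in auto)
  then have "AE z in lebesgue. z \<in> ball x r \<longrightarrow> p z = c T0"
  proof eventually_elim
    case (elim z)
    show ?case
    proof
      assume z: "z \<in> ball x r"
      then have "z \<in> perf_dom" using r(2) by blast
      then obtain t where t: "t \<in> \<T>h" "z \<in> t" using perf_dom_subset_fine by blast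
      then have zi: "z \<in> interior t" using elim closure_subset[of t] by (auto simp: frontier_def)
      obtain T where T: "T \<in> \<T>H" "t \<subseteq> G ` T" using refinement t(1) by blast
      have "y \<in> T"
      proof (rule ccontr)
        assume "y \<notin> T"
        then have "G ` T \<in> (\<lambda>T. G ` T) ` {T \<in> \<T>H. y \<notin> T}" using T(1) by (intro imageI) simp
        then have "z \<in> \<Union>((\<lambda>T. G ` T) ` {T \<in> \<T>H. y \<notin> T})"
          by (rule UnionI) (rule subsetD[OF T(2) t(2)])
        moreover have "z \<in> ?O" by (rule subsetD[OF r(2) z])
        ultimately show False by (simp only: Int_iff Compl_iff not_True_eq_False simp_thms)
      qed
      then have "c T = c T0" using eq T(1) T0 by blast
      moreover have "t \<in> block T" using t(1) T(2) by (simp add: block_def)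
      then have "z \<in> interior (\<Union>(block T))" using zi interior_mono[of t "\<Union>(block T)"] by blast
      ultimately show "p z = c T0" using p[OF T(1)] by simp
    qed
  qed
  then show ?thesis using r by blast
qed

lemma AE_locally_const:
  assumes jf: "jump_free p c"
    and x: "x \<in> perf_dom"
  shows "\<exists>r>0. \<exists>k. ball x r \<subseteq> perf_dom \<and> (AE z in lebesgue. z \<in> ball x r \<longrightarrow> p z = k)"
proof (cases "x \<in> G ` mesh_vertices \<T>H")
  case False
  show ?thesis by (rule AE_const_near_nonvertex[OF jf x False])
next
  case True
  note p = jump_freeD(1)[OF jf]
  define N where "N = G ` mesh_vertices \<T>H"
  have fN: "finite N" using finite_mesh_vertices[OF meshes(1)] by (simp add: N_def)
  define O1 where "O1 = perf_dom - (N - {x})"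
  have "open O1" unfolding O1_def using fN perf_dom_open by (intro open_Diff finite_imp_closed) auto
  then obtain r where r: "r > 0" "ball x r \<subseteq> O1"
    by (rule openE[of O1 x]) (use x in \<open>auto simp: O1_def\<close>)
  let ?P = "ball x r - {x}"
  have ex: "\<exists>\<rho>>0. \<exists>k. ball z \<rho> \<subseteq> ?P \<and> (AE w in lebesgue. w \<in> ball z \<rho> \<longrightarrow> p w = k)" if z: "z \<in> ?P" for z
  proof -
    have "z \<in> perf_dom" "z \<notin> N" using z r(2) by (auto simp: O1_def)
    then obtain \<rho> k where \<rho>: "\<rho> > 0" "AE w in lebesgue. w \<in> ball z \<rho> \<longrightarrow> p w = k"
      using AE_const_near_nonvertex[OF jf, of z] unfolding N_def by blast
    have "open ?P" by (intro open_Diff) auto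
    then obtain \<rho>' where \<rho>': "\<rho>' > 0" "ball z \<rho>' \<subseteq> ?P" using z by (rule openE)
    let ?m = "min \<rho> \<rho>'"
    have "AE w in lebesgue. w \<in> ball z ?m \<longrightarrow> p w = k" using \<rho>(2) by eventually_elim auto
    moreover have "ball z ?m \<subseteq> ?P" using \<rho>'(2) by auto
    moreover have "?m > 0" using \<rho>(1) \<rho>'(1) by simp
    ultimately show ?thesis by blast
  qed
  define R where "R z s a \<longleftrightarrow> s > 0 \<and> ball z s \<subseteq> ?P \<and> (AE w in lebesgue. w \<in> ball z s \<longrightarrow> p w = a)" for z s a
  have "\<forall>z\<in>?P. \<exists>s a. R z s a" using ex unfolding R_def by blast
  then obtain \<rho> k where R: "\<And>z. z \<in> ?P \<Longrightarrow> R z (\<rho> z) (k z)" by metis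
  have \<rho>: "\<And>z. z \<in> ?P \<Longrightarrow> \<rho> z > 0" "\<And>z. z \<in> ?P \<Longrightarrow> ball z (\<rho> z) \<subseteq> ?P"
    "\<And>z. z \<in> ?P \<Longrightarrow> AE w in lebesgue. w \<in> ball z (\<rho> z) \<longrightarrow> p w = k z"
    using R unfolding R_def by blast+
  have loc: "k w = k z" if z: "z \<in> ?P" and w: "w \<in> ball z (\<rho> z)" for z w
  proof -
    have wP: "w \<in> ?P" using \<rho>(2)[OF z] w by blast
    obtain s where s: "s > 0" "ball w s \<subseteq> ball z (\<rho> z) \<inter> ball w (\<rho> w)"
      by (rule openE[of "ball z (\<rho> z) \<inter> ball w (\<rho> w)" w]) (use w \<rho>(1)[OF wP] in auto)
    show ?thesis
    proof (rule AE_ball_const_unique[OF s(1)])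
      show "AE u in lebesgue. u \<in> ball w s \<longrightarrow> p u = k w"
        using \<rho>(3)[OF wP] by eventually_elim (use s(2) in blast)
      show "AE u in lebesgue. u \<in> ball w s \<longrightarrow> p u = k z"
        using \<rho>(3)[OF z] by eventually_elim (use s(2) in blast)
    qed
  qed
  have conn: "connected ?P" by (rule connected_punctured_ball) simp
  have "k constant_on ?P"
  proof (rule locally_constant_imp_constant[OF conn])
    fix z assume z: "z \<in> ?P"
    have op: "openin (top_of_set ?P) (ball z (\<rho> z))"
      by (rule open_subset[OF \<rho>(2)[OF z] open_ball])
    show "\<exists>Q. openin (top_of_set ?P) Q \<and> z \<in> Q \<and> (\<forall>w\<in>Q. k w = k z)"
    proof (intro exI[of _ "ball z (\<rho> z)"] conjI ballI)
      show "openin (top_of_set ?P) (ball z (\<rho> z))" by (rule op)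
      show "z \<in> ball z (\<rho> z)" using \<rho>(1)[OF z] by simp
      show "k w = k z" if "w \<in> ball z (\<rho> z)" for w using loc[OF z that] .
    qed
  qed
  then obtain k0 where k0: "\<And>z. z \<in> ?P \<Longrightarrow> k z = k0" unfolding constant_on_def by blast
  have "AE z in lebesgue. \<forall>t\<in>\<T>h. z \<notin> frontier t"
    by (rule AE_not_in_triangle_frontiers) (use meshes_finite fine_triangle in auto)
  moreover have "AE z in lebesgue. z \<noteq> x"
    using AE_not_in[of "{x}" lebesgue] by (simp flip: negligible_iff_null_sets)
  ultimately have "AE z in lebesgue. z \<in> ball x r \<longrightarrow> p z = k0"
  proof eventually_elim
    case (elim z)
    show ?case
    proof
      assume z: "z \<in> ball x r"
      then have zP: "z \<in> ?P" using elim(2) by blast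
      have "z \<in> perf_dom" using z r(2) by (auto simp: O1_def)
      then obtain t where t: "t \<in> \<T>h" "z \<in> t" using perf_dom_subset_fine by blast
      then have zi: "z \<in> interior t" using elim(1) closure_subset[of t] by (auto simp: frontier_def)
      obtain T where T: "T \<in> \<T>H" "t \<subseteq> G ` T" using refinement t(1) by blast
      have "t \<in> block T" using t(1) T(2) by (simp add: block_def)
      then have tK: "interior t \<subseteq> interior (\<Union>(block T))" by (intro interior_mono) auto
      obtain s where s: "s > 0" "ball z s \<subseteq> interior t \<inter> ball z (\<rho> z)"
        by (rule openE[of "interior t \<inter> ball z (\<rho> z)" z]) (use zi \<rho>(1)[OF zP] in auto)
      have "c T = k z"
      proof (rule AE_ball_const_unique[OF s(1)])
        show "AE u in lebesgue. u \<in> ball z s \<longrightarrow> p u = c T"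
          using s(2) tK p[OF T(1)] by (intro AE_I2) blast
        show "AE u in lebesgue. u \<in> ball z s \<longrightarrow> p u = k z"
          using \<rho>(3)[OF zP] by eventually_elim (use s(2) in blast)
      qed
      then show "p z = k0" using k0[OF zP] p[OF T(1)] zi tK by auto
    qed
  qed
  moreover have "ball x r \<subseteq> perf_dom" using r(2) by (auto simp: O1_def)
  ultimately show ?thesis using r(1) by blast
qed

text \<open>Up to a null set, \<open>p\<close> is locally constant, so its product with a test function is smooth with compact
  support and the integral of its derivatives vanishes.\<close>

lemma jump_free_weak_partial:
  assumes jf: "jump_free p c"
    and sq: "square_integrable perf_dom p"
  shows "has_weak_partial perf_dom j p (\<lambda>x. 0)"
  unfolding has_weak_partial_def
proof (intro conjI ballI sq square_integrable_zero)
  note p = jump_freeD(1)[OF jf]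
  have sP: "perf_dom \<in> sets lebesgue" using perf_dom_open by (rule open_in_sets_lebesgue)
  define R where "R z s a \<longleftrightarrow> s > 0 \<and> ball z s \<subseteq> perf_dom \<and> (AE w in lebesgue. w \<in> ball z s \<longrightarrow> p w = a)" for z s a
  have "\<forall>z\<in>perf_dom. \<exists>s a. R z s a" using AE_locally_const[OF jf] unfolding R_def by blast
  then obtain r k where R: "\<And>z. z \<in> perf_dom \<Longrightarrow> R z (r z) (k z)" by metis
  have r: "\<And>x. x \<in> perf_dom \<Longrightarrow> r x > 0" "\<And>x. x \<in> perf_dom \<Longrightarrow> ball x (r x) \<subseteq> perf_dom"
    and k: "\<And>x. x \<in> perf_dom \<Longrightarrow> AE z in lebesgue. z \<in> ball x (r x) \<longrightarrow> p z = k x"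
    using R unfolding R_def by blast+
  have loc: "k w = k z" if z: "z \<in> perf_dom" and w: "w \<in> ball z (r z)" for z w
  proof -
    have wP: "w \<in> perf_dom" using r(2)[OF z] w by blast
    obtain s where s: "s > 0" "ball w s \<subseteq> ball z (r z) \<inter> ball w (r w)"
      by (rule openE[of "ball z (r z) \<inter> ball w (r w)" w]) (use w r(1)[OF wP] in auto)
    show ?thesis
    proof (rule AE_ball_const_unique[OF s(1)])
      show "AE u in lebesgue. u \<in> ball w s \<longrightarrow> p u = k w"
        using k[OF wP] by eventually_elim (use s(2) in blast)
      show "AE u in lebesgue. u \<in> ball w s \<longrightarrow> p u = k z"
        using k[OF z] by eventually_elim (use s(2) in blast)
    qed
  qed
  have kc: "k x = c T \<and> p x = c T" if t: "t \<in> \<T>h" "x \<in> interior t" and T: "T \<in> \<T>H" "t \<subseteq> G ` T" for x t T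
  proof -
    have "t \<in> block T" using t(1) T(2) by (simp add: block_def)
    then have tK: "interior t \<subseteq> interior (\<Union>(block T))" by (intro interior_mono) auto
    have "interior t \<subseteq> perf_dom" unfolding fine_cover using t(1) by (intro interior_mono) auto
    then have xP: "x \<in> perf_dom" using t(2) by blast
    obtain s where s: "s > 0" "ball x s \<subseteq> interior t \<inter> ball x (r x)"
      by (rule openE[of "interior t \<inter> ball x (r x)" x]) (use t(2) r(1)[OF xP] in auto)
    have "k x = c T"
    proof (rule AE_ball_const_unique[OF s(1)])
      show "AE u in lebesgue. u \<in> ball x s \<longrightarrow> p u = c T"
        using s(2) tK p[OF T(1)] by (intro AE_I2) blast
      show "AE u in lebesgue. u \<in> ball x s \<longrightarrow> p u = k x"
        using k[OF xP] by eventually_elim (use s(2) in blast)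
    qed
    then show ?thesis using p[OF T(1)] t(2) tK by blast
  qed
  have pk: "AE x in lebesgue. x \<in> perf_dom \<longrightarrow> p x = k x"
  proof -
    have "AE z in lebesgue. \<forall>t\<in>\<T>h. z \<notin> frontier t"
      by (rule AE_not_in_triangle_frontiers) (use meshes_finite fine_triangle in auto)
    then show ?thesis
    proof eventually_elim
      case (elim x)
      show ?case
      proof
        assume "x \<in> perf_dom"
        then obtain t where t: "t \<in> \<T>h" "x \<in> t" using perf_dom_subset_fine by blast
        then have ti: "x \<in> interior t" using elim closure_subset[of t] by (auto simp: frontier_def)
        obtain T where "T \<in> \<T>H" "t \<subseteq> G ` T" using refinement t(1) by blast
        then show "p x = k x" using kc[OF t(1) ti] by simp
      qed
    qed
  qed
  define C where "C = (\<Sum>T\<in>\<T>H. \<bar>c T\<bar>)"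
  \<comment> \<open>Every ball around \<open>x\<close> meets the interior of a fine triangle, so \<open>k\<close> takes values of \<open>c\<close> only.\<close>
  have kC: "\<bar>k x\<bar> \<le> C" if x: "x \<in> perf_dom" for x
  proof -
    obtain t where t: "t \<in> \<T>h" "x \<in> t" using x perf_dom_subset_fine by blast
    have "x \<in> closure (interior t)" using t(2) triangle_properties(5)[OF fine_triangle[OF t(1)]] by blast
    then have "ball x (r x) \<inter> interior t \<noteq> {}"
    proof -
      have "x \<in> ball x (r x)" using r(1)[OF x] by simp
      then have "ball x (r x) \<inter> closure (interior t) \<noteq> {}" using \<open>x \<in> closure (interior t)\<close> by blast
      then show ?thesis using open_Int_closure_eq_empty[OF open_ball, of x "r x" "interior t"] by blast
    qed
    then obtain z where z: "z \<in> ball x (r x)" "z \<in> interior t" by blast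
    obtain T where T: "T \<in> \<T>H" "t \<subseteq> G ` T" using refinement t(1) by blast
    have "k x = c T" using loc[OF x z(1)] kc[OF t(1) z(2) T] by simp
    moreover have "\<bar>c T\<bar> \<le> C" unfolding C_def using T(1) meshes_finite(1) by (intro member_le_sum) auto
    ultimately show ?thesis by simp
  qed
  fix \<phi> assume \<phi>: "\<phi> \<in> test_functions perf_dom"
  obtain K where K: "compact K" "K \<subseteq> perf_dom" "\<And>x. x \<notin> K \<Longrightarrow> \<phi> x = 0"
    "\<And>x v. x \<notin> K \<Longrightarrow> frechet_derivative \<phi> (at x) v = 0"
    using test_function_support[OF \<phi>] by metis
  obtain L B0 where L: "L-lipschitz_on UNIV \<phi>" using test_function_bounds[OF \<phi>] by metis
  have \<phi>d: "\<phi> differentiable (at x)" for x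
    using test_functionD(2)[OF \<phi>] by (auto simp: differentiable_def)
  define W where "W x = (if x \<in> perf_dom then k x * \<phi> x else 0)" for x
  define k' where "k' x = (if x \<in> perf_dom then k x else 0)" for x
  have Wd: "(W has_derivative (\<lambda>v. k' x * frechet_derivative \<phi> (at x) v)) (at x)" for x
  proof (cases "x \<in> perf_dom")
    case True
    have "((\<lambda>z. k x * \<phi> z) has_derivative (\<lambda>v. k x * frechet_derivative \<phi> (at x) v)) (at x)"
      by (rule has_derivative_mult_right[OF test_functionD(2)[OF \<phi>]])
    then have "(W has_derivative (\<lambda>v. k x * frechet_derivative \<phi> (at x) v)) (at x)"
    proof (rule has_derivative_transform_within_open[of _ _ x UNIV "ball x (r x)"])
      show "x \<in> ball x (r x)" using r(1)[OF True] by simp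
      show "k x * \<phi> z = W z" if "z \<in> ball x (r x)" for z
        using loc[OF True that] r(2)[OF True] that by (auto simp: W_def)
    qed simp
    then show ?thesis using True by (simp add: k'_def)
  next
    case False
    have "(W has_derivative (\<lambda>v. 0)) (at x)"
    proof (rule has_derivative_transform_within_open[of "\<lambda>_. 0" "\<lambda>_. 0" x UNIV "- K"])
      show "open (- K)" using K(1) by (simp add: compact_imp_closed open_Compl)
      show "x \<in> - K" using False K(2) by blast
      show "0 = W z" if "z \<in> - K" for z using K(3) that by (simp add: W_def)
    qed simp
    then show ?thesis using False by (simp add: k'_def)
  qed
  have Wf: "frechet_derivative W (at x) = (\<lambda>v. k' x * frechet_derivative \<phi> (at x) v)" for x
    using frechet_derivative_at[OF Wd] by simp
  have Wdiff: "W differentiable (at x)" for x using Wd by (auto simp: differentiable_def)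
  have C0: "C \<ge> 0" by (simp add: C_def sum_nonneg)
  have L0: "L \<ge> 0" using L by (rule lipschitz_on_nonneg)
  have "(2 * (C * L))-lipschitz_on UNIV W"
  proof (rule lipschitz_if_partials_bounded[OF convex_UNIV Wdiff])
    fix x and j :: 2
    have "\<bar>k' x\<bar> \<le> C" using kC C0 by (simp add: k'_def)
    moreover have "\<bar>pd j \<phi> x\<bar> \<le> L"
      using abs_frechet_derivative_le_lipschitz[OF L \<phi>d, of x "axis j 1"] by simp
    ultimately show "\<bar>pd j W x\<bar> \<le> C * L" unfolding Wf abs_mult using C0 by (intro mult_mono) auto
  qed (use C0 L0 in simp)
  moreover obtain R where R: "\<And>x. x \<in> K \<Longrightarrow> norm x \<le> R"
    using compact_imp_bounded[OF K(1)] by (auto simp: bounded_iff)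
  have "W x = 0" if "R < norm x" for x
  proof -
    have "x \<notin> K" using R[of x] that by auto
    then show ?thesis using K(3) by (simp add: W_def)
  qed
  ultimately have z: "(\<integral>x. pd j W x \<partial>lebesgue) = 0"
    using Wdiff by (intro integral_frechet_derivative_zero(2)) auto
  have m1: "(\<lambda>x. indicator perf_dom x *\<^sub>R (p x * pd j \<phi> x)) \<in> borel_measurable lebesgue"
  proof -
    have "(\<lambda>x. indicator perf_dom x *\<^sub>R p x) \<in> borel_measurable lebesgue"
      using sq sP borel_measurable_restrict_space_iff[of perf_dom lebesgue p] by (simp add: square_integrable_real)
    moreover have "pd j \<phi> \<in> borel_measurable lebesgue"
      by (rule borel_measurable_frechet_derivative[OF test_functionD(4)[OF \<phi>]]) (use \<phi>d in auto)
    ultimately have "(\<lambda>x. (indicator perf_dom x *\<^sub>R p x) * pd j \<phi> x) \<in> borel_measurable lebesgue"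
      by (rule borel_measurable_times)
    then show ?thesis by (simp add: mult.assoc)
  qed
  have ae: "AE x in lebesgue. indicator perf_dom x *\<^sub>R (p x * pd j \<phi> x) = pd j W x"
    using pk
  proof eventually_elim
    case (elim x)
    then show ?case unfolding Wf by (simp add: k'_def indicator_def)
  qed
  have "(\<integral>x. p x * pd j \<phi> x \<partial>lebesgue_on perf_dom) = (\<integral>x. indicator perf_dom x *\<^sub>R (p x * pd j \<phi> x) \<partial>lebesgue)"
    by (rule integral_restrict_space) (simp add: sP)
  also have "\<dots> = (\<integral>x. pd j W x \<partial>lebesgue)"
    by (rule integral_cong_AE[OF m1 borel_measurable_AE[OF m1 ae] ae])
  finally show "(\<integral>x. p x * pd j \<phi> x \<partial>lebesgue_on perf_dom) = - (\<integral>x. 0 * \<phi> x \<partial>lebesgue_on perf_dom)"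
    using z by simp
qed

lemma jump_free_orthogonal_to_divergences:
  assumes p: "\<And>j. has_weak_partial perf_dom j p (\<lambda>x. 0)" and v: "v \<in> H1_0 perf_dom"
  shows "(\<integral>x. divergence perf_dom v x * p x \<partial>lebesgue_on perf_dom) = 0"
proof -
  have bd: "bounded perf_dom" by (rule bounded_subset_fine[OF perf_dom_subset_fine])
  have vH: "v \<in> H1 perf_dom" using v by (simp add: H1_0_def)
  have "(\<integral>x. divergence perf_dom v x * p x \<partial>lebesgue_on perf_dom)
      = (\<integral>x. (\<Sum>i\<in>UNIV. weak_partial perf_dom i (\<lambda>x. v x $ i) x * p x) \<partial>lebesgue_on perf_dom)"
    by (simp add: divergence_eq sum_distrib_right)
  also have "\<dots> = (\<Sum>i\<in>UNIV. \<integral>x. weak_partial perf_dom i (\<lambda>x. v x $ i) x * p x \<partial>lebesgue_on perf_dom)"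
    by (rule Bochner_Integration.integral_sum)
      (rule square_integrable_mult_integrable[OF has_weak_partialD(2)[OF H1_has_weak_partial[OF vH]] has_weak_partialD(1)[OF p]])
  also have "\<dots> = 0"
    by (rule sum.neutral) (simp add: H1_0_integration_by_parts[OF perf_dom_open bd v p])
  finally show ?thesis .
qed

end

section \<open>The discrete inf-sup condition\<close>

text \<open>Finite-dimensionality enters here: a seminorm that vanishes on the common kernel of finitely many
  linear functionals is bounded by a multiple of the sum of their absolute values.\<close>

lemma seminorm_bounded_by_functionals:
  fixes X :: "('a \<Rightarrow> real) set" and m :: "('a \<Rightarrow> real) \<Rightarrow> real" and l :: "'i \<Rightarrow> ('a \<Rightarrow> real) \<Rightarrow> real"
  assumes "finite J"
    and X: "\<And>x z c. x \<in> X \<Longrightarrow> z \<in> X \<Longrightarrow> (\<lambda>y. x y + c * z y) \<in> X"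
    and l: "\<And>i x z c. i \<in> J \<Longrightarrow> x \<in> X \<Longrightarrow> z \<in> X \<Longrightarrow> l i (\<lambda>y. x y + c * z y) = l i x + c * l i z"
    and m: "\<And>x z c. x \<in> X \<Longrightarrow> z \<in> X \<Longrightarrow> m (\<lambda>y. x y + c * z y) \<le> m x + \<bar>c\<bar> * m z"
    and ker: "\<And>x. x \<in> X \<Longrightarrow> (\<And>i. i \<in> J \<Longrightarrow> l i x = 0) \<Longrightarrow> m x \<le> 0"
  shows "\<exists>C\<ge>0. \<forall>x\<in>X. m x \<le> C * (\<Sum>i\<in>J. \<bar>l i x\<bar>)"
  using assms
proof (induction J arbitrary: X rule: finite_induct)
  case empty
  then show ?case by auto
next
  case (insert j J)
  note X = insert.prems(1) and l = insert.prems(2) and m = insert.prems(3) and ker = insert.prems(4)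
  define X0 where "X0 = {x \<in> X. l j x = 0}"
  have "\<exists>C\<ge>0. \<forall>x\<in>X0. m x \<le> C * (\<Sum>i\<in>J. \<bar>l i x\<bar>)"
  proof (rule insert.IH)
    show "(\<lambda>y. x y + c * z y) \<in> X0" if "x \<in> X0" "z \<in> X0" for x z c
      using that X l[of j x z c] by (simp add: X0_def)
    show "l i (\<lambda>y. x y + c * z y) = l i x + c * l i z" if "i \<in> J" "x \<in> X0" "z \<in> X0" for i x z c
      using that l by (simp add: X0_def)
    show "m (\<lambda>y. x y + c * z y) \<le> m x + \<bar>c\<bar> * m z" if "x \<in> X0" "z \<in> X0" for x z c
      using that m by (simp add: X0_def)
    show "m x \<le> 0" if "x \<in> X0" "\<And>i. i \<in> J \<Longrightarrow> l i x = 0" for x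
      using that ker[of x] by (auto simp: X0_def)
  qed
  then obtain C where C: "C \<ge> 0" "\<And>x. x \<in> X0 \<Longrightarrow> m x \<le> C * (\<Sum>i\<in>J. \<bar>l i x\<bar>)" by blast
  show ?case
  proof (cases "X0 = X")
    case True
    have "\<forall>x\<in>X. m x \<le> C * (\<Sum>i\<in>insert j J. \<bar>l i x\<bar>)"
    proof
      fix x assume "x \<in> X"
      then have "m x \<le> C * (\<Sum>i\<in>J. \<bar>l i x\<bar>)" using C(2) True by simp
      also have "\<dots> \<le> C * (\<Sum>i\<in>insert j J. \<bar>l i x\<bar>)"
        using insert.hyps by (intro mult_left_mono C(1)) simp
      finally show "m x \<le> C * (\<Sum>i\<in>insert j J. \<bar>l i x\<bar>)" .
    qed
    then show ?thesis using C(1) by blast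
  next
    case False
    then obtain x0 where x0: "x0 \<in> X" "l j x0 \<noteq> 0" by (auto simp: X0_def)
    \<comment> \<open>Subtracting a multiple of \<open>x0\<close> moves \<open>x\<close> into the kernel of \<open>l j\<close>, where the induction hypothesis applies.\<close>
    define A where "A = (\<Sum>i\<in>J. \<bar>l i x0\<bar>)"
    define C' where "C' = C + (C * A + \<bar>m x0\<bar>) / \<bar>l j x0\<bar>"
    have A: "A \<ge> 0" by (simp add: A_def sum_nonneg)
    have C': "C' \<ge> C" using C(1) A by (simp add: C'_def)
    have "m x \<le> C' * (\<Sum>i\<in>insert j J. \<bar>l i x\<bar>)" if x: "x \<in> X" for x
    proof -
      define t where "t = l j x / l j x0"
      define x' where "x' y = x y + (- t) * x0 y" for y
      have x'X: "x' \<in> X" unfolding x'_def[abs_def] by (rule X[OF x x0(1)])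
      have lx': "l i x' = l i x - t * l i x0" if "i \<in> insert j J" for i
        unfolding x'_def[abs_def] using l[OF that x x0(1), of "- t"] by simp
      have "l j x' = 0" using lx'[of j] x0(2) by (simp add: t_def)
      then have x'0: "x' \<in> X0" using x'X by (simp add: X0_def)
      have "x = (\<lambda>y. x' y + t * x0 y)" by (simp add: x'_def fun_eq_iff)
      then have "m x \<le> m x' + \<bar>t\<bar> * m x0" using m[OF x'X x0(1), of t] by simp
      also have "\<dots> \<le> C * (\<Sum>i\<in>J. \<bar>l i x'\<bar>) + \<bar>t\<bar> * \<bar>m x0\<bar>"
        by (intro add_mono C(2) x'0 mult_left_mono) auto
      also have "(\<Sum>i\<in>J. \<bar>l i x'\<bar>) \<le> (\<Sum>i\<in>J. \<bar>l i x\<bar> + \<bar>t\<bar> * \<bar>l i x0\<bar>)"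
      proof (rule sum_mono)
        fix i assume "i \<in> J"
        then have "l i x' = l i x - t * l i x0" by (intro lx') simp
        then show "\<bar>l i x'\<bar> \<le> \<bar>l i x\<bar> + \<bar>t\<bar> * \<bar>l i x0\<bar>"
          using abs_triangle_ineq4[of "l i x" "t * l i x0"] by (simp add: abs_mult)
      qed
      also have "\<dots> = (\<Sum>i\<in>J. \<bar>l i x\<bar>) + \<bar>t\<bar> * A"
        by (simp add: sum.distrib sum_distrib_left A_def)
      finally have "m x \<le> C * ((\<Sum>i\<in>J. \<bar>l i x\<bar>) + \<bar>t\<bar> * A) + \<bar>t\<bar> * \<bar>m x0\<bar>"
        using C(1) by (simp add: mult_left_mono)
      also have "\<dots> = C * (\<Sum>i\<in>J. \<bar>l i x\<bar>) + (C * A + \<bar>m x0\<bar>) / \<bar>l j x0\<bar> * \<bar>l j x\<bar>"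
        using x0(2) by (simp add: t_def abs_divide field_simps)
      also have "\<dots> \<le> C' * (\<Sum>i\<in>J. \<bar>l i x\<bar>) + C' * \<bar>l j x\<bar>"
        using C' C(1) A by (intro add_mono mult_right_mono) (auto simp: C'_def sum_nonneg)
      also have "\<dots> = C' * (\<Sum>i\<in>insert j J. \<bar>l i x\<bar>)"
        using insert.hyps by (simp add: distrib_left)
      finally show ?thesis .
    qed
    then show ?thesis using C' C(1) by (intro exI[of _ C']) auto
  qed
qed

lemma h1_norm_uminus:
  assumes U: "open U" "bounded U" and u: "u \<in> H1 U"
  shows "h1_norm U (\<lambda>x. - u x) = h1_norm U u"
    and "AE x in lebesgue_on U. divergence U (\<lambda>x. - u x) x = - divergence U u x"
    and "(\<lambda>x. - u x) \<in> H1 U"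
proof -
  have w: "has_weak_partial U j (\<lambda>x. (- u x) $ i) (\<lambda>x. - weak_partial U j (\<lambda>x. u x $ i) x)" for i j
    using has_weak_partial_cmult[OF H1_has_weak_partial[OF u, of j i], of "-1"] by simp
  then show H: "(\<lambda>x. - u x) \<in> H1 U" unfolding H1_def by blast
  have w1: "AE x in lebesgue_on U. weak_partial U j (\<lambda>x. (- u x) $ i) x = - weak_partial U j (\<lambda>x. u x $ i) x" for i j
    by (rule weak_partial_AE_eq[OF U w])
  have "AE x in lebesgue_on U. \<forall>i\<in>UNIV. \<forall>j\<in>UNIV. weak_partial U j (\<lambda>x. (- u x) $ i) x = - weak_partial U j (\<lambda>x. u x $ i) x"
    by (rule AE_finite_allI[OF finite])+ (rule w1)
  then have g: "AE x in lebesgue_on U. grad U (\<lambda>x. - u x) x = - grad U u x"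
    by eventually_elim (simp add: grad_def vec_eq_iff)
  then show "AE x in lebesgue_on U. divergence U (\<lambda>x. - u x) x = - divergence U u x"
    by eventually_elim (simp add: divergence_def trace_def sum_negf)
  have "l2_norm U (grad U (\<lambda>x. - u x)) = l2_norm U (grad U u)"
    unfolding l2_norm_def
  proof (rule arg_cong[where f = sqrt], rule integral_cong_AE)
    show "AE x in lebesgue_on U. (norm (grad U (\<lambda>x. - u x) x))\<^sup>2 = (norm (grad U u x))\<^sup>2"
      using g by eventually_elim simp
  qed (use l2_norm_le_h1_norm(3)[OF u] l2_norm_le_h1_norm(3)[OF H] in \<open>auto simp: square_integrable_def intro!: borel_measurable_power\<close>)
  moreover have "l2_norm U (\<lambda>x. - u x) = l2_norm U u" by (simp add: l2_norm_def)
  ultimately show "h1_norm U (\<lambda>x. - u x) = h1_norm U u" by (simp add: h1_norm_def)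
qed

text \<open>Both \<open>u\<close> and \<open>- u\<close> compete in the supremum, which bounds the absolute value of the integral.\<close>

lemma abs_divergence_integral_le_sup_quotient:
  fixes p :: "pt \<Rightarrow> real"
  assumes U: "open U" "bounded U" and u: "u \<in> H1 U" "u \<in> V" "(\<lambda>x. - u x) \<in> V"
    and p: "square_integrable U p" and q: "sup_quotient U V p = ennreal q" "q \<ge> 0"
  shows "\<bar>\<integral>x. divergence U u x * p x \<partial>lebesgue_on U\<bar> \<le> h1_norm U u * q"
proof -
  note m = divergence_square_integrable[OF u(1)] divergence_square_integrable[OF h1_norm_uminus(3)[OF U u(1)]]
  have h0: "h1_norm U u \<ge> 0" by (simp add: h1_norm_def)
  show ?thesis
  proof (cases "h1_norm U u = 0")
    case True
    have "(\<integral>x. divergence U u x * p x \<partial>lebesgue_on U) = (\<integral>x. 0 \<partial>lebesgue_on U)"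
    proof (rule integral_cong_AE)
      show "AE x in lebesgue_on U. divergence U u x * p x = 0"
        using divergence_AE_zero[OF u(1) True] by eventually_elim simp
    qed (use m p in \<open>auto simp: square_integrable_real intro!: borel_measurable_times\<close>)
    then show ?thesis using True by simp
  next
    case False
    then have hp: "h1_norm U u > 0" using h0 by simp
    have bound: "(\<integral>x. divergence U v x * p x \<partial>lebesgue_on U) / h1_norm U v \<le> q"
      if v: "v \<in> V" "h1_norm U v \<noteq> 0" for v
    proof -
      have "ennreal ((\<integral>x. divergence U v x * p x \<partial>lebesgue_on U) / h1_norm U v) \<le> ennreal q"
        unfolding q(1)[symmetric] sup_quotient_def using v by (intro SUP_upper) auto
      then show ?thesis using q(2) by (simp add: ennreal_le_iff)
    qed
    have "(\<integral>x. divergence U (\<lambda>x. - u x) x * p x \<partial>lebesgue_on U) = (\<integral>x. - (divergence U u x * p x) \<partial>lebesgue_on U)"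
    proof (rule integral_cong_AE)
      show "AE x in lebesgue_on U. divergence U (\<lambda>x. - u x) x * p x = - (divergence U u x * p x)"
        using h1_norm_uminus(2)[OF U u(1)] by eventually_elim simp
    qed (use m p in \<open>auto simp: square_integrable_real intro!: borel_measurable_times borel_measurable_uminus\<close>)
    then have "(- (\<integral>x. divergence U u x * p x \<partial>lebesgue_on U)) / h1_norm U u \<le> q"
      using bound[OF u(3)] h1_norm_uminus(1)[OF U u(1)] False by simp
    then have "- (\<integral>x. divergence U u x * p x \<partial>lebesgue_on U) \<le> q * h1_norm U u"
      by (rule pos_divide_le_eq[OF hp, THEN iffD1])
    moreover have "(\<integral>x. divergence U u x * p x \<partial>lebesgue_on U) \<le> q * h1_norm U u"
      using bound[OF u(2) False] by (rule pos_divide_le_eq[OF hp, THEN iffD1])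
    ultimately show ?thesis unfolding mult.commute[of "h1_norm U u" q] by linarith
  qed
qed

lemma field_span_basis:
  assumes "f \<in> F"
  shows "f \<in> field_span F" "(\<lambda>x. - f x) \<in> field_span F"
proof -
  have "(\<lambda>x. \<Sum>h\<in>{f}. (\<lambda>_. a) h *\<^sub>R h x) \<in> field_span F" for a
    unfolding field_span_def
    by (intro CollectI exI[of _ "{f}"] exI[of _ "\<lambda>_. a"]) (use assms in auto)
  from this[of 1] this[of "-1"] show "f \<in> field_span F" "(\<lambda>x. - f x) \<in> field_span F" by simp_all
qed

context perforated_grid begin

lemma finite_anchors: "finite anchors"
proof -
  have "mesh_edges \<T>H \<subseteq> (\<Union>T\<in>\<T>H. {F. F face_of T})" by (auto simp: mesh_edges_def)
  moreover have "finite (\<Union>T\<in>\<T>H. {F. F face_of T})"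
    using meshes_finite(1) coarse_triangle simplex_imp_polytope finite_polytope_faces by blast
  ultimately have "finite (mesh_edges \<T>H)" by (rule finite_subset)
  then have "finite coarse_edges" by (simp add: coarse_edges_def Setcompr_eq_image)
  moreover have "finite coarse_nodes"
    using finite_mesh_vertices[OF meshes(1)] by (simp add: coarse_nodes_def)
  ultimately show ?thesis by (simp add: anchors_def)
qed

lemma Q_off_combination:
  assumes p: "p \<in> Q_off" and q: "q \<in> Q_off"
  shows "(\<lambda>x. p x + c * q x) \<in> Q_off"
proof -
  have bd: "bounded perf_dom" by (rule bounded_subset_fine[OF perf_dom_subset_fine])
  have sq: "square_integrable perf_dom p" "square_integrable perf_dom q"
    and z: "(\<integral>x. p x \<partial>lebesgue_on perf_dom) = 0" "(\<integral>x. q x \<partial>lebesgue_on perf_dom) = 0"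
    using p q by (auto simp: Q_off_def L2_0_def)
  have int: "integrable (lebesgue_on perf_dom) f" if "square_integrable perf_dom f" for f :: "pt \<Rightarrow> real"
    using square_integrable_mult_integrable[OF that has_weak_partialD(1)[OF const_has_weak_partial[OF perf_dom_open bd, of 1 1]]] by simp
  have "(\<integral>x. p x + c * q x \<partial>lebesgue_on perf_dom) = 0"
    using int[OF sq(1)] int[OF sq(2)] z by simp
  moreover have "square_integrable perf_dom (\<lambda>x. p x + c * q x)"
    by (intro square_integrable_add square_integrable_cmult sq)
  moreover have "\<exists>a. \<forall>x\<in>interior (\<Union>K). p x + c * q x = a" if "K \<in> blocks" for K
  proof -
    obtain a b where "\<forall>x\<in>interior (\<Union>K). p x = a" "\<forall>x\<in>interior (\<Union>K). q x = b"
      using p q \<open>K \<in> blocks\<close> unfolding Q_off_def by blast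
    then show ?thesis by (intro exI[of _ "a + c * b"]) simp
  qed
  ultimately show ?thesis by (simp add: Q_off_def L2_0_def)
qed

text \<open>The continuous inf-sup condition enters here, and only qualitatively: it says that a locally constant
  function of mean zero vanishes, which is the connectedness of the perforated domain.\<close>

lemma jump_free_norm_zero:
  assumes C: "C_cont > 0"
    and inf_sup: "\<forall>p\<in>L2_0 perf_dom.
          ennreal (C_cont * l2_norm perf_dom p) \<le> sup_quotient perf_dom (H1_0 perf_dom) p"
    and p: "p \<in> L2_0 perf_dom" "\<And>j. has_weak_partial perf_dom j p (\<lambda>x. 0)"
  shows "l2_norm perf_dom p = 0"
proof -
  have "sup_quotient perf_dom (H1_0 perf_dom) p \<le> 0"
    unfolding sup_quotient_def
    by (rule SUP_least) (simp add: jump_free_orthogonal_to_divergences[OF p(2)])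
  moreover have "ennreal (C_cont * l2_norm perf_dom p) \<le> sup_quotient perf_dom (H1_0 perf_dom) p"
    using inf_sup p(1) by blast
  ultimately have "ennreal (C_cont * l2_norm perf_dom p) \<le> 0" by (rule order_trans[rotated])
  then have "C_cont * l2_norm perf_dom p \<le> 0" by (simp add: ennreal_eq_0_iff)
  then show ?thesis using C l2_norm_nonneg[of perf_dom p] by (simp add: mult_le_0_iff antisym_conv)
qed

end

context stokes_gmsfem begin

lemma interior_edge_basis_function:
  assumes T: "T1 \<in> \<T>H" "T2 \<in> \<T>H" "T1 \<noteq> T2" "e face_of T1" "e face_of T2" "1 simplex e"
    and y: "y \<in> rel_interior e" "G y \<in> perf_dom"
  shows "\<exists>X d k \<beta>. X \<in> anchors \<and> k < M X \<and> \<Phi> X d k \<in> H1 perf_dom \<and> \<beta> \<noteq> 0 \<and>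
    (\<forall>p c1 c2. square_integrable perf_dom p \<longrightarrow> (\<forall>x\<in>interior (\<Union>(block T1)). p x = c1) \<longrightarrow>
     (\<forall>x\<in>interior (\<Union>(block T2)). p x = c2) \<longrightarrow>
     (\<integral>x. divergence perf_dom (\<Phi> X d k) x * p x \<partial>lebesgue_on perf_dom) = \<beta> * (c1 - c2))"
proof -
  let ?E = "edge_set e"
  have ye: "y \<in> e" using y(1) rel_interior_subset by blast
  have GyB: "G y \<notin> B" using perf_dom_disjoint_B[OF y(2)] .
  have GyE: "G y \<in> ?E"
    using ye GyB by (auto simp: edge_set_def intro!: subsetD[OF closure_subset])
  have em: "e \<in> mesh_edges \<T>H" using T by (auto simp: mesh_edges_def)
  have "\<not> G ` e \<subseteq> B" using ye GyB by blast
  then have Ec: "?E \<in> coarse_edges" unfolding coarse_edges_def edge_set_def using em by blast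
  then have EA: "?E \<in> anchors" by (simp add: anchors_def)
  have "\<not> ?E \<subseteq> frontier perf_dom"
    using GyE y(2) perf_dom_open by (auto simp: frontier_def interior_open)
  then obtain d k K g where kK: "k < M ?E" "K \<in> blocks" "?E \<subseteq> \<Union>K" "has_trace K (\<Phi> ?E d k) g"
    "flux {(t, f) \<in> boundary_edges K. f \<subseteq> ?E} g \<noteq> 0"
    using edge_flux Ec by blast
  have KT: "K \<in> {block T1, block T2}"
    using block_contains_edge_set_iff(1)[OF T y] kK(2,3) by blast
  have "M ?E \<le> n ?E" using selected EA by blast
  then have "k < n ?E" using kK(1) by simp
  then have snap: "\<Phi>t ?E k \<in> snap_space \<delta> ?E"
    using eigenproblem EA unfolding eigensystem_def by blast
  define \<omega> where "\<omega> x = pou ?E x * \<Phi>t ?E k x $ d" for x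
  note \<omega>p = weighted_field_properties[OF partition EA snap, where d = d, folded \<omega>_def]
  have ext: "stokes_extension ?E (\<lambda>x. axis d (\<omega> x)) (\<Phi> ?E d k)"
    using offline_basis EA kK(1) unfolding \<omega>_def by blast
  have nb: "nbhd ?E = block T1 \<union> block T2"
    unfolding nbhd_def using block_contains_edge_set_iff(1)[OF T y] by simp
  interpret ebf: edge_basis_function \<Omega> B G \<T>H \<T>h e T1 T2 y \<omega> d "\<Phi> ?E d k" K g
  proof unfold_locales
    show "stokes_minimizer K' (\<lambda>x. axis d (\<omega> x)) (\<Phi> ?E d k)" if "K' \<in> {block T1, block T2}" for K'
      using ext that block_contains_edge_set_iff(2,3)[OF T y] nb unfolding stokes_extension_def by blast
    show "\<Phi> ?E d k x = 0" if "x \<notin> \<Union>(nbhd ?E)" for x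
      using ext that unfolding stokes_extension_def by blast
  qed (fact T y \<omega>p KT kK(4,5))+
  show ?thesis
    using EA kK(1) ebf.\<Phi>_H1 ebf.divergence_measures_jump by blast
qed

lemma discrete_inf_sup:
  assumes C: "C_cont > 0"
    and inf_sup: "\<forall>p\<in>L2_0 perf_dom.
          ennreal (C_cont * l2_norm perf_dom p) \<le> sup_quotient perf_dom (H1_0 perf_dom) p"
  shows "\<exists>C>0. \<forall>p\<in>Q_off. ennreal (C * l2_norm perf_dom p) \<le> sup_quotient perf_dom (V_off M \<Phi>) p"
proof -
  have bd: "bounded perf_dom" by (rule bounded_subset_fine[OF perf_dom_subset_fine])
  define F where "F = {\<Phi> X d k | X d k. X \<in> anchors \<and> k < M X}"
  define J where "J = F \<inter> H1 perf_dom"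
  define l where "l u p = (\<integral>x. divergence perf_dom u x * p x \<partial>lebesgue_on perf_dom)" for u and p :: "pt \<Rightarrow> real"
  have "F = (\<lambda>(X, d, k). \<Phi> X d k) ` (SIGMA X:anchors. UNIV \<times> {..<M X})"
    by (force simp: F_def)
  then have "finite F" using finite_anchors by simp
  then have fJ: "finite J" by (simp add: J_def)
  have Qsq: "square_integrable perf_dom p" if "p \<in> Q_off" for p
    using that by (simp add: Q_off_def L2_0_def)
  have "\<exists>c\<ge>0. \<forall>p\<in>Q_off. l2_norm perf_dom p \<le> c * (\<Sum>u\<in>J. \<bar>l u p\<bar>)"
  proof (rule seminorm_bounded_by_functionals[OF fJ Q_off_combination])
    show "l u (\<lambda>y. p y + c * q y) = l u p + c * l u q" if u: "u \<in> J" and pq: "p \<in> Q_off" "q \<in> Q_off" for u p q c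
    proof -
      have s: "square_integrable perf_dom (divergence perf_dom u)"
        using u by (simp add: J_def divergence_square_integrable)
      have "l u (\<lambda>y. p y + c * q y) = (\<integral>x. divergence perf_dom u x * p x + c * (divergence perf_dom u x * q x) \<partial>lebesgue_on perf_dom)"
        unfolding l_def by (simp add: algebra_simps)
      also have "\<dots> = l u p + c * l u q"
        unfolding l_def
        using square_integrable_mult_integrable[OF s Qsq[OF pq(1)]] square_integrable_mult_integrable[OF s Qsq[OF pq(2)]]
        by simp
      finally show ?thesis .
    qed
    show "l2_norm perf_dom (\<lambda>y. p y + c * q y) \<le> l2_norm perf_dom p + \<bar>c\<bar> * l2_norm perf_dom q"
      if "p \<in> Q_off" "q \<in> Q_off" for p q c
      using l2_norm_add_le[OF Qsq[OF that(1)] square_integrable_cmult[OF Qsq[OF that(2)], of c]]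
      by (simp add: l2_norm_cmult)
    fix p assume p: "p \<in> Q_off" and lz: "\<And>u. u \<in> J \<Longrightarrow> l u p = 0"
    have "\<forall>T\<in>\<T>H. \<exists>a. \<forall>x\<in>interior (\<Union>(block T)). p x = a"
    proof
      fix T assume T: "T \<in> \<T>H"
      show "\<exists>a. \<forall>x\<in>interior (\<Union>(block T)). p x = a"
      proof (cases "block T = {}")
        case False
        then show ?thesis using p block_in_blocks[OF T] unfolding Q_off_def by blast
      qed simp
    qed
    then obtain c where c: "\<And>T x. T \<in> \<T>H \<Longrightarrow> x \<in> interior (\<Union>(block T)) \<Longrightarrow> p x = c T" by metis
    have jump: "c T1 = c T2" if T: "T1 \<in> \<T>H" "T2 \<in> \<T>H" "T1 \<noteq> T2" "e face_of T1" "e face_of T2" "1 simplex e"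
      and y: "y \<in> rel_interior e" "G y \<in> perf_dom" for e T1 T2 y
    proof -
      obtain X d k \<beta> where X: "X \<in> anchors" "k < M X" "\<Phi> X d k \<in> H1 perf_dom" "\<beta> \<noteq> 0"
        and int: "\<And>p c1 c2. square_integrable perf_dom p \<Longrightarrow> \<forall>x\<in>interior (\<Union>(block T1)). p x = c1 \<Longrightarrow>
         \<forall>x\<in>interior (\<Union>(block T2)). p x = c2 \<Longrightarrow>
         (\<integral>x. divergence perf_dom (\<Phi> X d k) x * p x \<partial>lebesgue_on perf_dom) = \<beta> * (c1 - c2)"
        using interior_edge_basis_function[OF T y] by blast
      have "\<Phi> X d k \<in> J" using X by (auto simp: J_def F_def)
      then have "l (\<Phi> X d k) p = 0" by (rule lz)
      moreover have "l (\<Phi> X d k) p = \<beta> * (c T1 - c T2)"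
        unfolding l_def by (rule int[OF Qsq[OF p]]) (use c T(1,2) in auto)
      ultimately show ?thesis using X(4) by simp
    qed
    have jf: "jump_free p c" unfolding jump_free_def using c jump by blast
    have "has_weak_partial perf_dom j p (\<lambda>x. 0)" for j
      by (rule jump_free_weak_partial[OF jf Qsq[OF p]])
    moreover have "p \<in> L2_0 perf_dom" using p by (simp add: Q_off_def)
    ultimately show "l2_norm perf_dom p \<le> 0"
      using jump_free_norm_zero[OF C inf_sup, of p] by simp
  qed
  then obtain c where c: "c \<ge> 0" "\<And>p. p \<in> Q_off \<Longrightarrow> l2_norm perf_dom p \<le> c * (\<Sum>u\<in>J. \<bar>l u p\<bar>)" by blast
  define H where "H = (\<Sum>u\<in>J. h1_norm perf_dom u)"
  have H: "H \<ge> 0" unfolding H_def by (rule sum_nonneg) (simp add: h1_norm_def)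
  have cH: "c * H + 1 > 0" using c(1) H by (simp add: add_nonneg_pos)
  have "ennreal (1 / (c * H + 1) * l2_norm perf_dom p) \<le> sup_quotient perf_dom (V_off M \<Phi>) p" if p: "p \<in> Q_off" for p
  proof (cases "sup_quotient perf_dom (V_off M \<Phi>) p")
    case (real q)
    have "\<bar>l u p\<bar> \<le> h1_norm perf_dom u * q" if u: "u \<in> J" for u
    proof -
      have uV: "u \<in> V_off M \<Phi>" "(\<lambda>x. - u x) \<in> V_off M \<Phi>"
        using field_span_basis[of u F] u by (auto simp: J_def V_off_def F_def)
      have uH: "u \<in> H1 perf_dom" using u by (simp add: J_def)
      show ?thesis
        unfolding l_def
        by (rule abs_divergence_integral_le_sup_quotient[OF perf_dom_open bd uH uV Qsq[OF p] real(2,1)])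
    qed
    then have "(\<Sum>u\<in>J. \<bar>l u p\<bar>) \<le> H * q"
      unfolding H_def sum_distrib_right by (rule sum_mono)
    then have "l2_norm perf_dom p \<le> c * (H * q)"
      using c(2)[OF p] mult_left_mono[OF _ c(1)] order_trans by blast
    also have "\<dots> \<le> (c * H + 1) * q" using real(1) by (simp add: algebra_simps)
    finally have "1 / (c * H + 1) * l2_norm perf_dom p \<le> q" using cH by (simp add: pos_divide_le_eq mult.commute)
    then show ?thesis using real by (simp add: ennreal_leI)
  qed simp
  moreover have "1 / (c * H + 1) > 0" using cH by simp
  ultimately show ?thesis by blast
qed

end

theorem lemma5p1:
  fixes \<Omega> B :: "pt set" and G :: "pt \<Rightarrow> pt" and \<T>H \<T>h :: "pt set set"
    and \<delta> :: "pt set \<Rightarrow> pt set \<Rightarrow> pt \<Rightarrow> real"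
    and pou :: "pt set \<Rightarrow> pt \<Rightarrow> real"
    and n M :: "pt set \<Rightarrow> nat"
    and ev :: "pt set \<Rightarrow> nat \<Rightarrow> real"
    and \<Phi>t :: "pt set \<Rightarrow> nat \<Rightarrow> field"
    and \<Phi> :: "pt set \<Rightarrow> 2 \<Rightarrow> nat \<Rightarrow> field"
    and C_cont :: real
  assumes setting: "stokes_gmsfem \<Omega> B G \<T>H \<T>h \<delta> pou n ev \<Phi>t M \<Phi>"
    and C_cont_pos: "C_cont > 0"
    and cont_inf_sup: "\<forall>p\<in>L2_0 (\<Omega> - B).
          ennreal (C_cont * l2_norm (\<Omega> - B) p) \<le> sup_quotient (\<Omega> - B) (H1_0 (\<Omega> - B)) p"
  shows "\<exists>C_infsup>0. \<forall>p\<in>grid_data.Q_off \<Omega> B G \<T>H \<T>h.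
          ennreal (C_infsup * l2_norm (\<Omega> - B) p)
          \<le> sup_quotient (\<Omega> - B) (grid_data.V_off \<Omega> B G \<T>H M \<Phi>) p"
proof -
  interpret stokes_gmsfem \<Omega> B G \<T>H \<T>h \<delta> pou n ev \<Phi>t M \<Phi> by (rule setting)
  show ?thesis
    using discrete_inf_sup[of C_cont] C_cont_pos cont_inf_sup by (simp only: perf_dom_def)
qed

end
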